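(* Let $\mathsf{M}$ be a $d\times d$ real-valued expansive matrix. Then there exist two real-valued functions $\phi,\psi$ in the Schwartz class on $\mathbb{R}^d$ such that (i) for all integers $J$, the nonhomogeneous system generated by $\phi$ and $\psi$ is a tight $\mathsf{M}$-wavelet frame in $L_2(\mathbb{R}^d)$: $$\|f\|^2_{L_2(\mathbb{R}^d)}=\sum_{k\in\mathbb{Z}^d}|\langle f,\phi_{\mathsf{M}^J;k}\rangle|^2+\sum_{j=J}^\infty\sum_{k\in\mathbb{Z}^d}|\langle f,\psi_{\mathsf{M}^j;k}\rangle|^2\qquad\forall f\in L_2(\mathbb{R}^d);$$ (ii) $\hat\phi$ and $\hat\psi$ are compactly supported $C^\infty$ even functions; (iii) $\hat\psi$ vanishes in a neighborhood of the origin (i.e., $\psi$ has arbitrarily high vanishing moments); (iv) there exist $2\pi\mathbb{Z}^d$-periodic functions $\mathbf{a}_k,\mathbf{b}_k$, $k\in\mathbb{Z}^d$, in $C^\infty(\mathbb{T}^d)$ such that $$e^{-ik\cdot\mathsf{M}^T\xi}\hat\phi(\mathsf{M}^T\xi)=\mathbf{a}_k(\xi)\hat\phi(\xi)\quad\text{and}\quad e^{-ik\cdot\mathsf{M}^T\xi}\hat\psi(\mathsf{M}^T\xi)=\mathbf{b}_k(\xi)\hat\phi(\xi),\qquad \xi\in\mathbb{R}^d,\ k\in\mathbb{Z}^d.$$ Moreover, $\{\psi_{\mathsf{M}^j;k}: j\in\mathbb{Z},k\in\mathbb{Z}^d\}$ is a homogeneous tight $\mathsf{M}$-wavelet frame in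 $L_2(\mathbb{R}^d)$ satisfying $$\|f\|^2_{L_2(\mathbb{R}^d)}=\sum_{j\in\mathbb{Z}}\sum_{k\in\mathbb{Z}^d}|\langle f,\psi_{\mathsf{M}^j;k}\rangle|^2\qquad\forall f\in L_2(\mathbb{R}^d).$$
   Context: For $f:\mathbb{R}^d\to\mathbb{C}$, a $d\times d$ real invertible matrix $U$ and $k\in\mathbb{R}^d$, put $f_{U;k}(x):=|\det U|^{1/2}f(Ux-k)$. A matrix is expansive if all its eigenvalues have modulus greater than one. $\langle f,g\rangle=\int_{\mathbb{R}^d}f\overline{g}$. The Fourier transform is $\hat f(\xi)=\int_{\mathbb{R}^d}f(x)e^{-ix\cdot\xi}\,dx$. $C^\infty(\mathbb{T}^d)$ denotes the $2\pi\mathbb{Z}^d$-periodic $C^\infty$ functions on $\mathbb{R}^d$. *)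

theory Defs
  imports "HOL-Analysis.Analysis"
begin

definition eigenvalue :: "'a::field ^ 'n ^ 'n \<Rightarrow> 'a \<Rightarrow> bool"
  where "eigenvalue A c \<longleftrightarrow> (\<exists>v. v \<noteq> 0 \<and> A *v v = c *s v)"

(* Eigenvalues are taken over the complex numbers, although the matrix is real. *)
definition expansive :: "real ^ 'n ^ 'n \<Rightarrow> bool"
  where "expansive M \<longleftrightarrow>
    (\<forall>c. eigenvalue (\<chi> i j. complex_of_real (M $ i $ j)) c \<longrightarrow> cmod c > 1)"

(* Integer powers for the matrix product **; negative powers are powers of the inverse. *)
definition matrix_powi :: "real ^ 'n ^ 'n \<Rightarrow> int \<Rightarrow> real ^ 'n ^ 'n"
  where "matrix_powi M j =
    (if j \<ge> 0 then (((**) M) ^^ nat j) (mat 1)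
     else (((**) (matrix_inv M)) ^^ nat (- j)) (mat 1))"

definition int_lattice :: "(real ^ 'n) set"
  where "int_lattice = {k. \<forall>i. k $ i \<in> \<int>}"

definition dilate_shift ::
    "real ^ 'n ^ 'n \<Rightarrow> real ^ 'n \<Rightarrow> (real ^ 'n \<Rightarrow> complex) \<Rightarrow> real ^ 'n \<Rightarrow> complex"
  where "dilate_shift U k f x = complex_of_real (sqrt \<bar>det U\<bar>) * f (U *v x - k)"

(* L2 consists of functions, not of classes modulo null sets; the quantities below do not
   depend on the representative. *)
definition L2 :: "(real ^ 'n \<Rightarrow> complex) set"
  where "L2 = {f. f \<in> borel_measurable lebesgue \<and> integrable lebesgue (\<lambda>x. (cmod (f x))\<^sup>2)}"

definition L2_norm_sq :: "(real ^ 'n \<Rightarrow> complex) \<Rightarrow> real"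
  where "L2_norm_sq f = (LINT x|lebesgue. (cmod (f x))\<^sup>2)"

definition L2_inner :: "(real ^ 'n \<Rightarrow> complex) \<Rightarrow> (real ^ 'n \<Rightarrow> complex) \<Rightarrow> complex"
  where "L2_inner f g = (LINT x|lebesgue. f x * cnj (g x))"

(* Meaningful for integrable f only, since the Bochner integral is 0 otherwise. *)
definition fourier :: "(real ^ 'n \<Rightarrow> complex) \<Rightarrow> real ^ 'n \<Rightarrow> complex"
  where "fourier f \<xi> = (LINT x|lebesgue. f x * exp (- (\<i> * complex_of_real (x \<bullet> \<xi>))))"

definition partial_deriv :: "'n \<Rightarrow> (real ^ 'n \<Rightarrow> complex) \<Rightarrow> real ^ 'n \<Rightarrow> complex"
  where "partial_deriv i f x = frechet_derivative f (at x) (axis i 1)"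

(* A higher-order partial derivative is given by the list of its directions. *)
definition partial_derivs :: "'n list \<Rightarrow> (real ^ 'n \<Rightarrow> complex) \<Rightarrow> real ^ 'n \<Rightarrow> complex"
  where "partial_derivs is f = foldr partial_deriv is f"

(* C-infinity: partial derivatives of all orders exist and are differentiable, hence continuous. *)
definition smooth :: "(real ^ 'n \<Rightarrow> complex) \<Rightarrow> bool"
  where "smooth f \<longleftrightarrow> (\<forall>is. partial_derivs is f differentiable_on UNIV)"

definition monomial :: "('n \<Rightarrow> nat) \<Rightarrow> real ^ 'n \<Rightarrow> real"
  where "monomial \<alpha> x = (\<Prod>i\<in>UNIV. (x $ i) ^ \<alpha> i)"

definition schwartz :: "(real ^ 'n \<Rightarrow> complex) set"
  where "schwartz = {f. smooth f \<and>
    (\<forall>\<alpha> is. bounded (range (\<lambda>x. complex_of_real (monomial \<alpha> x) * partial_derivs is f x)))}"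

definition smooth_torus :: "(real ^ 'n \<Rightarrow> complex) set"
  where "smooth_torus = {g. smooth g \<and>
    (\<forall>k\<in>int_lattice. \<forall>\<xi>. g (\<xi> + (2 * pi) *\<^sub>R k) = g \<xi>)}"

definition compactly_supported :: "(real ^ 'n \<Rightarrow> complex) \<Rightarrow> bool"
  where "compactly_supported f \<longleftrightarrow> compact (closure {x. f x \<noteq> 0})"

definition even_fun :: "(real ^ 'n \<Rightarrow> complex) \<Rightarrow> bool"
  where "even_fun f \<longleftrightarrow> (\<forall>x. f (- x) = f x)"

(* The energy of the coefficients of f with respect to the shifts at one scale U.
   The value is an extended nonnegative real: there every family is summable, so that an
   equation between such sums and a finite quantity includes the convergence of the series. *)
definition level_energy ::
    "(real ^ 'n \<Rightarrow> complex) \<Rightarrow> real ^ 'n ^ 'n \<Rightarrow> (real ^ 'n \<Rightarrow> complex) \<Rightarrow> ennreal"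
  where "level_energy g U f =
    (\<Sum>\<^sub>\<infinity>k\<in>int_lattice. ennreal ((cmod (L2_inner f (dilate_shift U k g)))\<^sup>2))"

end

theory Submission
  imports Defs "HOL-Computational_Algebra.Fundamental_Theorem_Algebra" "HOL-Probability.Sinc_Integral"
begin

text \<open>
  Everything is arranged on the Fourier side. Let \<open>T\<close> be the inverse of the transpose of \<open>M\<close>.
  Suppose that \<open>G\<close> is continuous and supported in the unit ball, and let \<open>g\<close> be its inverse Fourier
  transform. The coefficients of \<open>f\<close> with respect to the shifts of \<open>g\<close> at scale \<open>U\<close> are then,
  up to a constant, the Fourier coefficients of a function on the torus, because the support of
  \<open>G\<close> fits into one period and nothing overlaps. Parseval's identity
  (\<open>parseval_torus\<close>) turns the energy at this scale into the integral of
  \<open>\<bar>G (U\<^sup>-\<^sup>T \<eta>)\<bar>\<^sup>2 \<bar>f^ \<eta>\<bar>\<^sup>2 / (2 \<pi>)\<^sup>d\<close> (\<open>level_energy_ift\<close>). By Plancherel's identity a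
  family of such generators is a tight frame as soon as the functions
  \<open>\<bar>G\<^sub>i (U\<^sub>i\<^sup>-\<^sup>T \<eta>)\<bar>\<^sup>2\<close> sum to one (\<open>tight_frame_criterion\<close>).

  Such a partition of unity comes from a smooth mask \<open>s\<close> that is one near the origin, supported in
  the unit ball, and satisfies \<open>s (T x) = 1\<close> wherever \<open>s x \<noteq> 0\<close>. With \<open>s\<^sup>2 + c\<^sup>2 = 1\<close>, the
  transforms of \<open>\<phi>\<close> and \<open>\<psi>\<close> are \<open>s x\<close> and \<open>s (T x) * c x\<close>. The square of the second one is
  \<open>s (T x)\<^sup>2 - s x\<^sup>2\<close>, so the sum over the scales telescopes; along the orbit of a point other than
  the origin the values \<open>s\<^sup>2\<close> are eventually one in one direction and eventually zero in the other,
  so only finitely many terms are nonzero. Taking \<open>s = sin (\<pi> h / 2)\<close> and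
  \<open>c = cos (\<pi> h / 2)\<close> for a smooth step \<open>h\<close> avoids taking the square root of a smooth function.
  The refinement relations hold because \<open>s = 1\<close> on the support of \<open>s\<close> composed with the transpose
  of \<open>M\<close>; the periodic coefficients are periodizations of functions supported in the unit ball.

  The nesting \<open>s x \<noteq> 0 \<Longrightarrow> s (T x) = 1\<close> is where expansiveness enters. The powers of \<open>T\<close> tend to
  zero, so a finite sum \<open>Q\<close> of the squared norms of \<open>T\<^sup>n x\<close> is a quadratic form that \<open>T\<close>
  contracts strictly (\<open>lyapunov_form\<close>), and \<open>h\<close> is a step function of \<open>Q\<close>.

  The analytic tools are developed along the way, each in the generality in which it is used.
  Parseval's identity follows from the Stone-Weierstrass theorem on a product of circles.
  Plancherel's identity follows from Parseval's: the Parseval sums of a function over all shifts of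
  the lattice are equal, and averaging them over a fundamental cell gives the integral of the squared
  transform. Inversion for smooth functions of compact support follows from Plancherel's identity by
  testing against compactly supported functions, and the Schwartz bounds follow since multiplication
  by coordinates and differentiation are exchanged by the transform.
\<close>

section \<open>Lebesgue measure on euclidean space: products and linear changes of variables\<close>

lemma prod_Basis_cart: "(\<Prod>b\<in>(Basis :: (real ^ 'n) set). f b) = (\<Prod>i\<in>UNIV. f (axis i 1))"
proof -
  have "inj (\<lambda>i. axis i (1::real) :: real ^ 'n)" by (auto simp: inj_def axis_eq_axis)
  moreover have B: "(Basis :: (real ^ 'n) set) = (\<lambda>i. axis i 1) ` UNIV" by (auto simp: Basis_vec_def)
  ultimately show ?thesis unfolding B by (subst prod.reindex) auto
qed

lemma box_vec: "box l (u :: real ^ 'n) = {x. \<forall>i. x $ i \<in> {l $ i <..< u $ i}}"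
  by (auto simp: mem_box_cart)

text \<open>
  Lebesgue measure is by definition a product over the basis vectors. Indexing the product by the
  coordinates themselves gives direct access to Fubini's theorem in each coordinate.
\<close>

lemma lborel_vec: "(lborel :: (real ^ 'n) measure) = distr (\<Pi>\<^sub>M i\<in>UNIV. lborel) borel (\<lambda>f. \<chi> i. f i)"
proof (rule lborel_eqI)
  interpret finite_product_sigma_finite "\<lambda>_::'n. lborel :: real measure" UNIV
    by standard simp
  have [measurable]: "(\<lambda>f. \<chi> i. f i) \<in> (\<Pi>\<^sub>M i\<in>UNIV. lborel :: real measure) \<rightarrow>\<^sub>M (borel :: (real ^ 'n) measure)"
    by (rule borel_measurable_euclidean_space[THEN iffD2])
       (auto simp: Basis_vec_def inner_axis)
  fix l u :: "real ^ 'n" assume le: "\<And>b. b \<in> Basis \<Longrightarrow> l \<bullet> b \<le> u \<bullet> b"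
  have le': "l $ i \<le> u $ i" for i using le[of "axis i 1"] by (auto simp: Basis_vec_def inner_axis)
  have "emeasure (distr (\<Pi>\<^sub>M i\<in>UNIV. lborel) borel (\<lambda>f. \<chi> i. f i)) (box l u)
     = emeasure (\<Pi>\<^sub>M i\<in>UNIV. lborel) (\<Pi>\<^sub>E i\<in>UNIV. {l $ i <..< u $ i})"
    by (subst emeasure_distr) (auto simp: box_vec space_PiM intro!: arg_cong[where f = "emeasure _"])
  also have "\<dots> = (\<Prod>i\<in>UNIV. emeasure lborel {l $ i <..< u $ i})"
    by (rule measure_times) auto
  also have "\<dots> = (\<Prod>b\<in>Basis. (u - l) \<bullet> b)"
    using le' by (simp add: prod_Basis_cart inner_axis prod_ennreal)
  finally show "emeasure (distr (\<Pi>\<^sub>M i\<in>UNIV. lborel) borel (\<lambda>f. \<chi> i. f i)) (box l u) = (\<Prod>b\<in>Basis. (u - l) \<bullet> b)" .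
qed simp

lemma measurable_vec_lambda [measurable]:
  "(\<lambda>f. \<chi> i. f i) \<in> (\<Pi>\<^sub>M i\<in>UNIV. lborel :: real measure) \<rightarrow>\<^sub>M (borel :: (real ^ 'n) measure)"
  by (rule borel_measurable_euclidean_space[THEN iffD2]) (auto simp: Basis_vec_def inner_axis)

lemma
  fixes f :: "'n::finite \<Rightarrow> real \<Rightarrow> 'b::{real_normed_field,banach,second_countable_topology}"
  assumes f: "\<And>i. integrable lborel (f i)"
  shows integrable_prod_vec: "integrable lborel (\<lambda>x :: real ^ 'n. \<Prod>i\<in>UNIV. f i (x $ i))"
    and integral_prod_vec: "(LINT x|lborel. (\<Prod>i\<in>UNIV. f i (x $ i))) = (\<Prod>i\<in>UNIV. LINT t|lborel. f i t)"
proof -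
  interpret product_sigma_finite "\<lambda>_::'n. lborel :: real measure"
    by standard
  have [measurable]: "f i \<in> borel_measurable borel" for i using f[of i] by auto
  have [measurable]: "(\<lambda>x :: real ^ 'n. \<Prod>i\<in>UNIV. f i (x $ i)) \<in> borel_measurable borel"
    by measurable
  show "integrable lborel (\<lambda>x :: real ^ 'n. \<Prod>i\<in>UNIV. f i (x $ i))"
    unfolding lborel_vec using product_integrable_prod[of UNIV f] f
    by (subst integrable_distr_eq) auto
  show "(LINT x|lborel. (\<Prod>i\<in>UNIV. f i (x $ i))) = (\<Prod>i\<in>UNIV. LINT t|lborel. f i t)"
    unfolding lborel_vec using product_integral_prod[of UNIV f] f
    by (subst integral_distr) auto
qed

text \<open>
  The shear moves the coordinate \<open>m\<close> by an amount that depends on the other coordinates only. After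
  integrating over \<open>x $ m\<close> first, this is the translation invariance of the measure on the line.
\<close>

lemma nn_integral_lborel_shear:
  fixes h :: "real ^ 'n \<Rightarrow> ennreal"
  assumes [measurable]: "h \<in> borel_measurable borel" and "m \<noteq> n"
  shows "(\<integral>\<^sup>+x. h (\<chi> i. if i = m then x $ m + x $ n else x $ i) \<partial>lborel) = (\<integral>\<^sup>+x. h x \<partial>lborel)"
proof -
  interpret product_sigma_finite "\<lambda>_::'n. lborel :: real measure"
    by standard
  let ?P = "\<lambda>I. \<Pi>\<^sub>M i\<in>I. lborel :: real measure"
  let ?S = "\<lambda>x :: real ^ 'n. \<chi> i. if i = m then x $ m + x $ n else x $ i"
  let ?I = "UNIV - {m}"
  have U: "insert m ?I = UNIV" by auto
  have [measurable]: "?S \<in> borel \<rightarrow>\<^sub>M borel"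
    by (intro borel_measurable_continuous_onI linear_continuous_on)
       (auto simp: linear_conv_bounded_linear[symmetric] linear_iff vec_eq_iff algebra_simps)
  have g: "(\<integral>\<^sup>+x. g x \<partial>lborel) = (\<integral>\<^sup>+x. (\<integral>\<^sup>+y. g (\<chi> i. (x(m := y)) i) \<partial>lborel) \<partial>?P ?I)"
    if [measurable]: "g \<in> borel_measurable borel" for g :: "real ^ 'n \<Rightarrow> ennreal"
  proof -
    have "(\<integral>\<^sup>+x. g x \<partial>lborel) = (\<integral>\<^sup>+x. g (\<chi> i. x i) \<partial>?P UNIV)"
      unfolding lborel_vec by (subst nn_integral_distr) auto
    also have "\<dots> = (\<integral>\<^sup>+x. (\<integral>\<^sup>+y. g (\<chi> i. (x(m := y)) i) \<partial>lborel) \<partial>?P ?I)"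
      using product_nn_integral_insert[of ?I m "\<lambda>x. g (\<chi> i. x i)"] unfolding U by simp
    finally show ?thesis .
  qed
  have "(\<integral>\<^sup>+y. h (?S (\<chi> i. (x(m := y)) i)) \<partial>lborel) = (\<integral>\<^sup>+y. h (\<chi> i. (x(m := y)) i) \<partial>lborel)" for x
  proof -
    have [measurable]: "(\<lambda>y. (\<chi> i. (x(m := y)) i) :: real ^ 'n) \<in> borel \<rightarrow>\<^sub>M borel"
      by (rule borel_measurable_euclidean_space[THEN iffD2])
         (auto simp: Basis_vec_def inner_axis)
    have "?S (\<chi> i. (x(m := y)) i) = (\<chi> i. (x(m := x n + y)) i)" for y
      using \<open>m \<noteq> n\<close> by (auto simp: vec_eq_iff)
    then have "(\<integral>\<^sup>+y. h (?S (\<chi> i. (x(m := y)) i)) \<partial>lborel) = (\<integral>\<^sup>+y. h (\<chi> i. (x(m := x n + y)) i) \<partial>lborel)"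
      by simp
    also have "\<dots> = (\<integral>\<^sup>+y. h (\<chi> i. (x(m := y)) i) \<partial>lborel)"
    proof -
      have "(\<lambda>y. h (\<chi> i. (x(m := y)) i)) \<in> borel_measurable borel" by measurable
      from nn_integral_real_affine[OF this, of 1 "x n"] show ?thesis by simp
    qed
    finally show ?thesis .
  qed
  then show ?thesis
    using g[of "\<lambda>x. h (?S x)"] g[of h] by simp
qed

lemma nn_integral_lborel_permute:
  fixes h :: "real ^ 'n \<Rightarrow> ennreal"
  assumes [measurable]: "h \<in> borel_measurable borel" and p: "p permutes UNIV"
  shows "(\<integral>\<^sup>+x. h (\<chi> i. x $ p i) \<partial>lborel) = (\<integral>\<^sup>+x. h x \<partial>lborel)"
proof -
  let ?S = "\<lambda>x :: real ^ 'n. \<chi> i. x $ p i"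
  have [measurable]: "?S \<in> borel \<rightarrow>\<^sub>M borel"
    by (intro borel_measurable_continuous_onI linear_continuous_on)
       (auto simp: linear_conv_bounded_linear[symmetric] linear_iff vec_eq_iff)
  have inv: "inv p (p i) = i" "p (inv p i) = i" for i
    using permutes_inverses[OF p] by auto
  have "lborel = distr lborel borel ?S"
  proof (rule lborel_eqI)
    fix l u :: "real ^ 'n" assume le: "\<And>b. b \<in> Basis \<Longrightarrow> l \<bullet> b \<le> u \<bullet> b"
    have le': "l $ i \<le> u $ i" for i using le[of "axis i 1"] by (auto simp: Basis_vec_def inner_axis)
    have eq: "?S -` box l u = box (\<chi> i. l $ inv p i) (\<chi> i. u $ inv p i)"
      by (auto simp: box_vec) (metis inv)+
    have "emeasure (distr lborel borel ?S) (box l u) = (\<Prod>i\<in>UNIV. ennreal (u $ inv p i - l $ inv p i))"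
    proof -
      have "\<forall>b\<in>Basis. (\<chi> i. l $ inv p i) \<bullet> b \<le> (\<chi> i. u $ inv p i) \<bullet> b"
        using le' by (auto simp: Basis_vec_def inner_axis)
      then have "emeasure lborel (box (\<chi> i. l $ inv p i) (\<chi> i. u $ inv p i))
          = ennreal (\<Prod>b\<in>Basis. ((\<chi> i. u $ inv p i) - (\<chi> i. l $ inv p i)) \<bullet> b)"
        by (intro emeasure_lborel_box) auto
      then show ?thesis
        using le' by (subst emeasure_distr) (auto simp: eq prod_Basis_cart inner_axis prod_ennreal)
    qed
    also have "\<dots> = (\<Prod>i\<in>UNIV. ennreal (u $ i - l $ i))"
      by (rule prod.reindex_bij_betw) (use permutes_bij[OF permutes_inv[OF p]] in auto)
    also have "\<dots> = (\<Prod>b\<in>Basis. (u - l) \<bullet> b)"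
      using le' by (simp add: prod_Basis_cart inner_axis prod_ennreal)
    finally show "emeasure (distr lborel borel ?S) (box l u) = (\<Prod>b\<in>Basis. (u - l) \<bullet> b)" .
  qed simp
  then have "(\<integral>\<^sup>+x. h x \<partial>lborel) = (\<integral>\<^sup>+x. h x \<partial>distr lborel borel ?S)" by simp
  then show ?thesis by (simp add: nn_integral_distr)
qed

lemma nn_integral_lborel_diagonal:
  fixes h :: "real ^ 'n \<Rightarrow> ennreal"
  assumes [measurable]: "h \<in> borel_measurable borel" and c: "\<And>i. c i \<noteq> 0"
  shows "ennreal \<bar>\<Prod>i\<in>UNIV. c i\<bar> * (\<integral>\<^sup>+x. h (\<chi> i. c i * x $ i) \<partial>lborel) = (\<integral>\<^sup>+x. h x \<partial>lborel)"
proof -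
  let ?c = "\<lambda>b :: real ^ 'n. \<Prod>i\<in>UNIV. if b = axis i 1 then c i else 1"
  let ?T = "\<lambda>x :: real ^ 'n. 0 + (\<Sum>j\<in>Basis. (?c j * (x \<bullet> j)) *\<^sub>R j)"
  have ca: "?c (axis i 1) = c i" for i
    by (simp add: axis_eq_axis)
  have "?c j \<noteq> 0" if "j \<in> Basis" for j using c by simp
  then have "lborel = density (distr lborel borel ?T) (\<lambda>_. (\<Prod>j\<in>Basis. \<bar>?c j\<bar>))"
    by (rule lborel_affine_euclidean)
  moreover have "?T x = (\<chi> i. c i * x $ i)" for x
  proof -
    have "inj (\<lambda>i. axis i (1::real) :: real ^ 'n)" by (auto simp: inj_def axis_eq_axis)
    moreover have B: "(Basis :: (real ^ 'n) set) = (\<lambda>i. axis i 1) ` UNIV" by (auto simp: Basis_vec_def)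
    ultimately have "?T x = (\<Sum>i\<in>UNIV. (c i * x $ i) *\<^sub>R axis i 1)"
      unfolding B by (subst sum.reindex) (simp_all add: ca inner_axis o_def)
    also have "\<dots> = (\<chi> i. c i * x $ i)"
      using basis_expansion[of "\<chi> i. c i * x $ i"] by (simp add: scalar_mult_eq_scaleR)
    finally show ?thesis .
  qed
  moreover have "(\<Prod>j\<in>Basis. \<bar>?c j\<bar>) = \<bar>\<Prod>i\<in>UNIV. c i\<bar>"
  proof -
    have "(\<Prod>j\<in>Basis. \<bar>?c j\<bar>) = (\<Prod>i\<in>UNIV. \<bar>?c (axis i 1)\<bar>)" by (rule prod_Basis_cart)
    also have "\<dots> = (\<Prod>i\<in>UNIV. \<bar>c i\<bar>)" by (simp only: ca)
    finally show ?thesis by (simp only: abs_prod)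
  qed
  ultimately have "lborel = density (distr lborel borel (\<lambda>x :: real ^ 'n. \<chi> i. c i * x $ i)) (\<lambda>_. ennreal \<bar>\<Prod>i\<in>UNIV. c i\<bar>)"
    by (simp only:)
  then have "(\<integral>\<^sup>+x. h x \<partial>lborel) = (\<integral>\<^sup>+x. h x \<partial>density (distr lborel borel (\<lambda>x :: real ^ 'n. \<chi> i. c i * x $ i)) (\<lambda>_. ennreal \<bar>\<Prod>i\<in>UNIV. c i\<bar>))"
    by simp
  moreover have [measurable]: "(\<lambda>x :: real ^ 'n. \<chi> i. c i * x $ i) \<in> borel \<rightarrow>\<^sub>M borel"
    by (intro borel_measurable_continuous_onI linear_continuous_on)
       (auto simp: linear_conv_bounded_linear[symmetric] linear_iff vec_eq_iff algebra_simps)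
  ultimately show ?thesis
    by (simp add: nn_integral_density nn_integral_distr nn_integral_cmult)
qed

lemma measurable_matrix_vector_mult [measurable]:
  "(\<lambda>x. (A :: real ^ 'n ^ 'm) *v x) \<in> borel \<rightarrow>\<^sub>M borel"
  by (intro borel_measurable_continuous_onI continuous_intros)

text \<open>
  The statement is multiplicative in the matrix, so it suffices to treat elementary matrices:
  diagonal ones, coordinate swaps and shears.
\<close>

lemma nn_integral_lborel_linear:
  fixes h :: "real ^ 'n \<Rightarrow> ennreal" and A :: "real ^ 'n ^ 'n"
  assumes "h \<in> borel_measurable borel" and "det A \<noteq> 0"
  shows "ennreal \<bar>det A\<bar> * (\<integral>\<^sup>+x. h (A *v x) \<partial>lborel) = (\<integral>\<^sup>+x. h x \<partial>lborel)"
proof -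
  let ?P = "\<lambda>A :: real ^ 'n ^ 'n. det A \<noteq> 0 \<longrightarrow> (\<forall>h \<in> borel_measurable borel.
     ennreal \<bar>det A\<bar> * (\<integral>\<^sup>+x. h (A *v x) \<partial>lborel) = (\<integral>\<^sup>+x. h x \<partial>lborel))"
  have "?P A"
  proof (rule induct_matrix_elementary_alt)
    fix A B :: "real ^ 'n ^ 'n" assume A: "?P A" and B: "?P B"
    show "?P (A ** B)"
    proof (intro impI ballI)
      fix h :: "real ^ 'n \<Rightarrow> ennreal"
      assume d: "det (A ** B) \<noteq> 0" and [measurable]: "h \<in> borel_measurable borel"
      then have d: "det A \<noteq> 0" "det B \<noteq> 0" by (auto simp: det_mul)
      have "ennreal \<bar>det (A ** B)\<bar> * (\<integral>\<^sup>+x. h ((A ** B) *v x) \<partial>lborel)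
         = ennreal \<bar>det A\<bar> * (ennreal \<bar>det B\<bar> * (\<integral>\<^sup>+x. h (A *v (B *v x)) \<partial>lborel))"
        by (simp add: det_mul abs_mult ennreal_mult mult.assoc matrix_vector_mul_assoc)
      also have "\<dots> = ennreal \<bar>det A\<bar> * (\<integral>\<^sup>+x. h (A *v x) \<partial>lborel)"
        using B[rule_format, OF d(2), of "\<lambda>x. h (A *v x)"] by simp
      also have "\<dots> = (\<integral>\<^sup>+x. h x \<partial>lborel)"
        using A d by simp
      finally show "ennreal \<bar>det (A ** B)\<bar> * (\<integral>\<^sup>+x. h ((A ** B) *v x) \<partial>lborel) = (\<integral>\<^sup>+x. h x \<partial>lborel)" .
    qed
  next
    fix A :: "real ^ 'n ^ 'n" and i assume "row i A = 0"
    then show "?P A" using det_zero_row(2)[of i A] by simp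
  next
    fix A :: "real ^ 'n ^ 'n" assume D: "\<And>i j. i \<noteq> j \<Longrightarrow> A $ i $ j = 0"
    have "A *v x = (\<chi> i. A $ i $ i * x $ i)" for x
    proof -
      have "(\<Sum>j\<in>UNIV. A $ i $ j * x $ j) = (\<Sum>j\<in>UNIV. if j = i then A $ i $ i * x $ i else 0)" for i
        by (intro sum.cong) (auto simp: D)
      then show ?thesis by (simp add: matrix_vector_mult_def vec_eq_iff)
    qed
    moreover have "det A = (\<Prod>i\<in>UNIV. A $ i $ i)" by (rule det_diagonal) (rule D)
    ultimately show "?P A" using nn_integral_lborel_diagonal[of _ "\<lambda>i. A $ i $ i"] by simp
  next
    fix m n :: 'n assume "m \<noteq> n"
    let ?B = "(\<chi> i j. mat 1 $ i $ Transposition.transpose m n j) :: real ^ 'n ^ 'n"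
    have p: "Transposition.transpose m n permutes UNIV" by (simp add: permutes_swap_id)
    have "\<bar>det ?B\<bar> = 1"
      using det_permute_columns[OF p, of "mat 1 :: real ^ 'n ^ 'n"]
      by (simp add: sign_swap_id abs_mult)
    moreover have "?B *v x = (\<chi> i. x $ Transposition.transpose m n i)" for x
    proof -
      have "(\<Sum>j\<in>UNIV. mat 1 $ i $ Transposition.transpose m n j * x $ j) = (\<Sum>j\<in>UNIV. if j = Transposition.transpose m n i then x $ j else 0)" for i
        by (intro sum.cong) (auto simp: mat_def)
      then show ?thesis by (simp add: matrix_vector_mult_def vec_eq_iff)
    qed
    ultimately show "?P ?B" using nn_integral_lborel_permute[OF _ p] by simp
  next
    fix m n :: 'n assume mn: "m \<noteq> n"
    let ?B = "(\<chi> i j. of_bool (i = m \<and> j = n \<or> i = j)) :: real ^ 'n ^ 'n"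
    have "?B = (\<chi> k. if k = m then row m (mat 1) + 1 *s row n (mat 1) else row k (mat 1))"
      using mn by (auto simp: vec_eq_iff row_def mat_def)
    then have "det ?B = 1"
      using det_row_operation[OF mn, of "mat 1 :: real ^ 'n ^ 'n" 1] by simp
    moreover have "?B *v x = (\<chi> i. if i = m then x $ m + x $ n else x $ i)" for x
    proof -
      have "(\<Sum>j\<in>UNIV. of_bool (i = m \<and> j = n \<or> i = j) * x $ j)
        = (\<Sum>j\<in>UNIV. (if j = i then x $ j else 0) + (if j = n then (if i = m then x $ j else 0) else 0))" for i
        by (intro sum.cong) (use mn in auto)
      then show ?thesis by (auto simp: matrix_vector_mult_def vec_eq_iff sum.distrib)
    qed
    ultimately show "?P ?B" using nn_integral_lborel_shear[OF _ mn] by simp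
  qed
  then show ?thesis using assms by simp
qed

lemma distr_lborel_linear:
  fixes A :: "real ^ 'n ^ 'n"
  assumes "det A \<noteq> 0"
  shows "distr lborel borel ((*v) A) = density lborel (\<lambda>_. ennreal (1 / \<bar>det A\<bar>))"
proof (rule measure_eqI)
  fix S assume "S \<in> sets (distr lborel borel ((*v) A))"
  then have [measurable]: "S \<in> sets borel" by simp
  have "emeasure (distr lborel borel ((*v) A)) S = (\<integral>\<^sup>+x. indicator S (A *v x) \<partial>lborel)"
    by (simp add: nn_integral_distr flip: nn_integral_indicator)
  also have "\<dots> = ennreal (1 / \<bar>det A\<bar>) * (ennreal \<bar>det A\<bar> * (\<integral>\<^sup>+x. indicator S (A *v x) \<partial>lborel))"
    using assms by (simp add: mult.assoc[symmetric] ennreal_mult[symmetric])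
  also have "\<dots> = ennreal (1 / \<bar>det A\<bar>) * emeasure lborel S"
    using assms by (subst nn_integral_lborel_linear) auto
  finally show "emeasure (distr lborel borel ((*v) A)) S = emeasure (density lborel (\<lambda>_. ennreal (1 / \<bar>det A\<bar>))) S"
    by (simp add: emeasure_density nn_integral_cmult)
qed simp

lemma
  fixes A :: "real ^ 'n ^ 'n" and h :: "real ^ 'n \<Rightarrow> complex"
  assumes d: "det A \<noteq> 0" and [measurable]: "h \<in> borel_measurable borel"
  shows integrable_lborel_linear_iff: "integrable lborel (\<lambda>x. h (A *v x)) \<longleftrightarrow> integrable lborel h"
    and integral_lborel_linear: "\<bar>det A\<bar> * (LINT x|lborel. h (A *v x)) = (LINT x|lborel. h x)"
proof -
  have "integrable lborel (\<lambda>x. h (A *v x)) \<longleftrightarrow> integrable (distr lborel borel ((*v) A)) h"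
    by (simp add: integrable_distr_eq)
  also have "\<dots> \<longleftrightarrow> integrable lborel h"
    unfolding distr_lborel_linear[OF d] using d
  proof (subst integrable_density)
    show "integrable lborel (\<lambda>x. (1 / \<bar>det A\<bar>) *\<^sub>R h x) \<longleftrightarrow> integrable lborel h"
    proof
      assume "integrable lborel (\<lambda>x. (1 / \<bar>det A\<bar>) *\<^sub>R h x)"
      then have "integrable lborel (\<lambda>x. \<bar>det A\<bar> *\<^sub>R (1 / \<bar>det A\<bar>) *\<^sub>R h x)"
        by (rule integrable_scaleR_right)
      then show "integrable lborel h" using d by simp
    qed auto
  qed auto
  finally show "integrable lborel (\<lambda>x. h (A *v x)) \<longleftrightarrow> integrable lborel h" .
  have "(LINT x|lborel. h (A *v x)) = (LINT x|distr lborel borel ((*v) A). h x)"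
    by (simp add: integral_distr)
  also have "\<dots> = (1 / \<bar>det A\<bar>) *\<^sub>R (LINT x|lborel. h x)"
    unfolding distr_lborel_linear[OF d] by (subst integral_density) auto
  finally show "\<bar>det A\<bar> * (LINT x|lborel. h (A *v x)) = (LINT x|lborel. h x)"
    using d by (simp add: scaleR_conv_of_real)
qed

section \<open>Parseval's identity on the torus\<close>

text \<open>
  The characters of euclidean space. The pairing is symmetric, so that \<open>chr k x\<close> is a character in
  either argument; the Fourier transform integrates against its conjugate.
\<close>

definition chr :: "real ^ 'd \<Rightarrow> real ^ 'd \<Rightarrow> complex"
  where "chr k x = exp (\<i> * complex_of_real (k \<bullet> x))"

lemma chr_0 [simp]: "chr 0 x = 1" by (simp add: chr_def)
lemma chr_add: "chr (k + l) x = chr k x * chr l x"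
  by (simp add: chr_def inner_left_distrib ring_distribs exp_add)
lemma chr_minus: "chr (- k) x = cnj (chr k x)"
  by (simp add: chr_def exp_cnj)
lemma norm_chr [simp]: "cmod (chr k x) = 1" by (simp add: chr_def)
lemma chr_mult_cnj [simp]: "chr k x * cnj (chr k x) = 1"
  by (metis chr_add chr_minus chr_0 add.right_inverse)
lemma continuous_on_chr [continuous_intros]:
  "continuous_on S f \<Longrightarrow> continuous_on S g \<Longrightarrow> continuous_on S (\<lambda>x. chr (f x) (g x))"
  unfolding chr_def by (intro continuous_intros)

definition torus_cube :: "(real ^ 'd) set" where "torus_cube = {x. \<forall>i. \<bar>x $ i\<bar> \<le> pi}"

lemma torus_cube_cbox: "torus_cube = cbox (\<chi> i. - pi) (\<chi> i. pi)"
  by (auto simp: torus_cube_def mem_box_cart abs_le_iff) (metis minus_le_iff)+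

lemma compact_torus_cube: "compact torus_cube" by (simp add: torus_cube_cbox)

lemma torus_cube_integrable:
  fixes f :: "real ^ 'd \<Rightarrow> 'b::{banach, second_countable_topology}"
  assumes "continuous_on UNIV f" shows "set_integrable lborel torus_cube f"
  unfolding set_integrable_def
  by (rule borel_integrable_compact[OF compact_torus_cube]) (use assms continuous_on_subset in blast)

lemma int_lattice_add: "k \<in> int_lattice \<Longrightarrow> l \<in> int_lattice \<Longrightarrow> k + l \<in> int_lattice"
  by (simp add: int_lattice_def)
lemma int_lattice_minus: "k \<in> int_lattice \<Longrightarrow> - k \<in> int_lattice"
  by (simp add: int_lattice_def)
lemma int_lattice_axis: "axis i 1 \<in> int_lattice" by (simp add: int_lattice_def axis_def)
lemma int_lattice_0: "0 \<in> int_lattice" by (simp add: int_lattice_def)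

lemma integral_exp_int:
  assumes "m \<in> \<int>"
  shows "(LINT t|lborel. indicator {-pi..pi} t *\<^sub>R exp (\<i> * complex_of_real (m * t))) = (if m = 0 then 2 * pi else 0)"
proof (cases "m = 0")
  case True
  have "(LINT t|lborel. indicator {-pi..pi} t *\<^sub>R (1::complex)) = complex_of_real (measure lborel {-pi..pi})"
    by (simp add: scaleR_conv_of_real)
  then show ?thesis using True by simp
next
  case False
  obtain n where n: "m = of_int n" using assms by (auto elim: Ints_cases)
  let ?F = "\<lambda>t. exp (\<i> * complex_of_real (m * t)) / (\<i> * complex_of_real m)"
  have D: "(?F has_vector_derivative exp (\<i> * complex_of_real (m * t))) (at t within {-pi..pi})" for t
  proof -
    have "((\<lambda>z. exp (c * z) / c) has_field_derivative exp (c * complex_of_real t)) (at (complex_of_real t))" if "c \<noteq> 0" for c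
      using that by (auto intro!: derivative_eq_intros)
    from has_vector_derivative_real_field[OF this, of "\<i> * complex_of_real m"] show ?thesis
      using False by (simp add: mult.assoc)
  qed
  have "(LINT t|lborel. indicator {-pi..pi} t *\<^sub>R exp (\<i> * complex_of_real (m * t))) = ?F pi - ?F (- pi)"
    by (rule integral_FTC_Icc) (use D in \<open>auto intro!: continuous_intros\<close>)
  also have "exp (\<i> * complex_of_real (m * pi)) = exp (\<i> * complex_of_real (m * (- pi)))"
  proof -
    have "exp (\<i> * complex_of_real (m * pi)) = exp (\<i> * complex_of_real (m * (- pi)) + \<i> * (of_int n * (of_real pi * 2)))"
      by (simp add: n algebra_simps)
    also have "\<dots> = exp (\<i> * complex_of_real (m * (- pi)))" by (rule exp_plus_2pin)
    finally show ?thesis .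
  qed
  finally show ?thesis using False by simp
qed

lemma chr_prod: "chr k x = (\<Prod>i\<in>UNIV. exp (\<i> * complex_of_real (k $ i * x $ i)))"
  by (simp add: chr_def inner_vec_def sum_distrib_left exp_sum)

lemma torus_cube_indicator: "indicator torus_cube x = (\<Prod>i\<in>UNIV. indicator {-pi..pi} (x $ i) :: real)"
proof (cases "x \<in> torus_cube")
  case True then show ?thesis by (auto simp: torus_cube_def abs_le_iff minus_le_iff indicator_def)
next
  case False
  then obtain i where "\<not> \<bar>x $ i\<bar> \<le> pi" by (auto simp: torus_cube_def)
  then have "indicator {-pi..pi} (x $ i) = (0::real)" by (auto simp: indicator_def)
  then have "(\<Prod>i\<in>UNIV. indicator {-pi..pi} (x $ i) :: real) = 0" by (metis (no_types, lifting) UNIV_I finite prod_zero)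
  then show ?thesis using False by simp
qed

lemma integral_chr:
  fixes k :: "real ^ 'd"
  assumes k: "k \<in> int_lattice"
  shows "(LINT x:torus_cube|lborel. chr k x) = (if k = 0 then (2 * pi) ^ CARD('d) else 0)"
proof -
  have "(LINT x:torus_cube|lborel. chr k x)
     = (LINT x|lborel. (\<Prod>i\<in>UNIV. indicator {-pi..pi} (x $ i) *\<^sub>R exp (\<i> * complex_of_real (k $ i * x $ i))))"
    unfolding set_lebesgue_integral_def
    by (simp add: torus_cube_indicator chr_prod scaleR_conv_of_real prod.distrib)
  also have "\<dots> = (\<Prod>i\<in>UNIV. LINT t|lborel. indicator {-pi..pi} t *\<^sub>R exp (\<i> * complex_of_real (k $ i * t)))"
    by (rule integral_prod_vec, rule borel_integrable_compact) (auto intro!: continuous_intros)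
  also have "\<dots> = (\<Prod>i\<in>UNIV. if k $ i = 0 then complex_of_real (2 * pi) else 0)"
    using k by (intro prod.cong refl) (subst integral_exp_int, auto simp: int_lattice_def)
  also have "\<dots> = (if k = 0 then (2 * pi) ^ CARD('d) else 0)"
    by (auto simp: vec_eq_iff)
  finally show ?thesis .
qed

text \<open>
  Trigonometric polynomials with frequencies in the integer lattice. The inductive form makes the
  closure under sums and products immediate; the form with a finite set of distinct frequencies,
  which the orthogonality relations need, is recovered afterwards.
\<close>

inductive trig :: "(real ^ 'd \<Rightarrow> complex) \<Rightarrow> bool" where
  character: "k \<in> int_lattice \<Longrightarrow> trig (\<lambda>x. c * chr k x)"
| add: "trig f \<Longrightarrow> trig g \<Longrightarrow> trig (\<lambda>x. f x + g x)"

lemma trig_term_mult: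
  assumes "trig f" "k \<in> int_lattice" shows "trig (\<lambda>x. (c * chr k x) * f x)"
  using assms(1)
proof induction
  case (character l d)
  have "trig (\<lambda>x. (c * d) * chr (k + l) x)" by (intro trig.character int_lattice_add character assms(2))
  then show ?case by (simp add: chr_add mult_ac)
next
  case (add f g)
  then show ?case by (simp only: distrib_left trig.add)
qed

lemma trig_mult:
  assumes "trig f" "trig g" shows "trig (\<lambda>x. f x * g x)"
  using assms(1)
proof induction
  case (character k c) then show ?case by (rule trig_term_mult[OF assms(2)])
next
  case (add f g) then show ?case by (simp only: distrib_right trig.add)
qed

lemma trig_const: "trig (\<lambda>x. c)"
  using trig.character[OF int_lattice_0, of c] by simp

lemma trig_sum: "(\<And>i. i \<in> A \<Longrightarrow> trig (f i)) \<Longrightarrow> trig (\<lambda>x. \<Sum>i\<in>A. f i x)"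
  by (induction A rule: infinite_finite_induct) (auto intro: trig_const trig.add)

lemma trig_imp_finite_sum:
  assumes "trig f"
  obtains S p where "finite S" "S \<subseteq> int_lattice" "f = (\<lambda>x. \<Sum>k\<in>S. p k * chr k x)"
proof -
  have "\<exists>S p. finite S \<and> S \<subseteq> int_lattice \<and> f = (\<lambda>x. \<Sum>k\<in>S. p k * chr k x)"
    using assms
  proof induction
    case (character k c)
    then show ?case by (intro exI[of _ "{k}"] exI[of _ "\<lambda>_. c"]) auto
  next
    case (add f g)
    then obtain S p T q where fS: "finite S" "S \<subseteq> int_lattice" and f: "f = (\<lambda>x. \<Sum>k\<in>S. p k * chr k x)"
      and fT: "finite T" "T \<subseteq> int_lattice" and g: "g = (\<lambda>x. \<Sum>k\<in>T. q k * chr k x)" by blast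
    define r where "r k = (if k \<in> S then p k else 0) + (if k \<in> T then q k else 0)" for k
    have "f x = (\<Sum>k\<in>S \<union> T. (if k \<in> S then p k else 0) * chr k x)" for x
      unfolding f using fS(1) fT(1) by (intro sum.mono_neutral_cong_left) auto
    moreover have "g x = (\<Sum>k\<in>S \<union> T. (if k \<in> T then q k else 0) * chr k x)" for x
      unfolding g using fS(1) fT(1) by (intro sum.mono_neutral_cong_left) auto
    ultimately have "(\<lambda>x. f x + g x) = (\<lambda>x. \<Sum>k\<in>S \<union> T. r k * chr k x)"
      by (simp only: r_def sum.distrib distrib_right)
    moreover have "finite (S \<union> T)" "S \<union> T \<subseteq> int_lattice" using fS fT by auto
    ultimately show ?case by blast
  qed
  then show thesis using that by blast
qed

definition torus_point :: "real ^ 'd \<Rightarrow> complex ^ 'd" where "torus_point x = (\<chi> i. exp (\<i> * complex_of_real (x $ i)))"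

text \<open>
  The point of passing to the torus in \<open>complex ^ 'd\<close>: the coordinate functions there are the basic
  characters, so polynomials pull back to trigonometric polynomials.
\<close>

lemma trig_real_polynomial:
  fixes P :: "complex ^ 'd \<Rightarrow> real"
  assumes "real_polynomial_function P"
  shows "trig (\<lambda>x. complex_of_real (P (torus_point x)))"
  using assms
proof induction
  case (linear L)
  interpret L: bounded_linear L by fact
  have ax: "L (axis i w) = Re w * L (axis i 1) + Im w * L (axis i \<i>)" for i w
  proof -
    have "axis i w = Re w *\<^sub>R axis i 1 + Im w *\<^sub>R axis i \<i>"
      by (auto simp: vec_eq_iff axis_def complex_eq_iff)
    then show ?thesis by (metis L.add L.scaleR real_scaleR_def)
  qed
  have "L z = (\<Sum>i\<in>UNIV. Re (z $ i) * L (axis i 1) + Im (z $ i) * L (axis i \<i>))" for z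
  proof -
    have "z = (\<Sum>i\<in>UNIV. axis i (z $ i))"
      by (simp add: vec_eq_iff axis_def)
    from arg_cong[OF this, of L] have "L z = (\<Sum>i\<in>UNIV. L (axis i (z $ i)))" by (simp only: L.sum)
    also have "\<dots> = (\<Sum>i\<in>UNIV. Re (z $ i) * L (axis i 1) + Im (z $ i) * L (axis i \<i>))"
      by (intro sum.cong refl ax)
    finally show ?thesis .
  qed
  note Lz = this
  have "complex_of_real (L (torus_point x)) = (\<Sum>i\<in>UNIV.
      (complex_of_real (L (axis i 1)) / 2 + complex_of_real (L (axis i \<i>)) / (2 * \<i>)) * chr (axis i 1) x
    + (complex_of_real (L (axis i 1)) / 2 - complex_of_real (L (axis i \<i>)) / (2 * \<i>)) * chr (- axis i 1) x)" for x
  proof -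
    have e: "torus_point x $ i = chr (axis i 1) x" for i
      by (simp add: chr_def torus_point_def inner_axis')
    have re: "complex_of_real (Re z) = (z + cnj z) / 2" for z
      by (simp add: complex_add_cnj)
    have im: "complex_of_real (Im z) = (z - cnj z) / (2 * \<i>)" for z
    proof -
      have "z - cnj z = (2 * \<i>) * complex_of_real (Im z)" by (simp add: complex_eq_iff)
      then show ?thesis by simp
    qed
    have alg: "(z + w) / 2 * a + (z - w) / (2 * \<i>) * b = (a / 2 + b / (2 * \<i>)) * z + (a / 2 - b / (2 * \<i>)) * w" for z w a b
      by (simp add: algebra_simps add_divide_distrib diff_divide_distrib)
    show ?thesis
      by (subst Lz) (simp only: of_real_sum of_real_add of_real_mult e chr_minus re im alg)
  qed
  then show ?case
    by (simp only:) (intro trig_sum trig.add trig.character int_lattice_axis int_lattice_minus)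
next
  case (const c) then show ?case by (rule trig_const)
next
  case (add f g) then show ?case by (simp only: of_real_add trig.add)
next
  case (mult f g) then show ?case by (simp only: of_real_mult trig_mult)
qed

lemma cos_1_ge_half: "cos 1 \<ge> (1/2 :: real)"
proof -
  have "(1::real) \<le> pi / 3" using pi_gt3 by simp
  then have "cos (pi / 3) \<le> cos 1" by (intro cos_monotone_0_pi_le) auto
  then show ?thesis by (simp add: cos_60)
qed

text \<open>
  A function supported in the cube of half-width one extends continuously to the torus: a point of
  the right half circles in every coordinate is described by its arcsines, and the factor
  \<open>min 1 (max 0 (2 * Re z))\<close> cuts off the remaining points. The factor is one on the support because
  \<open>cos 1 \<ge> 1 / 2\<close>. The Stone-Weierstrass theorem then applies to the extension.
\<close>

lemma trig_approximation_real:
  fixes F :: "real ^ 'd \<Rightarrow> real"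
  assumes cont: "continuous_on UNIV F" and supp: "\<And>x i. F x \<noteq> 0 \<Longrightarrow> \<bar>x $ i\<bar> \<le> 1" and "e > 0"
  shows "\<exists>P. trig P \<and> (\<forall>x\<in>torus_cube. cmod (complex_of_real (F x) - P x) < e)"
proof -
  define T where "T = {z :: complex ^ 'd. \<forall>i. cmod (z $ i) = 1}"
  define G where "G z = F (\<chi> i. arcsin (Im (z $ i))) * (\<Prod>i\<in>UNIV. min 1 (max 0 (2 * Re (z $ i))))" for z :: "complex ^ 'd"
  have "closed T"
  proof -
    have "T = (\<Inter>i. {z. cmod (z $ i) = 1})" by (auto simp: T_def)
    then show ?thesis by (simp only:) (intro closed_INT ballI closed_Collect_eq continuous_intros)
  qed
  moreover have "bounded T"
  proof (rule boundedI)
    fix z assume "z \<in> T"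
    have "norm z \<le> (\<Sum>i\<in>UNIV. cmod (z $ i))" unfolding norm_vec_def by (rule L2_set_le_sum) simp
    then show "norm z \<le> real CARD('d)" using \<open>z \<in> T\<close> by (simp add: T_def)
  qed
  ultimately have "compact T" by (simp add: compact_eq_bounded_closed)
  moreover have "continuous_on T G"
    unfolding G_def
  proof (intro continuous_intros continuous_on_compose2[OF cont] continuous_on_vec_lambda ballI)
    fix z :: "complex ^ 'd" and i assume "z \<in> T"
    then have "\<bar>Im (z $ i)\<bar> \<le> 1" using abs_Im_le_cmod[of "z $ i"] by (simp add: T_def)
    then show "- 1 \<le> Im (z $ i) \<and> Im (z $ i) \<le> 1" by auto
  qed auto
  ultimately obtain g where g: "real_polynomial_function g" "\<And>z. z \<in> T \<Longrightarrow> \<bar>G z - g z\<bar> < e"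
    using Stone_Weierstrass_real_polynomial_function \<open>e > 0\<close> by metis
  have "cmod (complex_of_real (F x) - complex_of_real (g (torus_point x))) < e" if x: "x \<in> torus_cube" for x
  proof -
    have "torus_point x \<in> T" by (simp add: T_def torus_point_def)
    moreover have "G (torus_point x) = F x"
    proof -
      have ReIm: "Re (torus_point x $ i) = cos (x $ i)" "Im (torus_point x $ i) = sin (x $ i)" for i
        by (simp_all add: torus_point_def Re_exp Im_exp)
      show ?thesis
      proof (cases "\<exists>i. cos (x $ i) \<le> 0")
        case True
        then obtain i where i: "cos (x $ i) \<le> 0" by blast
        then have "(\<Prod>i\<in>UNIV. min 1 (max 0 (2 * Re (torus_point x $ i)))) = 0"
          by (intro prod_zero) (auto simp: ReIm intro!: exI[of _ i])
        then have "G (torus_point x) = 0" by (simp add: G_def)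
        moreover have "F x = 0"
        proof (rule ccontr)
          assume "F x \<noteq> 0"
          then have "\<bar>x $ i\<bar> \<le> 1" by (rule supp)
          then have "cos 1 \<le> cos \<bar>x $ i\<bar>" using pi_gt3 by (intro cos_monotone_0_pi_le) auto
          then show False using i cos_1_ge_half by simp
        qed
        ultimately show ?thesis by simp
      next
        case False
        have half: "\<bar>x $ i\<bar> < pi / 2" for i
        proof (rule ccontr)
          assume "\<not> \<bar>x $ i\<bar> < pi / 2"
          then have "cos \<bar>x $ i\<bar> \<le> cos (pi / 2)"
            using x by (intro cos_monotone_0_pi_le) (auto simp: torus_cube_def)
          then show False using False by (auto simp: not_le) (metis cos_abs_real not_le)
        qed
        have "arcsin (sin (x $ i)) = x $ i" for i
          using half[of i] by (intro arcsin_sin) auto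
        then have "(\<chi> i. arcsin (Im (torus_point x $ i))) = x" by (simp add: ReIm vec_eq_iff)
        then have G: "G (torus_point x) = F x * (\<Prod>i\<in>UNIV. min 1 (max 0 (2 * cos (x $ i))))"
          by (simp add: G_def ReIm)
        show ?thesis
        proof (cases "F x = 0")
          case True then show ?thesis using G by simp
        next
          case False
          have "min 1 (max 0 (2 * cos (x $ i))) = 1" for i
          proof -
            have "\<bar>x $ i\<bar> \<le> 1" using False by (rule supp)
            then have "cos 1 \<le> cos \<bar>x $ i\<bar>" using pi_gt3 by (intro cos_monotone_0_pi_le) auto
            then show ?thesis using cos_1_ge_half by simp
          qed
          then show ?thesis using G by simp
        qed
      qed
    qed
    ultimately show ?thesis using g(2)[of "torus_point x"] by (simp flip: of_real_diff)
  qed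
  then show ?thesis using trig_real_polynomial[OF g(1)] by blast
qed

lemma trig_approximation:
  fixes F :: "real ^ 'd \<Rightarrow> complex"
  assumes cont: "continuous_on UNIV F" and supp: "\<And>x i. F x \<noteq> 0 \<Longrightarrow> \<bar>x $ i\<bar> \<le> 1" and "e > 0"
  shows "\<exists>P. trig P \<and> (\<forall>x\<in>torus_cube. cmod (F x - P x) < e)"
proof -
  have "\<exists>P. trig P \<and> (\<forall>x\<in>torus_cube. cmod (complex_of_real (Re (F x)) - P x) < e / 2)"
    using \<open>e > 0\<close> by (intro trig_approximation_real continuous_intros cont) (use supp in force)+
  moreover have "\<exists>P. trig P \<and> (\<forall>x\<in>torus_cube. cmod (complex_of_real (Im (F x)) - P x) < e / 2)"
    using \<open>e > 0\<close> by (intro trig_approximation_real continuous_intros cont) (use supp in force)+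
  ultimately obtain P Q where PQ: "trig P" "trig Q"
    "\<And>x. x \<in> torus_cube \<Longrightarrow> cmod (complex_of_real (Re (F x)) - P x) < e / 2"
    "\<And>x. x \<in> torus_cube \<Longrightarrow> cmod (complex_of_real (Im (F x)) - Q x) < e / 2" by metis
  have "trig (\<lambda>x. P x + \<i> * Q x)" by (intro trig.add trig_mult trig_const PQ)
  moreover have "cmod (F x - (P x + \<i> * Q x)) < e" if "x \<in> torus_cube" for x
  proof -
    have eq: "F x - (P x + \<i> * Q x) = (complex_of_real (Re (F x)) - P x) + \<i> * (complex_of_real (Im (F x)) - Q x)"
      by (subst complex_eq[of "F x"]) (simp add: algebra_simps)
    have "cmod (F x - (P x + \<i> * Q x)) \<le> cmod (complex_of_real (Re (F x)) - P x) + cmod (complex_of_real (Im (F x)) - Q x)"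
      unfolding eq by (rule order_trans[OF norm_triangle_ineq]) (simp add: norm_mult)
    then show ?thesis using PQ(3,4)[OF that] by simp
  qed
  ultimately show ?thesis by blast
qed

text \<open>
  Completing the square. For the choice \<open>p = c / w\<close> this is Bessel's inequality; for a good
  trigonometric approximation of \<open>F\<close> it shows conversely that the Fourier coefficients carry almost
  the whole norm.
\<close>

lemma best_approximation_identity:
  fixes F :: "real ^ 'd \<Rightarrow> complex"
  assumes cont: "continuous_on UNIV F" and S: "finite S" "S \<subseteq> int_lattice"
  defines "w \<equiv> (2 * pi) ^ CARD('d)"
  defines "c \<equiv> \<lambda>k. LINT x:torus_cube|lborel. F x * cnj (chr k x)"
  shows "(LINT x:torus_cube|lborel. (cmod (F x - (\<Sum>k\<in>S. p k * chr k x)))\<^sup>2)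
     = (LINT x:torus_cube|lborel. (cmod (F x))\<^sup>2) - (\<Sum>k\<in>S. (cmod (c k))\<^sup>2) / w
       + w * (\<Sum>k\<in>S. (cmod (p k - c k / w))\<^sup>2)"
proof -
  have w: "w > 0" by (simp add: w_def)
  let ?P = "\<lambda>x. \<Sum>k\<in>S. p k * chr k x"
  let ?I = "\<lambda>f :: real ^ 'd \<Rightarrow> complex. LINT x:torus_cube|lborel. f x"
  have cP: "continuous_on UNIV ?P" by (intro continuous_intros)
  have [simp]: "set_integrable lborel torus_cube f" if "continuous_on UNIV f" for f :: "real ^ 'd \<Rightarrow> complex"
    by (rule torus_cube_integrable[OF that])
  have Isum: "?I (\<lambda>x. \<Sum>k\<in>S. f k x) = (\<Sum>k\<in>S. ?I (f k))" if "\<And>k. k \<in> S \<Longrightarrow> continuous_on UNIV (f k)" for f :: "real ^ 'd \<Rightarrow> real ^ 'd \<Rightarrow> complex"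
    using torus_cube_integrable[OF that] unfolding set_lebesgue_integral_def set_integrable_def scaleR_sum_right
    by (intro Bochner_Integration.integral_sum) auto
  have FP: "?I (\<lambda>x. F x * cnj (?P x)) = (\<Sum>k\<in>S. cnj (p k) * c k)"
  proof -
    have "?I (\<lambda>x. F x * cnj (?P x)) = ?I (\<lambda>x. \<Sum>k\<in>S. cnj (p k) * (F x * cnj (chr k x)))"
      by (simp add: sum_distrib_left mult_ac)
    also have "\<dots> = (\<Sum>k\<in>S. ?I (\<lambda>x. cnj (p k) * (F x * cnj (chr k x))))"
      by (intro Isum continuous_intros cont)
    finally show ?thesis by (simp add: c_def)
  qed
  have PP: "?I (\<lambda>x. ?P x * cnj (?P x)) = w * (\<Sum>k\<in>S. p k * cnj (p k))"
  proof -
    have "?I (\<lambda>x. ?P x * cnj (?P x)) = ?I (\<lambda>x. \<Sum>k\<in>S. \<Sum>l\<in>S. p k * cnj (p l) * chr (k - l) x)"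
      by (simp add: sum_product mult_ac chr_minus chr_add flip: add_uminus_conv_diff)
    also have "\<dots> = (\<Sum>k\<in>S. \<Sum>l\<in>S. p k * cnj (p l) * ?I (chr (k - l)))"
      by (subst Isum, intro continuous_intros, intro sum.cong refl, subst Isum, intro continuous_intros) simp
    also have "\<dots> = (\<Sum>k\<in>S. \<Sum>l\<in>S. if l = k then p k * cnj (p k) * w else 0)"
    proof (intro sum.cong refl)
      fix k l assume "k \<in> S" "l \<in> S"
      then have "k - l \<in> int_lattice" using S int_lattice_add[OF _ int_lattice_minus, of k l] by auto
      then show "p k * cnj (p l) * ?I (chr (k - l)) = (if l = k then p k * cnj (p k) * w else 0)"
        by (simp add: integral_chr w_def)
    qed
    also have "\<dots> = w * (\<Sum>k\<in>S. p k * cnj (p k))"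
      using S by (simp add: sum_distrib_left mult_ac)
    finally show ?thesis .
  qed
  have expand: "complex_of_real ((cmod (F x - ?P x))\<^sup>2) = complex_of_real ((cmod (F x))\<^sup>2) - F x * cnj (?P x) - cnj (F x * cnj (?P x)) + ?P x * cnj (?P x)" for x
    by (simp only: complex_norm_square) (simp add: algebra_simps)
  have ofr: "complex_of_real (LINT x:torus_cube|lborel. f x) = ?I (\<lambda>x. complex_of_real (f x))" for f
    by (rule set_integral_complex_of_real[symmetric])
  have "complex_of_real (LINT x:torus_cube|lborel. (cmod (F x - ?P x))\<^sup>2)
    = ?I (\<lambda>x. complex_of_real ((cmod (F x))\<^sup>2) - F x * cnj (?P x) - cnj (F x * cnj (?P x)) + ?P x * cnj (?P x))"
    unfolding ofr expand ..
  also have "\<dots> = ?I (\<lambda>x. complex_of_real ((cmod (F x))\<^sup>2)) - ?I (\<lambda>x. F x * cnj (?P x)) - ?I (\<lambda>x. cnj (F x * cnj (?P x))) + ?I (\<lambda>x. ?P x * cnj (?P x))"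
    by (subst set_integral_add(2) set_integral_diff(2); (intro torus_cube_integrable continuous_intros cont cP)?)+ simp
  also have "?I (\<lambda>x. cnj (F x * cnj (?P x))) = cnj (?I (\<lambda>x. F x * cnj (?P x)))"
    unfolding set_lebesgue_integral_def Bochner_Integration.integral_cnj[symmetric] by (simp add: scaleR_conv_of_real)
  also have "?I (\<lambda>x. complex_of_real ((cmod (F x))\<^sup>2)) = complex_of_real (LINT x:torus_cube|lborel. (cmod (F x))\<^sup>2)"
    by (rule ofr[symmetric])
  finally have *: "complex_of_real (LINT x:torus_cube|lborel. (cmod (F x - ?P x))\<^sup>2)
    = complex_of_real (LINT x:torus_cube|lborel. (cmod (F x))\<^sup>2) - (\<Sum>k\<in>S. cnj (p k) * c k) - (\<Sum>k\<in>S. p k * cnj (c k)) + w * (\<Sum>k\<in>S. p k * cnj (p k))"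
    unfolding FP PP by simp
  have key: "complex_of_real w * (\<Sum>k\<in>S. p k * cnj (p k)) - (\<Sum>k\<in>S. cnj (p k) * c k) - (\<Sum>k\<in>S. p k * cnj (c k))
     = complex_of_real w * (\<Sum>k\<in>S. (p k - c k / w) * cnj (p k - c k / w)) - (\<Sum>k\<in>S. c k * cnj (c k)) / w"
    unfolding sum_distrib_left sum_divide_distrib sum_subtractf[symmetric]
    using w by (intro sum.cong refl) (simp add: field_simps)
  have "complex_of_real (LINT x:torus_cube|lborel. (cmod (F x - ?P x))\<^sup>2)
    = complex_of_real (LINT x:torus_cube|lborel. (cmod (F x))\<^sup>2) + (complex_of_real w * (\<Sum>k\<in>S. p k * cnj (p k)) - (\<Sum>k\<in>S. cnj (p k) * c k) - (\<Sum>k\<in>S. p k * cnj (c k)))"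
    unfolding * by simp
  also have "\<dots> = complex_of_real ((LINT x:torus_cube|lborel. (cmod (F x))\<^sup>2) - (\<Sum>k\<in>S. (cmod (c k))\<^sup>2) / w + w * (\<Sum>k\<in>S. (cmod (p k - c k / w))\<^sup>2))"
    unfolding key by (simp only: of_real_add of_real_diff of_real_mult of_real_divide of_real_sum complex_norm_square) simp
  finally show ?thesis by (simp only: of_real_eq_iff)
qed

text \<open>
  The support hypothesis keeps \<open>F\<close> away from the boundary of a period, so that \<open>F\<close> itself stands for
  its periodization and integrals over the space replace integrals over the torus.
\<close>

theorem parseval_torus:
  fixes F :: "real ^ 'd \<Rightarrow> complex"
  assumes cont: "continuous_on UNIV F" and supp: "\<And>x i. F x \<noteq> 0 \<Longrightarrow> \<bar>x $ i\<bar> \<le> 1"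
  shows "(\<Sum>\<^sub>\<infinity>k\<in>int_lattice. ennreal ((cmod (LINT x|lborel. F x * cnj (chr k x)))\<^sup>2))
    = ennreal ((2 * pi) ^ CARD('d) * (LINT x|lborel. (cmod (F x))\<^sup>2))"
proof -
  define w where "w = (2 * pi) ^ CARD('d)"
  define c where "c k = (LINT x:torus_cube|lborel. F x * cnj (chr k x))" for k
  define A where "A = (LINT x:torus_cube|lborel. (cmod (F x))\<^sup>2)"
  have w: "w > 0" by (simp add: w_def)
  have z: "F x = 0" if "x \<notin> torus_cube" for x
  proof (rule ccontr)
    assume "F x \<noteq> 0"
    then have "\<bar>x $ i\<bar> \<le> pi" for i using supp[of x i] pi_gt3 by simp
    then show False using that by (simp add: torus_cube_def)
  qed
  have c: "(LINT x|lborel. F x * cnj (chr k x)) = c k" for k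
    unfolding c_def set_lebesgue_integral_def
    by (intro Bochner_Integration.integral_cong refl) (auto simp: indicator_def z)
  have A: "(LINT x|lborel. (cmod (F x))\<^sup>2) = A"
    unfolding A_def set_lebesgue_integral_def
    by (intro Bochner_Integration.integral_cong refl) (auto simp: indicator_def z)
  note id = best_approximation_identity[OF cont, folded w_def c_def A_def]
  have upper: "(\<Sum>k\<in>S. (cmod (c k))\<^sup>2) \<le> w * A" if S: "finite S" "S \<subseteq> int_lattice" for S
  proof -
    have "0 \<le> (LINT x:torus_cube|lborel. (cmod (F x - (\<Sum>k\<in>S. (c k / w) * chr k x)))\<^sup>2)"
      unfolding set_lebesgue_integral_def by (rule integral_nonneg_AE) simp
    also have "\<dots> = A - (\<Sum>k\<in>S. (cmod (c k))\<^sup>2) / w"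
      unfolding id[OF S] by simp
    finally show ?thesis using w by (simp add: field_simps)
  qed
  have lower: "\<exists>S. finite S \<and> S \<subseteq> int_lattice \<and> w * A - w * (w * e\<^sup>2) \<le> (\<Sum>k\<in>S. (cmod (c k))\<^sup>2)" if "e > 0" for e
  proof -
    obtain P where P: "trig P" "\<And>x. x \<in> torus_cube \<Longrightarrow> cmod (F x - P x) < e"
      using trig_approximation[OF cont supp \<open>e > 0\<close>] by blast
    obtain S p where S: "finite S" "S \<subseteq> int_lattice" "P = (\<lambda>x. \<Sum>k\<in>S. p k * chr k x)"
      using trig_imp_finite_sum[OF P(1)] .
    have cP: "continuous_on UNIV P" unfolding S(3) by (intro continuous_intros)
    have "A - (\<Sum>k\<in>S. (cmod (c k))\<^sup>2) / w \<le> (LINT x:torus_cube|lborel. (cmod (F x - P x))\<^sup>2)"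
      unfolding S(3) id[OF S(1,2)] using w by (simp add: sum_nonneg)
    also have "\<dots> \<le> (LINT x::real ^ 'd:torus_cube|lborel. e\<^sup>2)"
    proof (rule set_integral_mono)
      fix x :: "real ^ 'd" assume "x \<in> torus_cube"
      then have "(cmod (F x - P x))\<^sup>2 \<le> e\<^sup>2" using P(2)[of x] by (intro power_mono) auto
      then show "(cmod (F x - P x))\<^sup>2 \<le> e\<^sup>2" by simp
    qed (intro torus_cube_integrable continuous_intros cont cP)+
    also have "\<dots> = e\<^sup>2 * w"
    proof -
      have "complex_of_real (LINT x::real ^ 'd:torus_cube|lborel. 1) = (LINT x:torus_cube|lborel. chr (0 :: real ^ 'd) x)"
      proof -
        have "chr (0 :: real ^ 'd) = (\<lambda>x. 1)" by (rule ext) simp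
        then show ?thesis by (subst set_integral_complex_of_real[symmetric]) simp
      qed
      also have "\<dots> = complex_of_real w" using integral_chr[OF int_lattice_0] by (simp add: w_def)
      finally have "(LINT x::real ^ 'd:torus_cube|lborel. 1) = w" by (simp only: of_real_eq_iff)
      then show ?thesis by (simp add: set_lebesgue_integral_def mult.commute)
    qed
    finally have "w * A - w * (w * e\<^sup>2) \<le> (\<Sum>k\<in>S. (cmod (c k))\<^sup>2)" using w by (simp add: field_simps)
    then show ?thesis using S by blast
  qed
  have "A \<ge> 0" unfolding A_def set_lebesgue_integral_def by (rule integral_nonneg_AE) simp
  have "(\<Sum>\<^sub>\<infinity>k\<in>int_lattice. ennreal ((cmod (c k))\<^sup>2))
     = (SUP S\<in>{S. finite S \<and> S \<subseteq> int_lattice}. (\<Sum>k\<in>S. ennreal ((cmod (c k))\<^sup>2)))"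
    by (rule nonneg_infsum_complete) simp
  also have "\<dots> = (SUP S\<in>{S. finite S \<and> S \<subseteq> int_lattice}. ennreal (\<Sum>k\<in>S. (cmod (c k))\<^sup>2))"
    by (simp add: sum_ennreal)
  also have "\<dots> = ennreal (w * A)"
  proof (rule antisym)
    show "(SUP S\<in>{S. finite S \<and> S \<subseteq> int_lattice}. ennreal (\<Sum>k\<in>S. (cmod (c k))\<^sup>2)) \<le> ennreal (w * A)"
      using upper by (intro SUP_least ennreal_leI) auto
    show "ennreal (w * A) \<le> (SUP S\<in>{S. finite S \<and> S \<subseteq> int_lattice}. ennreal (\<Sum>k\<in>S. (cmod (c k))\<^sup>2))"
    proof (rule ennreal_le_epsilon)
      fix d :: real assume "d > 0"
      \<comment> \<open>a uniform error \<open>e\<close> of the approximation costs \<open>w * (w * e\<^sup>2)\<close> in the energy\<close>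
      define e where "e = sqrt (d / (w * w))"
      have "e > 0" using w \<open>d > 0\<close> by (simp add: e_def)
      have e2: "w * (w * e\<^sup>2) = d" using w \<open>d > 0\<close> by (simp add: e_def)
      obtain S where S: "finite S" "S \<subseteq> int_lattice" "w * A - d \<le> (\<Sum>k\<in>S. (cmod (c k))\<^sup>2)"
        using lower[OF \<open>e > 0\<close>] unfolding e2 by blast
      have "ennreal (w * A) \<le> ennreal ((\<Sum>k\<in>S. (cmod (c k))\<^sup>2) + d)"
        using S by (intro ennreal_leI) simp
      also have "\<dots> = ennreal (\<Sum>k\<in>S. (cmod (c k))\<^sup>2) + ennreal d"
        using \<open>d > 0\<close> by (intro ennreal_plus) (auto simp: sum_nonneg)
      also have "\<dots> \<le> (SUP S\<in>{S. finite S \<and> S \<subseteq> int_lattice}. ennreal (\<Sum>k\<in>S. (cmod (c k))\<^sup>2)) + ennreal d"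
        using S by (intro add_mono SUP_upper order_refl) auto
      finally show "ennreal (w * A) \<le> (SUP S\<in>{S. finite S \<and> S \<subseteq> int_lattice}. ennreal (\<Sum>k\<in>S. (cmod (c k))\<^sup>2)) + ennreal d" .
    qed
  qed
  finally show ?thesis unfolding c A w_def .
qed

section \<open>Plancherel's identity\<close>

text \<open>
  In \<open>ennreal\<close> unordered sums are integrals for the counting measure. This makes Tonelli's
  theorem, Fatou's lemma and linearity available for them.
\<close>

lemma infsum_ennreal_eq_nn_integral:
  fixes f :: "'a \<Rightarrow> ennreal"
  assumes "countable A"
  shows "(\<Sum>\<^sub>\<infinity>k\<in>A. f k) = (\<integral>\<^sup>+k. f k \<partial>count_space A)"
proof -
  have S: "(\<Sum>\<^sub>\<infinity>k\<in>A. f k) = (SUP F\<in>{F. finite F \<and> F \<subseteq> A}. sum f F)"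
    by (rule nonneg_infsum_complete) simp
  show ?thesis unfolding S
  proof (rule antisym)
    show "(SUP F\<in>{F. finite F \<and> F \<subseteq> A}. sum f F) \<le> (\<integral>\<^sup>+k. f k \<partial>count_space A)"
    proof (intro SUP_least)
      fix F assume "F \<in> {F. finite F \<and> F \<subseteq> A}"
      then have F: "finite F" "F \<subseteq> A" by auto
      have "sum f F = (\<integral>\<^sup>+k. f k * indicator F k \<partial>count_space A)"
        using nn_integral_count_space'[of F A "\<lambda>k. f k * indicator F k"] F by simp
      also have "\<dots> \<le> (\<integral>\<^sup>+k. f k \<partial>count_space A)"
        by (intro nn_integral_mono) (auto simp: indicator_def)
      finally show "sum f F \<le> (\<integral>\<^sup>+k. f k \<partial>count_space A)" .
    qed
    let ?e = "to_nat_on A" and ?d = "from_nat_into A"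
    have "(\<integral>\<^sup>+k. f k \<partial>count_space A) = (\<integral>\<^sup>+k. f (?d (?e k)) \<partial>count_space A)"
      by (intro nn_integral_cong) (simp add: assms)
    also have "\<dots> = (\<integral>\<^sup>+n. f (?d n) \<partial>count_space (?e ` A))"
      by (rule nn_integral_bij_count_space[of _ _ _ "\<lambda>n. f (?d n)"]) (rule inj_on_imp_bij_betw[OF inj_on_to_nat_on[OF assms]])
    also have "\<dots> = (\<integral>\<^sup>+n. f (?d n) * indicator (?e ` A) n \<partial>count_space UNIV)"
      by (subst nn_integral_restrict_space[symmetric]) (simp_all add: restrict_count_space)
    also have "\<dots> = (SUP N. \<Sum>n<N. f (?d n) * indicator (?e ` A) n)"
      by (simp add: nn_integral_count_space_nat suminf_eq_SUP)
    also have "\<dots> \<le> (SUP F\<in>{F. finite F \<and> F \<subseteq> A}. sum f F)"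
    proof (intro SUP_least)
      fix N
      let ?N = "{..<N} \<inter> ?e ` A"
      have "(\<Sum>n<N. f (?d n) * indicator (?e ` A) n) = (\<Sum>n\<in>?N. f (?d n))"
        by (simp add: sum.inter_restrict indicator_def if_distrib cong: if_cong)
      also have "\<dots> = sum f (?d ` ?N)"
        by (subst sum.reindex) (auto simp: inj_on_def assms)
      also have "\<dots> \<le> (SUP F\<in>{F. finite F \<and> F \<subseteq> A}. sum f F)"
        by (intro SUP_upper) (auto simp: assms)
      finally show "(\<Sum>n<N. f (?d n) * indicator (?e ` A) n) \<le> (SUP F\<in>{F. finite F \<and> F \<subseteq> A}. sum f F)" .
    qed
    finally show "(\<integral>\<^sup>+k. f k \<partial>count_space A) \<le> (SUP F\<in>{F. finite F \<and> F \<subseteq> A}. sum f F)" .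
  qed
qed

lemma countable_int_lattice: "countable (int_lattice :: (real ^ 'n) set)"
proof (rule countable_subset)
  show "(int_lattice :: (real ^ 'n) set) \<subseteq> (\<lambda>m :: 'n \<Rightarrow> int. \<chi> i. of_int (m i)) ` UNIV"
  proof
    fix k :: "real ^ 'n" assume "k \<in> int_lattice"
    then have "k = (\<chi> i. of_int \<lfloor>k $ i\<rfloor>)" by (auto simp: int_lattice_def vec_eq_iff)
    then show "k \<in> (\<lambda>m :: 'n \<Rightarrow> int. \<chi> i. of_int (m i)) ` UNIV"
      by (rule image_eqI[where x = "\<lambda>i. \<lfloor>k $ i\<rfloor>"]) simp
  qed
qed simp

definition unit_cube :: "(real ^ 'n) set" where "unit_cube = {x. \<forall>i. 0 \<le> x $ i \<and> x $ i < 1}"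

lemma unit_cube_sets [measurable]: "unit_cube \<in> sets (borel :: (real ^ 'n) measure)"
proof -
  have "{x \<in> space (borel :: (real ^ 'n) measure). \<forall>i. 0 \<le> x $ i \<and> x $ i < 1} \<in> sets borel" by measurable
  then show ?thesis by (simp add: unit_cube_def)
qed

lemma emeasure_unit_cube: "emeasure lborel (unit_cube :: (real ^ 'n) set) = 1"
proof (rule antisym)
  let ?z = "0 :: real ^ 'n" and ?o = "(\<chi> i. 1) :: real ^ 'n"
  have le: "?z \<bullet> b \<le> ?o \<bullet> b" if "b \<in> Basis" for b
    using that by (auto simp: Basis_vec_def inner_axis)
  have "emeasure lborel (unit_cube :: (real ^ 'n) set) \<le> emeasure lborel (cbox ?z ?o)"
    by (intro emeasure_mono) (auto simp: unit_cube_def mem_box_cart less_imp_le)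
  also have "\<dots> = 1" by (simp add: emeasure_lborel_cbox[OF le] prod_Basis_cart inner_axis)
  finally show "emeasure lborel (unit_cube :: (real ^ 'n) set) \<le> 1" .
  have "1 = emeasure lborel (box ?z ?o)"
    by (simp add: emeasure_lborel_box[OF le] prod_Basis_cart inner_axis)
  also have "\<dots> \<le> emeasure lborel (unit_cube :: (real ^ 'n) set)"
    by (intro emeasure_mono) (auto simp: unit_cube_def mem_box_cart less_imp_le)
  finally show "1 \<le> emeasure lborel (unit_cube :: (real ^ 'n) set)" .
qed

lemma nn_integral_lborel_translation:
  fixes h :: "real ^ 'n \<Rightarrow> ennreal"
  assumes [measurable]: "h \<in> borel_measurable borel"
  shows "(\<integral>\<^sup>+x. h (c + x) \<partial>lborel) = (\<integral>\<^sup>+x. h x \<partial>lborel)"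
proof -
  have "(\<integral>\<^sup>+x. h x \<partial>lborel) = (\<integral>\<^sup>+x. h x \<partial>distr lborel borel ((+) c))" by (simp add: lborel_distr_plus)
  then show ?thesis by (simp add: nn_integral_distr)
qed

text \<open>
  Every point lies in exactly one lattice translate of the half-open unit cube.
\<close>

lemma nn_integral_tiling:
  fixes h :: "real ^ 'n \<Rightarrow> ennreal"
  assumes [measurable]: "h \<in> borel_measurable borel"
  shows "(\<integral>\<^sup>+x. h x \<partial>lborel) = (\<integral>\<^sup>+y. indicator unit_cube y * (\<Sum>\<^sub>\<infinity>k\<in>int_lattice. h (k + y)) \<partial>lborel)"
proof -
  note ct = countable_int_lattice
  have tile: "(\<integral>\<^sup>+k. h x * indicator unit_cube (x - k) \<partial>count_space int_lattice) = h x" for x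
  proof -
    define k0 :: "real ^ 'n" where "k0 = (\<chi> i. of_int \<lfloor>x $ i\<rfloor>)"
    have k0: "k0 \<in> int_lattice" by (simp add: k0_def int_lattice_def)
    have "x - k \<in> unit_cube \<longleftrightarrow> k = k0" if "k \<in> int_lattice" for k
    proof
      assume u: "x - k \<in> unit_cube"
      have "k $ i = of_int \<lfloor>x $ i\<rfloor>" for i
      proof -
        have "k $ i \<in> \<int>" using that by (simp add: int_lattice_def)
        then obtain m where "k $ i = of_int m" by (rule Ints_cases)
        moreover have "0 \<le> (x - k) $ i \<and> (x - k) $ i < 1" using u by (simp only: unit_cube_def mem_Collect_eq)
        ultimately have "\<lfloor>x $ i\<rfloor> = m" by (intro floor_unique) auto
        with \<open>k $ i = of_int m\<close> show ?thesis by simp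
      qed
      then show "k = k0" by (simp add: k0_def vec_eq_iff)
    next
      assume "k = k0"
      moreover have "0 \<le> x $ i - of_int \<lfloor>x $ i\<rfloor> \<and> x $ i - of_int \<lfloor>x $ i\<rfloor> < 1" for i by linarith
      ultimately show "x - k \<in> unit_cube" by (simp add: unit_cube_def k0_def)
    qed
    then have "(\<integral>\<^sup>+k. h x * indicator unit_cube (x - k) \<partial>count_space int_lattice)
      = (\<integral>\<^sup>+k. h x * indicator {k0} k \<partial>count_space int_lattice)"
      by (intro nn_integral_cong) (auto simp: indicator_def)
    also have "\<dots> = h x"
      using nn_integral_count_space'[of "{k0}" int_lattice "\<lambda>k. h x * indicator {k0} k"] k0 by simp
    finally show ?thesis .
  qed
  have "(\<integral>\<^sup>+x. h x \<partial>lborel) = (\<integral>\<^sup>+x. (\<integral>\<^sup>+k. h x * indicator unit_cube (x - k) \<partial>count_space int_lattice) \<partial>lborel)"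
    by (simp only: tile)
  also have "\<dots> = (\<integral>\<^sup>+k. (\<integral>\<^sup>+x. h x * indicator unit_cube (x - k) \<partial>lborel) \<partial>count_space int_lattice)"
    by (rule nn_integral_count_space_nn_integral[OF ct]) measurable
  also have "\<dots> = (\<integral>\<^sup>+k. (\<integral>\<^sup>+y. h (k + y) * indicator unit_cube y \<partial>lborel) \<partial>count_space int_lattice)"
  proof (rule nn_integral_cong)
    fix k :: "real ^ 'n"
    show "(\<integral>\<^sup>+x. h x * indicator unit_cube (x - k) \<partial>lborel) = (\<integral>\<^sup>+y. h (k + y) * indicator unit_cube y \<partial>lborel)"
      by (subst nn_integral_lborel_translation[of _ k, symmetric]) (auto simp: algebra_simps)
  qed
  also have "\<dots> = (\<integral>\<^sup>+y. (\<integral>\<^sup>+k. h (k + y) * indicator unit_cube y \<partial>count_space int_lattice) \<partial>lborel)"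
    by (rule nn_integral_count_space_nn_integral[OF ct, symmetric]) measurable
  also have "\<dots> = (\<integral>\<^sup>+y. indicator unit_cube y * (\<Sum>\<^sub>\<infinity>k\<in>int_lattice. h (k + y)) \<partial>lborel)"
    unfolding infsum_ennreal_eq_nn_integral[OF ct]
    by (intro nn_integral_cong) (simp add: nn_integral_multc mult.commute[of "indicator unit_cube _"])
  finally show ?thesis .
qed

text \<open>
  Continuous functions of compact support. Boundedness of the set of nonzero values is the form of
  the support condition that is easiest to propagate.
\<close>

definition cont_cs :: "(real ^ 'd \<Rightarrow> complex) \<Rightarrow> bool"
  where "cont_cs f \<longleftrightarrow> continuous_on UNIV f \<and> bounded {x. f x \<noteq> 0}"

lemma cont_cs_mult: "cont_cs f \<Longrightarrow> continuous_on UNIV g \<Longrightarrow> cont_cs (\<lambda>x. f x * g x)"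
  unfolding cont_cs_def by (auto intro!: continuous_intros elim!: bounded_subset)

lemma cont_cs_add: "cont_cs f \<Longrightarrow> cont_cs g \<Longrightarrow> cont_cs (\<lambda>x. f x + g x)"
  unfolding cont_cs_def
  by (auto intro!: continuous_intros intro: bounded_subset[of "{x. f x \<noteq> 0} \<union> {x. g x \<noteq> 0}"])

lemma continuous_compact_support_integrable:
  fixes f :: "real ^ 'd \<Rightarrow> 'b::{banach, second_countable_topology}"
  assumes "continuous_on UNIV f" "bounded {x. f x \<noteq> 0}" shows "integrable lborel f"
proof -
  obtain R where R: "\<And>x. f x \<noteq> 0 \<Longrightarrow> norm x \<le> R" using assms(2) by (auto simp: bounded_iff)
  have "integrable lborel (\<lambda>x. indicator (cball 0 R) x *\<^sub>R f x)"
    by (intro borel_integrable_compact compact_cball continuous_on_subset[OF assms(1)]) auto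
  moreover have "indicator (cball 0 R) x *\<^sub>R f x = f x" for x using R[of x] by (auto simp: indicator_def)
  ultimately show ?thesis by simp
qed

lemma cont_cs_integrable: "cont_cs f \<Longrightarrow> integrable lborel f"
  by (simp add: cont_cs_def continuous_compact_support_integrable)

lemma cont_cs_measurable [measurable_dest]: "cont_cs f \<Longrightarrow> f \<in> borel_measurable borel"
  by (simp add: cont_cs_def borel_measurable_continuous_onI)

lemma cont_cs_norm_square_integrable: "cont_cs f \<Longrightarrow> integrable lborel (\<lambda>x. (cmod (f x))\<^sup>2)"
  by (rule continuous_compact_support_integrable) (auto simp: cont_cs_def intro!: continuous_intros)

lemma cnj_chr: "cnj (chr k x) = exp (- (\<i> * complex_of_real (x \<bullet> k)))"
  by (simp only: chr_minus[symmetric]) (simp add: chr_def inner_commute)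

lemma chr_measurable [measurable]:
  "(\<lambda>x. chr k x) \<in> borel_measurable borel" "(\<lambda>x. cnj (chr k x)) \<in> borel_measurable borel"
  by (intro borel_measurable_continuous_onI continuous_intros)+

text \<open>
  For Borel functions the completed measure can be replaced by the Borel measure, for which Fubini's
  theorem and changes of variables are available.
\<close>

lemma fourier_lborel:
  assumes [measurable]: "f \<in> borel_measurable borel"
  shows "fourier f \<xi> = (LINT x|lborel. f x * cnj (chr \<xi> x))"
proof -
  have "fourier f \<xi> = (LINT x|lebesgue. f x * cnj (chr \<xi> x))"
    by (simp only: fourier_def cnj_chr)
  also have "\<dots> = (LINT x|lborel. f x * cnj (chr \<xi> x))"
    by (rule integral_completion) measurable
  finally show ?thesis .
qed

lemma fourier_continuous:
  assumes f: "integrable lborel f"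
  shows "continuous_on UNIV (fourier f)"
proof (rule continuous_on_sequentiallyI)
  have [measurable]: "f \<in> borel_measurable borel" using f by auto
  fix u :: "nat \<Rightarrow> real ^ 'a" and l assume u: "u \<longlonglongrightarrow> l"
  have "(\<lambda>n. LINT x|lborel. f x * cnj (chr (u n) x)) \<longlonglongrightarrow> (LINT x|lborel. f x * cnj (chr l x))"
  proof (rule integral_dominated_convergence)
    show "integrable lborel (\<lambda>x. cmod (f x))" using f by auto
    show "AE x in lborel. (\<lambda>n. f x * cnj (chr (u n) x)) \<longlonglongrightarrow> f x * cnj (chr l x)"
      unfolding chr_def by (intro AE_I2 tendsto_intros u)
  qed (auto simp: norm_mult)
  then show "(\<lambda>n. fourier f (u n)) \<longlonglongrightarrow> fourier f l" by (simp add: fourier_lborel)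
qed

lemma det_mat_scalar: "det (mat R :: real ^ 'n ^ 'n) = R ^ CARD('n)"
  by (subst det_diagonal) (auto simp: mat_def)

lemma mat_scalar_mult: "(mat R :: real ^ 'n ^ 'n) *v x = R *\<^sub>R x"
proof -
  have "(\<Sum>j\<in>UNIV. (if i = j then R else 0) * x $ j) = (\<Sum>j\<in>UNIV. if j = i then R * x $ j else 0)" for i
    by (intro sum.cong) auto
  then show ?thesis by (simp add: matrix_vector_mult_def mat_def vec_eq_iff)
qed

lemma nn_integral_lborel_scale:
  fixes h :: "real ^ 'n \<Rightarrow> ennreal"
  assumes "h \<in> borel_measurable borel" "R > 0"
  shows "ennreal (R ^ CARD('n)) * (\<integral>\<^sup>+x. h (R *\<^sub>R x) \<partial>lborel) = (\<integral>\<^sup>+x. h x \<partial>lborel)"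
  using nn_integral_lborel_linear[OF assms(1), of "mat R"] assms(2)
  by (simp add: det_mat_scalar mat_scalar_mult)

lemma integral_lborel_scale:
  fixes h :: "real ^ 'n \<Rightarrow> complex"
  assumes "h \<in> borel_measurable borel" "R > 0"
  shows "complex_of_real (R ^ CARD('n)) * (LINT x|lborel. h (R *\<^sub>R x)) = (LINT x|lborel. h x)"
  using integral_lborel_linear[of "mat R" h] assms
  by (simp add: det_mat_scalar mat_scalar_mult)

text \<open>
  Multiplying \<open>f\<close> by a character does not change its norm, so Parseval's identity gives the same value
  for the sum of \<open>\<bar>f^ (k + y)\<bar>\<^sup>2\<close> over the lattice for every shift \<open>y\<close>. Averaging over the unit cube
  turns the sum into an integral over the space.
\<close>

lemma plancherel_small_support:
  fixes f :: "real ^ 'd \<Rightarrow> complex"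
  assumes f: "continuous_on UNIV f" and supp: "\<And>x. f x \<noteq> 0 \<Longrightarrow> norm x \<le> 1"
  shows "(\<integral>\<^sup>+\<xi>. ennreal ((cmod (fourier f \<xi>))\<^sup>2) \<partial>lborel) = ennreal ((2 * pi) ^ CARD('d) * (LINT x|lborel. (cmod (f x))\<^sup>2))"
proof -
  have cont_cs: "cont_cs f" using f supp by (auto simp: cont_cs_def bounded_iff)
  have m: "f \<in> borel_measurable borel" using cont_cs by (rule cont_cs_measurable)
  have [measurable]: "fourier f \<in> borel_measurable borel"
    by (intro borel_measurable_continuous_onI fourier_continuous cont_cs_integrable cont_cs)
  let ?c = "ennreal ((2 * pi) ^ CARD('d) * (LINT x|lborel. (cmod (f x))\<^sup>2))"
  have s: "(\<Sum>\<^sub>\<infinity>k\<in>int_lattice. ennreal ((cmod (fourier f (k + y)))\<^sup>2)) = ?c" for y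
  proof -
    have "fourier f (k + y) = (LINT x|lborel. (f x * cnj (chr y x)) * cnj (chr k x))" for k
      by (simp add: fourier_lborel[OF m] chr_add mult_ac)
    moreover have "\<bar>x $ i\<bar> \<le> 1" if "f x \<noteq> 0" for x i
      using supp[OF that] component_le_norm_cart[of x i] by simp
    ultimately show ?thesis
      using parseval_torus[of "\<lambda>x. f x * cnj (chr y x)"] f
      by (simp add: norm_mult continuous_intros)
  qed
  have "(\<integral>\<^sup>+\<xi>. ennreal ((cmod (fourier f \<xi>))\<^sup>2) \<partial>lborel)
      = (\<integral>\<^sup>+y. indicator unit_cube y * (\<Sum>\<^sub>\<infinity>k\<in>int_lattice. ennreal ((cmod (fourier f (k + y)))\<^sup>2)) \<partial>lborel)"
    by (rule nn_integral_tiling) measurable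
  also have "\<dots> = (\<integral>\<^sup>+y. indicator (unit_cube :: (real ^ 'd) set) y * ?c \<partial>lborel)"
    by (simp only: s)
  also have "\<dots> = ?c"
    by (simp add: nn_integral_multc emeasure_unit_cube)
  finally show ?thesis .
qed

text \<open>
  A dilation brings the support into the unit ball.
\<close>

theorem plancherel:
  fixes f :: "real ^ 'd \<Rightarrow> complex"
  assumes f: "cont_cs f"
  shows "(\<integral>\<^sup>+\<xi>. ennreal ((cmod (fourier f \<xi>))\<^sup>2) \<partial>lborel) = ennreal ((2 * pi) ^ CARD('d) * (LINT x|lborel. (cmod (f x))\<^sup>2))"
proof -
  note [measurable] = cont_cs_measurable[OF f]
  obtain R0 where R0: "\<And>x. f x \<noteq> 0 \<Longrightarrow> norm x \<le> R0" using f by (auto simp: cont_cs_def bounded_iff)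
  define R where "R = max 1 R0"
  have R: "R > 0" "\<And>x. f x \<noteq> 0 \<Longrightarrow> norm x \<le> R" using R0 by (force simp: R_def)+
  define w where "w = R ^ CARD('d)"
  have w: "w > 0" using R by (simp add: w_def)
  define g where "g x = f (R *\<^sub>R x)" for x
  have g: "continuous_on UNIV g" unfolding g_def
    by (rule continuous_on_compose2[of UNIV f UNIV "\<lambda>x. R *\<^sub>R x"])
      (use f in \<open>simp_all add: cont_cs_def continuous_on_scaleR continuous_on_const continuous_on_id\<close>)
  have gs: "norm x \<le> 1" if "g x \<noteq> 0" for x
    using R(2)[of "R *\<^sub>R x"] that R(1) by (simp add: g_def)
  have gm: "g \<in> borel_measurable borel" using g by (intro borel_measurable_continuous_onI)
  have [measurable]: "fourier f \<in> borel_measurable borel"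
    by (intro borel_measurable_continuous_onI fourier_continuous cont_cs_integrable f)
  have hat: "fourier f \<xi> = complex_of_real w * fourier g (R *\<^sub>R \<xi>)" for \<xi>
  proof -
    have c: "chr \<xi> (R *\<^sub>R x) = chr (R *\<^sub>R \<xi>) x" for x by (simp add: chr_def)
    have "fourier f \<xi> = complex_of_real w * (LINT x|lborel. f (R *\<^sub>R x) * cnj (chr \<xi> (R *\<^sub>R x)))"
      unfolding fourier_lborel[OF cont_cs_measurable[OF f]] w_def
      by (rule integral_lborel_scale[symmetric]) (use R in measurable)
    then show ?thesis by (simp only: c fourier_lborel[OF gm] g_def)
  qed
  have [measurable]: "fourier g \<in> borel_measurable borel"
    by (intro borel_measurable_continuous_onI fourier_continuous cont_cs_integrable)
      (use g gs in \<open>auto simp: cont_cs_def bounded_iff\<close>)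
  have sq: "complex_of_real w * complex_of_real (LINT x|lborel. (cmod (g x))\<^sup>2) = complex_of_real (LINT x|lborel. (cmod (f x))\<^sup>2)"
    unfolding integral_complex_of_real[symmetric] w_def g_def
    by (rule integral_lborel_scale) (use R in measurable)
  then have sq: "w * (LINT x|lborel. (cmod (g x))\<^sup>2) = (LINT x|lborel. (cmod (f x))\<^sup>2)"
    by (metis of_real_mult of_real_eq_iff)
  have "(\<integral>\<^sup>+\<xi>. ennreal ((cmod (fourier f \<xi>))\<^sup>2) \<partial>lborel)
      = (\<integral>\<^sup>+\<xi>. ennreal (w\<^sup>2) * ennreal ((cmod (fourier g (R *\<^sub>R \<xi>)))\<^sup>2) \<partial>lborel)"
    using w by (intro nn_integral_cong) (simp add: hat norm_mult power_mult_distrib ennreal_mult)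
  also have "\<dots> = ennreal (w\<^sup>2) * (\<integral>\<^sup>+\<xi>. ennreal ((cmod (fourier g (R *\<^sub>R \<xi>)))\<^sup>2) \<partial>lborel)"
    by (rule nn_integral_cmult) measurable
  also have "\<dots> = ennreal w * (ennreal w * (\<integral>\<^sup>+\<xi>. ennreal ((cmod (fourier g (R *\<^sub>R \<xi>)))\<^sup>2) \<partial>lborel))"
    using w by (simp add: power2_eq_square ennreal_mult mult.assoc)
  also have "ennreal w * (\<integral>\<^sup>+\<xi>. ennreal ((cmod (fourier g (R *\<^sub>R \<xi>)))\<^sup>2) \<partial>lborel) = (\<integral>\<^sup>+\<xi>. ennreal ((cmod (fourier g \<xi>))\<^sup>2) \<partial>lborel)"
    unfolding w_def by (rule nn_integral_lborel_scale) (use R in measurable)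
  also have "\<dots> = ennreal ((2 * pi) ^ CARD('d) * (LINT x|lborel. (cmod (g x))\<^sup>2))"
    by (rule plancherel_small_support[OF g gs])
  also have "ennreal w * \<dots> = ennreal ((2 * pi) ^ CARD('d) * (LINT x|lborel. (cmod (f x))\<^sup>2))"
    using w sq by (simp add: ennreal_mult'[symmetric] mult.left_commute)
  finally show ?thesis .
qed

section \<open>Smooth functions\<close>

text \<open>
  Differentiability together with explicit partial derivatives. The sum over the coordinates is the
  total derivative, so that the rules for total derivatives compute partial derivatives.
\<close>

definition has_partials :: "(real ^ 'd \<Rightarrow> complex) \<Rightarrow> ('d \<Rightarrow> real ^ 'd \<Rightarrow> complex) \<Rightarrow> bool"
  where "has_partials f g \<longleftrightarrow>
    (\<forall>x. (f has_derivative (\<lambda>h. \<Sum>i\<in>UNIV. complex_of_real (h $ i) * g i x)) (at x))"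

lemma sum_axis_mult: "(\<Sum>i\<in>UNIV. complex_of_real (axis j 1 $ i) * g i) = g j"
proof -
  have "(\<Sum>i\<in>UNIV. complex_of_real (axis j 1 $ i) * g i) = (\<Sum>i\<in>UNIV. if i = j then g i else 0)"
    by (intro sum.cong) (auto simp: axis_def)
  then show ?thesis by simp
qed

lemma has_partials_imp_partial_deriv:
  assumes "has_partials f g" shows "partial_deriv i f = g i"
proof
  fix x
  have "frechet_derivative f (at x) = (\<lambda>h. \<Sum>i\<in>UNIV. complex_of_real (h $ i) * g i x)"
    using assms unfolding has_partials_def by (intro frechet_derivative_at[symmetric]) blast
  then show "partial_deriv i f x = g i x"
    by (simp add: partial_deriv_def sum_axis_mult)
qed

lemma linear_vec_expand:
  fixes L :: "real ^ 'd \<Rightarrow> complex" assumes "linear L"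
  shows "L h = (\<Sum>i\<in>UNIV. complex_of_real (h $ i) * L (axis i 1))"
proof -
  have "h = (\<Sum>i\<in>UNIV. h $ i *\<^sub>R axis i 1)"
    using basis_expansion[of h] by (simp add: scalar_mult_eq_scaleR)
  then have "L h = L (\<Sum>i\<in>UNIV. h $ i *\<^sub>R axis i 1)" by simp
  also have "\<dots> = (\<Sum>i\<in>UNIV. h $ i *\<^sub>R L (axis i 1))"
    by (simp only: linear_sum[OF assms] linear_scale[OF assms])
  finally show ?thesis by (simp add: scaleR_conv_of_real)
qed

lemma differentiable_imp_has_partials:
  assumes "f differentiable_on UNIV" shows "has_partials f (\<lambda>i. partial_deriv i f)"
  unfolding has_partials_def
proof
  fix x
  have d: "(f has_derivative frechet_derivative f (at x)) (at x)"
    using assms frechet_derivative_works by (auto simp: differentiable_on_def)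
  then have "linear (frechet_derivative f (at x))"
    using has_derivative_linear by blast
  then have "frechet_derivative f (at x) = (\<lambda>h. \<Sum>i\<in>UNIV. complex_of_real (h $ i) * partial_deriv i f x)"
    unfolding partial_deriv_def by (intro ext linear_vec_expand)
  with d show "(f has_derivative (\<lambda>h. \<Sum>i\<in>UNIV. complex_of_real (h $ i) * partial_deriv i f x)) (at x)"
    by simp
qed

lemma has_partials_imp_differentiable: "has_partials f g \<Longrightarrow> f differentiable_on UNIV"
  by (auto simp: has_partials_def differentiable_on_def differentiable_def)

lemma partial_derivs_snoc: "partial_derivs (is @ [i]) f = partial_derivs is (partial_deriv i f)"
  by (simp add: partial_derivs_def)

lemma smooth_differentiable: "smooth f \<Longrightarrow> f differentiable_on UNIV"
  unfolding smooth_def by (metis partial_derivs_def foldr_Nil id_apply)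

lemma smooth_partial_deriv: "smooth f \<Longrightarrow> smooth (partial_deriv i f)"
  unfolding smooth_def by (metis partial_derivs_snoc)

lemma smooth_has_partials: "smooth f \<Longrightarrow> has_partials f (\<lambda>i. partial_deriv i f)"
  by (intro differentiable_imp_has_partials smooth_differentiable)

lemma smooth_continuous: "smooth f \<Longrightarrow> continuous_on UNIV f"
  by (intro differentiable_imp_continuous_on smooth_differentiable)

text \<open>
  Smoothness is the largest class of differentiable functions that is closed under partial
  derivatives. Hence a function is smooth if it lies in some class with these closure properties.
\<close>

lemma smooth_coinduct:
  assumes "P f" and step: "\<And>f. P f \<Longrightarrow> \<exists>g. has_partials f g \<and> (\<forall>i. P (g i))"
  shows "smooth f"
proof -
  have "P (partial_derivs is f)" for "is"
    using \<open>P f\<close>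
  proof (induction "is" arbitrary: f rule: rev_induct)
    case Nil then show ?case by (simp add: partial_derivs_def)
  next
    case (snoc i is')
    then have "P (partial_deriv i f)" using step has_partials_imp_partial_deriv by metis
    then show ?case using snoc.IH by (simp add: partial_derivs_snoc)
  qed
  then show ?thesis unfolding smooth_def using step has_partials_imp_differentiable by blast
qed

text \<open>
  For \<open>p = 1\<close> this is the classical flat function \<open>exp (- 1 / t)\<close> on the positive axis. The polynomial
  factor in \<open>1 / t\<close> makes the family closed under differentiation.
\<close>

definition flat :: "real poly \<Rightarrow> real \<Rightarrow> real"
  where "flat p t = (if t > 0 then poly p (1 / t) * exp (- 1 / t) else 0)"

lemma poly_times_exp_tendsto_0: "((\<lambda>s::real. poly p s * exp (- s)) \<longlongrightarrow> 0) at_top"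
proof -
  have "((\<lambda>s. \<Sum>i\<le>degree p. coeff p i * (s ^ i / exp s)) \<longlongrightarrow> (\<Sum>i\<le>degree p. coeff p i * 0)) at_top"
    by (intro tendsto_intros tendsto_power_div_exp_0)
  moreover have "(\<Sum>i\<le>degree p. coeff p i * (s ^ i / exp s)) = poly p s * exp (- s)" for s :: real
    by (simp add: poly_altdef sum_distrib_right exp_minus divide_inverse mult.assoc)
  ultimately show ?thesis by simp
qed

lemma flat_tendsto_0: "(flat p \<longlongrightarrow> 0) (at 0)"
proof -
  have "((\<lambda>t. poly p (inverse t) * exp (- inverse t)) \<longlongrightarrow> 0) (at_right 0)"
    by (rule filterlim_compose[OF poly_times_exp_tendsto_0 filterlim_inverse_at_top_right])
  then have "(flat p \<longlongrightarrow> 0) (at_right 0)"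
    by (rule Lim_transform_eventually)
       (auto simp: flat_def eventually_at_filter divide_inverse)
  moreover have "(flat p \<longlongrightarrow> 0) (at_left 0)"
    by (rule tendsto_eventually) (auto simp: flat_def eventually_at_filter)
  ultimately show ?thesis by (simp add: filterlim_split_at)
qed

lemma flat_has_derivative:
  "(flat p has_field_derivative flat ([:0, 0, 1:] * (p - pderiv p)) t) (at t)"
proof (cases "t = 0")
  case True
  have "((\<lambda>t. flat p t / t) \<longlongrightarrow> 0) (at 0)"
    using flat_tendsto_0[of "pCons 0 p"]
    by (rule Lim_transform_eventually) (auto simp: flat_def eventually_at_filter)
  then show ?thesis using True by (simp add: has_field_derivative_iff flat_def)
next
  case False
  show ?thesis
  proof (cases "t > 0")
    case True
    have "((\<lambda>t. poly p (1/t) * exp (- 1 / t)) has_field_derivative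
       flat ([:0, 0, 1:] * (p - pderiv p)) t) (at t)"
      using True
      by (auto intro!: derivative_eq_intros DERIV_chain'[where g = "poly p"]
        simp: flat_def field_simps power2_eq_square)
    then show ?thesis
      by (rule has_field_derivative_transform_within_open[of _ _ _ "{0<..}"])
        (use True in \<open>auto simp: flat_def\<close>)
  next
    case f: False
    have "((\<lambda>t. 0) has_field_derivative flat ([:0, 0, 1:] * (p - pderiv p)) t) (at t)"
      using f by (simp add: flat_def)
    then show ?thesis
      by (rule has_field_derivative_transform_within_open[of _ _ _ "{..<0}"])
        (use f False in \<open>auto simp: flat_def\<close>)
  qed
qed

text \<open>
  Instead of a product rule, chain rule and so on for derivatives of all orders, all closure
  properties of smooth functions are proved at once: the first partial derivatives of an elementary
  function are elementary, so coinduction applies to the whole class.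
\<close>

inductive elementary :: "(real ^ 'd \<Rightarrow> complex) \<Rightarrow> bool" where
  smooth: "smooth f \<Longrightarrow> elementary f"
| compose: "smooth f \<Longrightarrow> Real_Vector_Spaces.linear (L :: real ^ 'd \<Rightarrow> real ^ 'd) \<Longrightarrow> elementary (\<lambda>x. f (L x))"
| const: "elementary (\<lambda>x. c)"
| linear: "linear L \<Longrightarrow> elementary (\<lambda>x. complex_of_real (L x))"
| add: "elementary f \<Longrightarrow> elementary g \<Longrightarrow> elementary (\<lambda>x. f x + g x)"
| mult: "elementary f \<Longrightarrow> elementary g \<Longrightarrow> elementary (\<lambda>x. f x * g x)"
| inverse: "elementary f \<Longrightarrow> (\<And>x. f x \<noteq> 0) \<Longrightarrow> elementary (\<lambda>x. inverse (f x))"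
| exp: "elementary f \<Longrightarrow> elementary (\<lambda>x. exp (f x))"
| flat: "elementary (\<lambda>x. complex_of_real (q x)) \<Longrightarrow> elementary (\<lambda>x. complex_of_real (flat p (q x)))"

lemma elementary_sum: "(\<And>i. i \<in> A \<Longrightarrow> elementary (f i)) \<Longrightarrow> elementary (\<lambda>x. \<Sum>i\<in>A. f i x)"
  by (induction A rule: infinite_finite_induct) (simp_all add: elementary.const elementary.add)

lemma elementary_step:
  assumes "elementary f" shows "\<exists>g. has_partials f g \<and> (\<forall>i. elementary (g i))"
  using assms
proof induction
  case (smooth f)
  then show ?case using smooth_has_partials smooth_partial_deriv elementary.smooth by blast
next
  case (compose f L)
  let ?g = "\<lambda>i x. \<Sum>j\<in>UNIV. complex_of_real (L (axis i 1) $ j) * partial_deriv j f (L x)"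
  have "has_partials (\<lambda>x. f (L x)) ?g"
    unfolding has_partials_def
  proof
    fix x
    have L: "(L has_derivative L) (at x)"
      using compose(2) by (intro bounded_linear_imp_has_derivative) (simp add: linear_conv_bounded_linear)
    have "(f has_derivative (\<lambda>h. \<Sum>j\<in>UNIV. complex_of_real (h $ j) * partial_deriv j f (L x))) (at (L x))"
      using smooth_has_partials[OF compose(1)] by (simp add: has_partials_def)
    from has_derivative_compose[OF L this]
    have D: "((\<lambda>x. f (L x)) has_derivative (\<lambda>h. \<Sum>j\<in>UNIV. complex_of_real (L h $ j) * partial_deriv j f (L x))) (at x)" .
    have "(\<lambda>h. \<Sum>j\<in>UNIV. complex_of_real (L h $ j) * partial_deriv j f (L x)) =
      (\<lambda>h. \<Sum>i\<in>UNIV. complex_of_real (h $ i) * ?g i x)"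
    proof (intro ext linear_vec_expand)
      show "Real_Vector_Spaces.linear (\<lambda>h. \<Sum>j\<in>UNIV. complex_of_real (L h $ j) * partial_deriv j f (L x))"
        using compose(2)
        by (simp add: linear_iff sum.distrib distrib_right sum_distrib_left scaleR_conv_of_real[where 'a = complex] mult.assoc)
    qed
    with D show "((\<lambda>x. f (L x)) has_derivative (\<lambda>h. \<Sum>i\<in>UNIV. complex_of_real (h $ i) * ?g i x)) (at x)"
      by simp
  qed
  moreover have "elementary (?g i)" for i
    by (intro elementary_sum elementary.mult elementary.const elementary.compose smooth_partial_deriv compose)
  ultimately show ?case by (intro exI[of _ ?g] conjI allI)
next
  case (const c)
  show ?case
    by (rule exI[of _ "\<lambda>i x. 0"]) (auto simp: has_partials_def intro: elementary.const)
next
  case (linear L)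
  have D: "((\<lambda>x. complex_of_real (L x)) has_derivative (\<lambda>h. complex_of_real (L h))) (at x)" for x
    using linear by (intro has_derivative_of_real bounded_linear_imp_has_derivative)
      (simp add: linear_conv_bounded_linear)
  have "linear (\<lambda>x. complex_of_real (L x))"
    using linear by (auto simp: linear_iff scaleR_conv_of_real)
  from linear_vec_expand[OF this]
  have "(\<lambda>h. complex_of_real (L h)) = (\<lambda>h. \<Sum>i\<in>UNIV. complex_of_real (h $ i) * complex_of_real (L (axis i 1)))"
    by (intro ext)
  with D have "has_partials (\<lambda>x. complex_of_real (L x)) (\<lambda>i x. complex_of_real (L (axis i 1)))"
    unfolding has_partials_def by metis
  then show ?case by (intro exI[of _ "\<lambda>i x. complex_of_real (L (axis i 1))"] conjI allI elementary.const)
next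
  case (add f g)
  then obtain f' g' where *: "has_partials f f'" "has_partials g g'" "\<And>i. elementary (f' i)" "\<And>i. elementary (g' i)" by auto
  have "has_partials (\<lambda>x. f x + g x) (\<lambda>i x. f' i x + g' i x)"
    unfolding has_partials_def
  proof
    fix x
    show "((\<lambda>x. f x + g x) has_derivative (\<lambda>h. \<Sum>i\<in>UNIV. complex_of_real (h $ i) * (f' i x + g' i x))) (at x)"
      by (rule has_derivative_eq_rhs[OF has_derivative_add])
        (use * in \<open>auto simp: has_partials_def algebra_simps sum.distrib\<close>)
  qed
  then show ?case using * by (intro exI[of _ "\<lambda>i x. f' i x + g' i x"]) (auto intro: elementary.add)
next
  case (mult f g)
  then obtain f' g' where *: "has_partials f f'" "has_partials g g'" "\<And>i. elementary (f' i)" "\<And>i. elementary (g' i)" by auto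
  have "has_partials (\<lambda>x. f x * g x) (\<lambda>i x. f x * g' i x + f' i x * g x)"
    unfolding has_partials_def
  proof
    fix x
    show "((\<lambda>x. f x * g x) has_derivative (\<lambda>h. \<Sum>i\<in>UNIV. complex_of_real (h $ i) * (f x * g' i x + f' i x * g x))) (at x)"
      by (rule has_derivative_eq_rhs[OF has_derivative_mult])
        (use * in \<open>auto simp: has_partials_def algebra_simps sum.distrib sum_distrib_left sum_distrib_right\<close>)
  qed
  then show ?case using * mult.hyps
    by (intro exI[of _ "\<lambda>i x. f x * g' i x + f' i x * g x"] conjI allI elementary.add elementary.mult) auto
next
  case (inverse f)
  then obtain f' where *: "has_partials f f'" "\<And>i. elementary (f' i)" by auto
  have "has_partials (\<lambda>x. inverse (f x)) (\<lambda>i x. (- 1) * (inverse (f x) * f' i x * inverse (f x)))"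
    unfolding has_partials_def
  proof
    fix x
    show "((\<lambda>x. inverse (f x)) has_derivative (\<lambda>h. \<Sum>i\<in>UNIV. complex_of_real (h $ i) * ((- 1) * (inverse (f x) * f' i x * inverse (f x))))) (at x)"
      by (rule has_derivative_eq_rhs[OF Deriv.has_derivative_inverse[OF _ *(1)[unfolded has_partials_def, rule_format]]])
        (use inverse in \<open>simp_all add: fun_eq_iff algebra_simps sum_distrib_left sum_distrib_right sum_negf\<close>)
  qed
  then show ?case using * inverse.hyps
    by (intro exI[of _ "\<lambda>i x. (- 1) * (inverse (f x) * f' i x * inverse (f x))"]
      conjI allI elementary.mult elementary.const elementary.inverse)
next
  case (exp f)
  then obtain f' where *: "has_partials f f'" "\<And>i. elementary (f' i)" by auto
  have "has_partials (\<lambda>x. exp (f x)) (\<lambda>i x. exp (f x) * f' i x)"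
    unfolding has_partials_def
  proof
    fix x
    show "((\<lambda>x. exp (f x)) has_derivative (\<lambda>h. \<Sum>i\<in>UNIV. complex_of_real (h $ i) * (exp (f x) * f' i x))) (at x)"
      by (rule has_derivative_eq_rhs[OF has_derivative_compose
            [OF *(1)[unfolded has_partials_def, rule_format] DERIV_exp[unfolded has_field_derivative_def]]])
        (simp add: fun_eq_iff algebra_simps sum_distrib_left)
  qed
  then show ?case using * exp.hyps
    by (intro exI[of _ "\<lambda>i x. exp (f x) * f' i x"] conjI allI elementary.mult elementary.exp)
next
  case (flat q p)
  then obtain q' where *: "has_partials (\<lambda>x. complex_of_real (q x)) q'" "\<And>i. elementary (q' i)" by auto
  let ?p = "[:0, 0, 1:] * (p - pderiv p)"
  have "has_partials (\<lambda>x. complex_of_real (flat p (q x))) (\<lambda>i x. complex_of_real (flat ?p (q x)) * q' i x)"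
    unfolding has_partials_def
  proof
    fix x
    let ?D = "\<lambda>h. \<Sum>i\<in>UNIV. complex_of_real (h $ i) * q' i x"
    have D: "((\<lambda>x. complex_of_real (q x)) has_derivative ?D) (at x)"
      using * by (simp add: has_partials_def)
    have q: "(q has_derivative (\<lambda>h. Re (?D h))) (at x)"
      using has_derivative_Re[OF D] by simp
    have "?D = (\<lambda>h. complex_of_real (Re (?D h)))"
      using has_derivative_unique[OF D has_derivative_of_real[OF q]] .
    then have eq: "complex_of_real (Re (?D h)) = ?D h" for h by metis
    have "((\<lambda>x. flat p (q x)) has_derivative (\<lambda>h. flat ?p (q x) * Re (?D h))) (at x)"
      by (rule has_derivative_eq_rhs[OF DERIV_compose_FDERIV[OF flat_has_derivative q]])
        (simp add: mult.commute)
    then have "((\<lambda>x. complex_of_real (flat p (q x))) has_derivative (\<lambda>h. complex_of_real (flat ?p (q x) * Re (?D h)))) (at x)"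
      by (rule has_derivative_of_real)
    then have "((\<lambda>x. complex_of_real (flat p (q x))) has_derivative (\<lambda>h. complex_of_real (flat ?p (q x)) * ?D h)) (at x)"
      by (simp only: of_real_mult eq)
    then show "((\<lambda>x. complex_of_real (flat p (q x))) has_derivative
       (\<lambda>h. \<Sum>i\<in>UNIV. complex_of_real (h $ i) * (complex_of_real (flat ?p (q x)) * q' i x))) (at x)"
      by (simp only: sum_distrib_left mult.left_commute)
  qed
  then show ?case using * flat.hyps
    by (intro exI[of _ "\<lambda>i x. complex_of_real (flat ?p (q x)) * q' i x"]
      conjI allI elementary.mult elementary.flat)
qed

lemma smooth_elementary: "elementary f \<Longrightarrow> smooth f"
  by (rule smooth_coinduct[of elementary]) (assumption, erule elementary_step)

lemma smooth_const: "smooth (\<lambda>x. c)"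
  by (rule smooth_elementary[OF elementary.const])

lemma smooth_linear: "linear L \<Longrightarrow> smooth (\<lambda>x. complex_of_real (L x))"
  by (rule smooth_elementary[OF elementary.linear])

lemma smooth_compose_linear: "smooth f \<Longrightarrow> linear (L :: real ^ 'd \<Rightarrow> real ^ 'd) \<Longrightarrow> smooth (\<lambda>x. f (L x))"
  by (rule smooth_elementary[OF elementary.compose[of f L]])

lemma smooth_add: "smooth f \<Longrightarrow> smooth g \<Longrightarrow> smooth (\<lambda>x. f x + g x)"
  by (rule smooth_elementary[OF elementary.add[OF elementary.smooth elementary.smooth]])

lemma smooth_mult: "smooth f \<Longrightarrow> smooth g \<Longrightarrow> smooth (\<lambda>x. f x * g x)"
  by (rule smooth_elementary[OF elementary.mult[OF elementary.smooth elementary.smooth]])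

lemma smooth_inverse: "smooth f \<Longrightarrow> (\<And>x. f x \<noteq> 0) \<Longrightarrow> smooth (\<lambda>x. inverse (f x))"
  by (rule smooth_elementary[OF elementary.inverse[OF elementary.smooth]])

lemma smooth_exp: "smooth f \<Longrightarrow> smooth (\<lambda>x. exp (f x))"
  by (rule smooth_elementary[OF elementary.exp[OF elementary.smooth]])

lemma smooth_flat:
  "smooth (\<lambda>x. complex_of_real (q x)) \<Longrightarrow> smooth (\<lambda>x. complex_of_real (flat p (q x)))"
  by (rule smooth_elementary[OF elementary.flat[OF elementary.smooth]])

lemma smooth_sum: "(\<And>i. i \<in> A \<Longrightarrow> smooth (f i)) \<Longrightarrow> smooth (\<lambda>x. \<Sum>i\<in>A. f i x)"
  by (induction A rule: infinite_finite_induct) (auto intro: smooth_const smooth_add)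

lemma has_partials_translation:
  assumes "has_partials f g" shows "has_partials (\<lambda>x. f (x - c)) (\<lambda>i x. g i (x - c))"
  unfolding has_partials_def
proof
  fix x
  have "((\<lambda>x. x - c) has_derivative (\<lambda>h. h)) (at x)" by (auto intro!: derivative_eq_intros)
  from has_derivative_compose[OF this, of f]
  show "((\<lambda>x. f (x - c)) has_derivative (\<lambda>h. \<Sum>i\<in>UNIV. complex_of_real (h $ i) * g i (x - c))) (at x)"
    using assms unfolding has_partials_def by blast
qed

lemma smooth_translation:
  assumes "smooth f" shows "smooth (\<lambda>x. f (x - c))"
proof (rule smooth_coinduct[of "\<lambda>h. \<exists>f. smooth f \<and> h = (\<lambda>x. f (x - c))"])
  fix h assume "\<exists>f. smooth f \<and> h = (\<lambda>x. f (x - c))"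
  then obtain f where "smooth f" "h = (\<lambda>x. f (x - c))" by blast
  then show "\<exists>g. has_partials h g \<and> (\<forall>i. \<exists>f. smooth f \<and> g i = (\<lambda>x. f (x - c)))"
    by (intro exI[of _ "\<lambda>i x. partial_deriv i f (x - c)"])
      (auto intro: has_partials_translation smooth_has_partials smooth_partial_deriv)
qed (use assms in auto)

text \<open>
  Derivatives depend on the values near a point only. This is used for functions that agree with a
  smooth function, such as zero, on an open set.
\<close>

lemma partial_deriv_local:
  assumes "open V" "y \<in> V" "smooth g" "\<And>z. z \<in> V \<Longrightarrow> f z = g z"
  shows "(f has_derivative (\<lambda>h. \<Sum>i\<in>UNIV. complex_of_real (h $ i) * partial_deriv i g y)) (at y)"
    and "partial_deriv i f y = partial_deriv i g y"
proof -
  show D: "(f has_derivative (\<lambda>h. \<Sum>i\<in>UNIV. complex_of_real (h $ i) * partial_deriv i g y)) (at y)"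
  proof (rule has_derivative_transform_within_open)
    show "(g has_derivative (\<lambda>h. \<Sum>i\<in>UNIV. complex_of_real (h $ i) * partial_deriv i g y)) (at y)"
      using smooth_has_partials[OF assms(3)] by (simp add: has_partials_def)
  qed (use assms in auto)
  have "frechet_derivative f (at y) = (\<lambda>h. \<Sum>i\<in>UNIV. complex_of_real (h $ i) * partial_deriv i g y)"
    using frechet_derivative_at[OF D] by simp
  then show "partial_deriv i f y = partial_deriv i g y"
    by (subst partial_deriv_def) (simp add: sum_axis_mult)
qed

lemma smooth_local:
  assumes "\<And>x. \<exists>V g. open V \<and> x \<in> V \<and> smooth g \<and> (\<forall>y\<in>V. f y = g y)"
  shows "smooth f"
proof (rule smooth_coinduct[of "\<lambda>f. \<forall>x. \<exists>V g. open V \<and> x \<in> V \<and> smooth g \<and> (\<forall>y\<in>V. f y = g y)"])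
  fix f :: "real ^ 'a \<Rightarrow> complex"
  assume "\<forall>x. \<exists>V g. open V \<and> x \<in> V \<and> smooth g \<and> (\<forall>y\<in>V. f y = g y)"
  then obtain V g where *: "\<And>x. open (V x)" "\<And>x. x \<in> V x" "\<And>x. smooth (g x)"
    "\<And>x y. y \<in> V x \<Longrightarrow> f y = g x y" by metis
  note local = partial_deriv_local[OF *(1) _ *(3) *(4)]
  have "f differentiable_on UNIV"
    using local(1)[OF *(2)] by (auto simp: differentiable_on_def differentiable_def)
  have eq: "partial_deriv i f y = partial_deriv i (g x) y" if "y \<in> V x" for i x y
    by (rule local(2)[OF that])
  have "\<exists>W h. open W \<and> x \<in> W \<and> smooth h \<and> (\<forall>y\<in>W. partial_deriv i f y = h y)" for i x
    by (intro exI[of _ "V x"] exI[of _ "partial_deriv i (g x)"] conjI ballI eq *(1,2) smooth_partial_deriv *(3))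
  moreover have "has_partials f (\<lambda>i. partial_deriv i f)"
    by (rule differentiable_imp_has_partials) fact
  ultimately show "\<exists>g. has_partials f g \<and>
    (\<forall>i x. \<exists>V h. open V \<and> x \<in> V \<and> smooth h \<and> (\<forall>y\<in>V. g i y = h y))"
    by (intro exI[of _ "\<lambda>i. partial_deriv i f"] conjI) auto
qed (use assms in auto)

lemma smooth_sin:
  assumes "smooth (\<lambda>x. complex_of_real (q x))" shows "smooth (\<lambda>x. complex_of_real (sin (q x)))"
proof -
  have "smooth (\<lambda>x. (exp (\<i> * complex_of_real (q x)) + (- 1) * exp ((- \<i>) * complex_of_real (q x))) * inverse (2 * \<i>))"
    by (intro smooth_mult smooth_add smooth_exp smooth_const assms)
  moreover have "(exp (\<i> * complex_of_real (q x)) + (- 1) * exp ((- \<i>) * complex_of_real (q x))) * inverse (2 * \<i>)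
      = complex_of_real (sin (q x))" for x
    unfolding sin_of_real[symmetric] sin_exp_eq by (simp only: divide_inverse mult_minus_left mult_1 diff_conv_add_uminus)
  ultimately show ?thesis by (simp only:)
qed

lemma smooth_cos:
  assumes "smooth (\<lambda>x. complex_of_real (q x))" shows "smooth (\<lambda>x. complex_of_real (cos (q x)))"
proof -
  have "smooth (\<lambda>x. complex_of_real (q x) + complex_of_real (pi / 2))"
    by (rule smooth_add[OF assms smooth_const])
  then have "smooth (\<lambda>x. complex_of_real (q x + pi / 2))" by simp
  from smooth_sin[OF this] show ?thesis by (simp add: sin_add)
qed

text \<open>
  A smooth step from one at \<open>t \<le> \<rho>\<close> down to zero at \<open>t \<ge> 1\<close>.
\<close>

definition cutoff :: "real \<Rightarrow> real \<Rightarrow> real"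
  where "cutoff \<rho> t = flat 1 (1 - t) * inverse (flat 1 (1 - t) + flat 1 (t - \<rho>))"

lemma flat_1_nonneg: "flat 1 t \<ge> 0" by (simp add: flat_def)

lemma flat_1_pos: "t > 0 \<Longrightarrow> flat 1 t > 0" by (simp add: flat_def)

lemma cutoff_denominator_pos: "\<rho> < 1 \<Longrightarrow> flat 1 (1 - t) + flat 1 (t - \<rho>) > 0"
  using flat_1_nonneg[of "1 - t"] flat_1_nonneg[of "t - \<rho>"] flat_1_pos[of "1 - t"] flat_1_pos[of "t - \<rho>"]
  by (cases "t < 1") auto

lemma cutoff_eq_1: "\<rho> < 1 \<Longrightarrow> t \<le> \<rho> \<Longrightarrow> cutoff \<rho> t = 1"
  using cutoff_denominator_pos[of \<rho> t] by (auto simp: cutoff_def flat_def)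

lemma cutoff_eq_0: "t \<ge> 1 \<Longrightarrow> cutoff \<rho> t = 0"
  by (auto simp: cutoff_def flat_def)

lemma smooth_cutoff:
  assumes "smooth (\<lambda>x. complex_of_real (q x))" "\<rho> < 1"
  shows "smooth (\<lambda>x. complex_of_real (cutoff \<rho> (q x)))"
proof -
  have "smooth (\<lambda>x. complex_of_real 1 + (- 1) * complex_of_real (q x))"
    by (intro smooth_add smooth_mult smooth_const assms)
  then have 1: "smooth (\<lambda>x. complex_of_real (1 - q x))" by simp
  have "smooth (\<lambda>x. complex_of_real (q x) + complex_of_real (- \<rho>))"
    by (intro smooth_add smooth_const assms)
  then have 2: "smooth (\<lambda>x. complex_of_real (q x - \<rho>))" by simp
  have "flat 1 (1 - q x) + flat 1 (q x - \<rho>) \<noteq> 0" for x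
    using cutoff_denominator_pos[OF assms(2), of "q x"] by simp
  then have ne: "complex_of_real (flat 1 (1 - q x)) + complex_of_real (flat 1 (q x - \<rho>)) \<noteq> 0" for x
    by (metis of_real_add of_real_eq_0_iff)
  have "smooth (\<lambda>x. complex_of_real (flat 1 (1 - q x)) * inverse (complex_of_real (flat 1 (1 - q x)) + complex_of_real (flat 1 (q x - \<rho>))))"
    by (rule smooth_mult[OF smooth_flat[OF 1] smooth_inverse[OF smooth_add[OF smooth_flat[OF 1] smooth_flat[OF 2]]]])
      (rule ne)
  then show ?thesis by (simp add: cutoff_def)
qed

text \<open>
  Reduction modulo \<open>2 \<pi>\<close> into a cube centred at the origin. Composition with \<open>wrap\<close> periodizes a
  function whose support lies in the interior of that cube.
\<close>

definition wrap :: "real ^ 'd \<Rightarrow> real ^ 'd"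
  where "wrap x = (\<chi> i. x $ i - 2 * pi * of_int (round (x $ i / (2 * pi))))"

lemma wrap_eq_self: "(\<And>i. \<bar>x $ i\<bar> < pi) \<Longrightarrow> wrap x = x"
proof -
  assume *: "\<And>i. \<bar>x $ i\<bar> < pi"
  have "round (x $ i / (2 * pi)) = 0" for i
    using *[of i] by (intro round_unique') (simp add: field_simps abs_mult)
  then show ?thesis by (simp add: wrap_def vec_eq_iff)
qed

lemma wrap_periodic:
  assumes "k \<in> int_lattice" shows "wrap (x + (2 * pi) *\<^sub>R k) = wrap x"
proof -
  have "(x $ i + 2 * pi * k $ i) - 2 * pi * of_int (round ((x $ i + 2 * pi * k $ i) / (2 * pi)))
     = x $ i - 2 * pi * of_int (round (x $ i / (2 * pi)))" for i
  proof -
    obtain m where m: "k $ i = of_int m" using assms by (auto simp: int_lattice_def elim: Ints_cases)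
    have "(x $ i + 2 * pi * k $ i) / (2 * pi) = x $ i / (2 * pi) + of_int m"
      by (simp add: m field_simps)
    then have "round ((x $ i + 2 * pi * k $ i) / (2 * pi)) = round (x $ i / (2 * pi)) + m"
      by (simp add: round_def, linarith)
    then show ?thesis by (simp add: m algebra_simps)
  qed
  then show ?thesis by (simp add: wrap_def vec_eq_iff)
qed

text \<open>
  Near a given point, \<open>F (wrap y)\<close> is a translate of \<open>F\<close>. Where \<open>wrap\<close> jumps, some coordinate has
  absolute value close to \<open>\<pi>\<close>, and there both functions vanish.
\<close>

lemma smooth_wrap:
  fixes F :: "real ^ 'd \<Rightarrow> complex"
  assumes F: "smooth F" and supp: "\<And>x i. F x \<noteq> 0 \<Longrightarrow> \<bar>x $ i\<bar> \<le> pi / 2"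
  shows "smooth (\<lambda>x. F (wrap x))"
proof (rule smooth_local)
  fix x :: "real ^ 'd"
  define n where "n i = round (x $ i / (2 * pi))" for i
  \<comment> \<open>the centre of the period that contains \<open>x\<close>; the box \<open>V\<close> reaches a quarter of a period beyond it on every side\<close>
  define k :: "real ^ 'd" where "k = (\<chi> i. 2 * pi * of_int (n i))"
  define V where "V = {y. \<forall>i. \<bar>y $ i - k $ i\<bar> < 3 * pi / 2}"
  have "open V"
  proof -
    have "V = (\<Inter>i. {y. \<bar>y $ i - k $ i\<bar> < 3 * pi / 2})" by (auto simp: V_def)
    then show ?thesis
      by (simp only:) (intro open_INT ballI finite_class.finite_UNIV open_Collect_less continuous_intros)
  qed
  moreover have "x \<in> V"
  proof -
    have "\<bar>x $ i - 2 * pi * of_int (n i)\<bar> \<le> pi" for i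
    proof -
      have "\<bar>of_int (n i) - x $ i / (2 * pi)\<bar> \<le> 1 / 2" unfolding n_def by (rule of_int_round_abs_le)
      then have "2 * pi * \<bar>of_int (n i) - x $ i / (2 * pi)\<bar> \<le> 2 * pi * (1 / 2)"
        by (intro mult_left_mono) auto
      also have "2 * pi * \<bar>of_int (n i) - x $ i / (2 * pi)\<bar> = \<bar>2 * pi * (of_int (n i) - x $ i / (2 * pi))\<bar>"
        by (simp add: abs_mult)
      also have "2 * pi * (of_int (n i) - x $ i / (2 * pi)) = - (x $ i - 2 * pi * of_int (n i))"
        by (simp add: field_simps)
      finally show ?thesis by simp
    qed
    moreover have "pi < 3 * pi / 2" by simp
    ultimately have "\<bar>x $ i - k $ i\<bar> < 3 * pi / 2" for i
      unfolding k_def vec_lambda_beta by (rule le_less_trans)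
    then show ?thesis by (simp add: V_def)
  qed
  moreover have "F (wrap y) = F (y - k)" if y: "y \<in> V" for y
  proof (cases "\<forall>i. \<bar>y $ i - k $ i\<bar> < pi")
    case True
    have "round (y $ i / (2 * pi)) = n i" for i
    proof (rule round_unique')
      have "\<bar>2 * pi * (y $ i / (2 * pi) - of_int (n i))\<bar> < pi"
        using True[rule_format, of i] by (simp add: k_def right_diff_distrib)
      then have "2 * pi * \<bar>y $ i / (2 * pi) - of_int (n i)\<bar> < 2 * pi * (1 / 2)"
        by (simp only: abs_mult) simp
      then show "\<bar>y $ i / (2 * pi) - of_int (n i)\<bar> < 1 / 2"
        by (rule mult_left_less_imp_less) simp
    qed
    then have "wrap y = y - k" by (simp add: wrap_def k_def vec_eq_iff)
    then show ?thesis by simp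
  next
    case False
    then obtain i where i: "\<bar>y $ i - k $ i\<bar> \<ge> pi" by (auto simp: not_less)
    have i2: "\<bar>y $ i - k $ i\<bar> < 3 * pi / 2" using y by (auto simp: V_def)
    have "pi / 2 < pi" by simp
    then have "F (y - k) = 0"
      using supp[of "y - k" i] i unfolding vector_minus_component by linarith
    moreover have "F (wrap y) = 0"
    proof (rule ccontr)
      assume "F (wrap y) \<noteq> 0"
      from supp[OF this, of i] have w: "\<bar>y $ i - 2 * pi * of_int (round (y $ i / (2 * pi)))\<bar> \<le> pi / 2"
        by (simp add: wrap_def)
      define m where "m = round (y $ i / (2 * pi)) - n i"
      have eq: "y $ i - k $ i = (y $ i - 2 * pi * of_int (round (y $ i / (2 * pi)))) + 2 * pi * of_int m"
        by (simp add: k_def m_def algebra_simps)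
      show False
      proof (cases "m = 0")
        case True
        then show False using eq w i pi_gt_zero by auto
      next
        case False
        then have "\<bar>real_of_int m\<bar> \<ge> 1" by linarith
        then have "\<bar>2 * pi * of_int m\<bar> \<ge> 2 * pi" by (simp add: abs_mult)
        then show False using eq w i2 by linarith
      qed
    qed
    ultimately show ?thesis by simp
  qed
  ultimately show "\<exists>V g. open V \<and> x \<in> V \<and> smooth g \<and> (\<forall>y\<in>V. F (wrap y) = g y)"
    by (intro exI[of _ V] exI[of _ "\<lambda>y. F (y - k)"]) (auto intro: smooth_translation F)
qed

section \<open>Fourier inversion\<close>

text \<open>
  Fubini's theorem for products of integrable functions with a unimodular kernel. It justifies every
  exchange of a Fourier integral with another integral below.
\<close>

lemma fubini_kernel:
  fixes F G :: "real ^ 'd \<Rightarrow> complex" and k :: "real ^ 'd \<Rightarrow> real ^ 'd \<Rightarrow> complex"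
  assumes F: "integrable lborel F" and G: "integrable lborel G"
    and k: "continuous_on UNIV (\<lambda>(x, y). k x y)" "\<And>x y. cmod (k x y) = 1"
  shows "(LINT y|lborel. LINT x|lborel. F x * G y * k x y) = (LINT x|lborel. LINT y|lborel. F x * G y * k x y)"
proof (rule lborel_pair.Fubini_integral)
  have [measurable]: "F \<in> borel_measurable borel" "G \<in> borel_measurable borel" using F G by auto
  have [measurable]: "(\<lambda>(x, y). k x y) \<in> borel_measurable (borel \<Otimes>\<^sub>M borel)"
    unfolding borel_prod by (rule borel_measurable_continuous_onI[OF k(1)])
  have [measurable]: "(\<lambda>y. k x y) \<in> borel_measurable borel" for x
    using k(1) by (intro borel_measurable_continuous_onI)
      (auto intro!: continuous_on_compose2[OF k(1), of UNIV "\<lambda>y. (x, y)", simplified] continuous_intros)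
  show "integrable (lborel \<Otimes>\<^sub>M lborel) (\<lambda>(x, y). F x * G y * k x y)"
  proof (rule lborel_pair.Fubini_integrable)
    show "(\<lambda>(x, y). F x * G y * k x y) \<in> borel_measurable (lborel \<Otimes>\<^sub>M lborel)"
      by (simp add: case_prod_beta')
    have "(\<lambda>x. LINT y|lborel. cmod (case (x, y) of (x, y) \<Rightarrow> F x * G y * k x y)) = (\<lambda>x. cmod (F x) * (LINT y|lborel. cmod (G y)))"
      by (simp add: norm_mult k)
    then show "integrable lborel (\<lambda>x. LINT y|lborel. cmod (case (x, y) of (x, y) \<Rightarrow> F x * G y * k x y))"
      using F by (simp add: integrable_norm)
    have "integrable lborel (\<lambda>y. F x * G y * k x y)" for x
    proof (rule Bochner_Integration.integrable_bound)
      show "integrable lborel (\<lambda>y. F x * G y)" using G by simp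
    qed (auto simp: norm_mult k)
    then show "AE x in lborel. integrable lborel (\<lambda>y. case (x, y) of (x, y) \<Rightarrow> F x * G y * k x y)" by simp
  qed
qed

lemma integral_lborel_uminus:
  fixes h :: "real ^ 'd \<Rightarrow> complex"
  assumes "h \<in> borel_measurable borel"
  shows "(LINT x|lborel. h (- x)) = (LINT x|lborel. h x)"
  using integral_lborel_linear[of "mat (- 1)" h] assms
  by (simp add: det_mat_scalar mat_scalar_mult)

lemma fourier_add:
  assumes "integrable lborel f" "integrable lborel g"
  shows "fourier (\<lambda>x. f x + g x) \<xi> = fourier f \<xi> + fourier g \<xi>"
proof -
  have [measurable]: "f \<in> borel_measurable borel" "g \<in> borel_measurable borel" using assms by auto
  have "integrable lborel (\<lambda>x. h x * cnj (chr \<xi> x))" if h: "integrable lborel h" for h :: "real ^ 'a \<Rightarrow> complex"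
  proof (rule Bochner_Integration.integrable_bound[OF h])
    have [measurable]: "h \<in> borel_measurable borel" using h by auto
    show "(\<lambda>x. h x * cnj (chr \<xi> x)) \<in> borel_measurable lborel" by simp
  qed (auto simp: norm_mult)
  then show ?thesis
    using assms by (simp add: fourier_lborel distrib_right)
qed

lemma plancherel_integrable:
  fixes f :: "real ^ 'd \<Rightarrow> complex"
  assumes "cont_cs f"
  shows "integrable lborel (\<lambda>\<xi>. (cmod (fourier f \<xi>))\<^sup>2)"
    and "(LINT \<xi>|lborel. (cmod (fourier f \<xi>))\<^sup>2) = (2 * pi) ^ CARD('d) * (LINT x|lborel. (cmod (f x))\<^sup>2)"
proof -
  have m: "fourier f \<in> borel_measurable borel"
    by (intro borel_measurable_continuous_onI fourier_continuous cont_cs_integrable assms)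
  note [measurable] = m
  show "integrable lborel (\<lambda>\<xi>. (cmod (fourier f \<xi>))\<^sup>2)"
    by (rule integrableI_nonneg) (auto simp: plancherel[OF assms])
  show "(LINT \<xi>|lborel. (cmod (fourier f \<xi>))\<^sup>2) = (2 * pi) ^ CARD('d) * (LINT x|lborel. (cmod (f x))\<^sup>2)"
    by (rule integral_eq_nn_integral[THEN trans]) (auto simp: plancherel[OF assms])
qed

lemma integrable_inner_of_norm_square:
  fixes u v :: "real ^ 'd \<Rightarrow> complex"
  assumes "integrable M (\<lambda>x. (cmod (u x))\<^sup>2)" "integrable M (\<lambda>x. (cmod (v x))\<^sup>2)"
    and [measurable]: "u \<in> borel_measurable M" "v \<in> borel_measurable M"
  shows "integrable M (\<lambda>x. u x * cnj (v x))"
proof (rule Bochner_Integration.integrable_bound)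
  show "integrable M (\<lambda>x. (cmod (u x))\<^sup>2 + (cmod (v x))\<^sup>2)" using assms by simp
  have "2 * (a * b) \<le> a\<^sup>2 + b\<^sup>2" for a b :: real
    using zero_le_power2[of "a - b"] by (simp add: power2_eq_square algebra_simps)
  then have "cmod (u x) * cmod (v x) \<le> (cmod (u x))\<^sup>2 + (cmod (v x))\<^sup>2" for x
    by (smt (verit) mult_nonneg_nonneg norm_ge_zero)
  then show "AE x in M. norm (u x * cnj (v x)) \<le> norm ((cmod (u x))\<^sup>2 + (cmod (v x))\<^sup>2)"
    by (simp add: norm_mult)
  have "(\<lambda>x. cnj (v x)) \<in> borel_measurable M"
    by (rule borel_measurable_continuous_on[of cnj, OF _ assms(4)]) (intro continuous_intros)
  then show "(\<lambda>x. u x * cnj (v x)) \<in> borel_measurable M" by simp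
qed

lemma norm_square_add: "(cmod (a + b))\<^sup>2 = (cmod a)\<^sup>2 + 2 * Re (a * cnj b) + (cmod b)\<^sup>2"
  unfolding cmod_power2 by (simp add: power2_eq_square algebra_simps)

lemma cont_cs_cnj: "cont_cs f \<Longrightarrow> cont_cs (\<lambda>x. cnj (f x))"
  by (simp add: cont_cs_def continuous_on_cnj)

text \<open>
  The real part of the polarised identity is enough for the inversion formula and needs the norm
  identity for \<open>f + g\<close> only.
\<close>

lemma plancherel_polarised:
  fixes f g :: "real ^ 'd \<Rightarrow> complex"
  assumes f: "cont_cs f" and g: "cont_cs g"
  shows "Re (LINT \<xi>|lborel. fourier f \<xi> * cnj (fourier g \<xi>)) = (2 * pi) ^ CARD('d) * Re (LINT x|lborel. f x * cnj (g x))"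
proof -
  let ?w = "(2 * pi) ^ CARD('d)"
  have m: "fourier h \<in> borel_measurable borel" if "cont_cs h" for h :: "real ^ 'd \<Rightarrow> complex"
    by (intro borel_measurable_continuous_onI fourier_continuous cont_cs_integrable that)
  have ih: "integrable lborel (\<lambda>\<xi>. fourier f \<xi> * cnj (fourier g \<xi>))"
    by (rule integrable_inner_of_norm_square) (use plancherel_integrable(1) f g m in auto)
  have i: "integrable lborel (\<lambda>x. f x * cnj (g x))"
    by (rule integrable_inner_of_norm_square) (use cont_cs_norm_square_integrable f g cont_cs_measurable in auto)
  have "(LINT \<xi>|lborel. (cmod (fourier (\<lambda>x. f x + g x) \<xi>))\<^sup>2)
     = (LINT \<xi>|lborel. (cmod (fourier f \<xi>))\<^sup>2 + 2 * Re (fourier f \<xi> * cnj (fourier g \<xi>)) + (cmod (fourier g \<xi>))\<^sup>2)"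
    by (simp only: fourier_add[OF cont_cs_integrable[OF f] cont_cs_integrable[OF g]] norm_square_add)
  also have "\<dots> = (LINT \<xi>|lborel. (cmod (fourier f \<xi>))\<^sup>2) + 2 * Re (LINT \<xi>|lborel. fourier f \<xi> * cnj (fourier g \<xi>)) + (LINT \<xi>|lborel. (cmod (fourier g \<xi>))\<^sup>2)"
    using plancherel_integrable(1)[OF f] plancherel_integrable(1)[OF g] ih
    by (simp only: Bochner_Integration.integral_add Bochner_Integration.integrable_add integrable_mult_right integrable_Re
      integral_mult_right_zero integral_Re)
  finally have 1: "?w * (LINT x|lborel. (cmod (f x + g x))\<^sup>2) = ?w * (LINT x|lborel. (cmod (f x))\<^sup>2)
      + 2 * Re (LINT \<xi>|lborel. fourier f \<xi> * cnj (fourier g \<xi>)) + ?w * (LINT x|lborel. (cmod (g x))\<^sup>2)"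
    by (simp only: plancherel_integrable(2)[OF f] plancherel_integrable(2)[OF g] plancherel_integrable(2)[OF cont_cs_add[OF f g]])
  have "(LINT x|lborel. (cmod (f x + g x))\<^sup>2) = (LINT x|lborel. (cmod (f x))\<^sup>2 + 2 * Re (f x * cnj (g x)) + (cmod (g x))\<^sup>2)"
    by (simp only: norm_square_add)
  also have "\<dots> = (LINT x|lborel. (cmod (f x))\<^sup>2) + 2 * Re (LINT x|lborel. f x * cnj (g x)) + (LINT x|lborel. (cmod (g x))\<^sup>2)"
    using cont_cs_norm_square_integrable[OF f] cont_cs_norm_square_integrable[OF g] i
    by (simp only: Bochner_Integration.integral_add Bochner_Integration.integrable_add integrable_mult_right integrable_Re
      integral_mult_right_zero integral_Re)
  finally show ?thesis using 1 by (simp add: distrib_left)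
qed

text \<open>
  The inverse Fourier transform.
\<close>

definition ift :: "(real ^ 'd \<Rightarrow> complex) \<Rightarrow> real ^ 'd \<Rightarrow> complex"
  where "ift G x = (LINT \<xi>|lborel. G \<xi> * chr x \<xi>) / (2 * pi) ^ CARD('d)"

lemma cont_cs_chr: "cont_cs G \<Longrightarrow> cont_cs (\<lambda>\<xi>. G \<xi> * chr x \<xi>)"
  by (intro cont_cs_mult continuous_intros)

lemma chr_swap: "chr x y = chr y x" by (simp add: chr_def inner_commute)

lemma ift_fourier: "cont_cs G \<Longrightarrow> ift G (x :: real ^ 'd) = fourier G (- x) / (2 * pi) ^ CARD('d)"
  by (simp add: ift_def fourier_lborel cont_cs_measurable chr_minus)

text \<open>
  A function that vanishes almost everywhere and is continuous vanishes everywhere, since nonempty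
  open sets are not negligible.
\<close>

lemma zero_of_integral_zero:
  fixes f :: "real ^ 'd \<Rightarrow> real"
  assumes "continuous_on UNIV f" "integrable lborel f" "\<And>x. 0 \<le> f x" "(LINT x|lborel. f x) = 0"
  shows "f x = 0"
proof (rule ccontr)
  assume "f x \<noteq> 0"
  define S where "S = {y. f y \<noteq> 0}"
  have "AE y in lborel. f y = 0"
    using integral_nonneg_eq_0_iff_AE[OF assms(2)] assms by simp
  then have "AE y in lebesgue. f y = 0" by (rule AE_completion)
  then have "negligible S" unfolding S_def
    by (subst negligible_iff_null_sets) (auto simp: eventually_ae_filter null_sets_completion_subset elim: null_sets_completion_subset[rotated])
  moreover have "open S" unfolding S_def
    by (intro open_Collect_neq assms(1) continuous_intros)
  moreover have "S \<noteq> {}" using \<open>f x \<noteq> 0\<close> by (auto simp: S_def)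
  ultimately show False using open_not_negligible by blast
qed

text \<open>
  By Fubini's theorem and Plancherel's identity, \<open>fourier (ift G)\<close> and \<open>G\<close> have the same real inner
  product with every continuous function \<open>H\<close> of compact support. Testing with their difference,
  multiplied by a bump around a point, shows that they agree there.
\<close>

theorem fourier_inversion:
  fixes G :: "real ^ 'd \<Rightarrow> complex"
  assumes G: "cont_cs G" and int: "integrable lborel (ift G)"
  shows "fourier (ift G) = G"
proof
  let ?w = "complex_of_real ((2 * pi) ^ CARD('d))"
  have w: "?w \<noteq> 0" by simp
  let ?D = "\<lambda>\<eta>. fourier (ift G) \<eta> - G \<eta>"
  have cD: "continuous_on UNIV ?D"
    using G by (intro continuous_intros fourier_continuous int) (simp add: cont_cs_def)
  have [measurable]: "ift G \<in> borel_measurable borel" using int by auto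
  have weak: "Re (LINT \<eta>|lborel. fourier (ift G) \<eta> * cnj (H \<eta>)) = Re (LINT \<eta>|lborel. G \<eta> * cnj (H \<eta>))" if H: "cont_cs H" for H
  proof -
    note Hc = cont_cs_cnj[OF H]
    have "(LINT \<eta>|lborel. fourier (ift G) \<eta> * cnj (H \<eta>))
       = (LINT \<eta>|lborel. LINT x|lborel. ift G x * cnj (H \<eta>) * cnj (chr \<eta> x))"
      by (simp add: fourier_lborel mult_ac flip: integral_mult_left_zero)
    also have "\<dots> = (LINT x|lborel. LINT \<eta>|lborel. ift G x * cnj (H \<eta>) * cnj (chr \<eta> x))"
    proof (rule fubini_kernel[OF int cont_cs_integrable[OF Hc]])
      show "continuous_on UNIV (\<lambda>(x, \<eta>). cnj (chr \<eta> (x :: real ^ 'd)))"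
        by (auto simp: case_prod_beta' intro!: continuous_intros)
    qed simp
    also have "\<dots> = (LINT x|lborel. ift G x * (?w * cnj (ift H x)))"
    proof (rule Bochner_Integration.integral_cong[OF refl])
      fix x
      have "(LINT \<eta>|lborel. ift G x * cnj (H \<eta>) * cnj (chr \<eta> x)) = ift G x * (LINT \<eta>|lborel. cnj (H \<eta> * chr x \<eta>))"
        by (simp only: mult.assoc integral_mult_right_zero complex_cnj_mult chr_swap[of _ x])
      also have "(LINT \<eta>|lborel. cnj (H \<eta> * chr x \<eta>)) = ?w * cnj (ift H x)"
        unfolding Bochner_Integration.integral_cnj using w by (simp add: ift_def)
      finally show "(LINT \<eta>|lborel. ift G x * cnj (H \<eta>) * cnj (chr \<eta> x)) = ift G x * (?w * cnj (ift H x))" .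
    qed
    also have "\<dots> = (LINT x|lborel. fourier G (- x) * cnj (fourier H (- x)) / ?w)"
      by (simp add: ift_fourier[OF G] ift_fourier[OF H])
    also have "\<dots> = (LINT x|lborel. fourier G x * cnj (fourier H x) / ?w)"
    proof (rule integral_lborel_uminus)
      have "continuous_on UNIV (fourier G)" "continuous_on UNIV (fourier H)"
        by (intro fourier_continuous cont_cs_integrable G H)+
      then show "(\<lambda>x. fourier G x * cnj (fourier H x) / ?w) \<in> borel_measurable borel"
        by (intro borel_measurable_continuous_onI continuous_intros) auto
    qed
    also have "\<dots> = (LINT x|lborel. fourier G x * cnj (fourier H x)) / ?w" by simp
    finally have "Re (LINT \<eta>|lborel. fourier (ift G) \<eta> * cnj (H \<eta>)) = Re (LINT x|lborel. fourier G x * cnj (fourier H x)) / (2 * pi) ^ CARD('d)"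
      by (metis Re_divide_of_real)
    then show ?thesis unfolding plancherel_polarised[OF G H] by simp
  qed
  fix \<eta>0 :: "real ^ 'd"
  \<comment> \<open>a continuous bump around the point at which the two functions are compared\<close>
  define c where "c \<eta> = max 0 (1 - dist \<eta> \<eta>0)" for \<eta>
  have cc: "continuous_on UNIV c" unfolding c_def by (intro continuous_intros)
  have bc: "bounded {x. c x \<noteq> 0}"
    by (rule bounded_subset[OF bounded_cball[of \<eta>0 1]]) (auto simp: c_def dist_commute)
  let ?H = "\<lambda>\<eta>. complex_of_real (c \<eta>) * ?D \<eta>"
  have H: "cont_cs ?H" using cc bc by (intro cont_cs_mult cD) (auto simp: cont_cs_def intro!: continuous_intros)
  have i1: "integrable lborel (\<lambda>\<eta>. fourier (ift G) \<eta> * cnj (?H \<eta>))"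
  proof -
    have "cont_cs (\<lambda>\<eta>. cnj (?H \<eta>) * fourier (ift G) \<eta>)"
      by (intro cont_cs_mult[OF cont_cs_cnj[OF H]] fourier_continuous int)
    from cont_cs_integrable[OF this] show ?thesis by (simp add: mult.commute)
  qed
  have i2: "integrable lborel (\<lambda>\<eta>. G \<eta> * cnj (?H \<eta>))"
    using cont_cs_cnj[OF H] by (intro cont_cs_integrable cont_cs_mult[OF G]) (simp add: cont_cs_def)
  have "0 = Re (LINT \<eta>|lborel. fourier (ift G) \<eta> * cnj (?H \<eta>) - G \<eta> * cnj (?H \<eta>))"
    using weak[OF H] i1 i2 by simp
  also have "\<dots> = (LINT \<eta>|lborel. Re (fourier (ift G) \<eta> * cnj (?H \<eta>) - G \<eta> * cnj (?H \<eta>)))"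
    using i1 i2 by (intro integral_Re[symmetric]) simp
  also have "\<dots> = (LINT \<eta>|lborel. c \<eta> * (cmod (?D \<eta>))\<^sup>2)"
  proof (rule Bochner_Integration.integral_cong[OF refl])
    fix \<eta>
    have "fourier (ift G) \<eta> * cnj (?H \<eta>) - G \<eta> * cnj (?H \<eta>) = complex_of_real (c \<eta>) * (?D \<eta> * cnj (?D \<eta>))"
      by (simp add: algebra_simps)
    also have "\<dots> = complex_of_real (c \<eta> * (cmod (?D \<eta>))\<^sup>2)"
      by (simp only: of_real_mult complex_norm_square)
    finally show "Re (fourier (ift G) \<eta> * cnj (?H \<eta>) - G \<eta> * cnj (?H \<eta>)) = c \<eta> * (cmod (?D \<eta>))\<^sup>2"
      by (metis Re_complex_of_real)
  qed
  finally have zero: "(LINT \<eta>|lborel. c \<eta> * (cmod (?D \<eta>))\<^sup>2) = 0" by simp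
  have cont: "continuous_on UNIV (\<lambda>\<eta>. c \<eta> * (cmod (?D \<eta>))\<^sup>2)"
    by (intro continuous_intros cc cD)
  have "c \<eta>0 * (cmod (?D \<eta>0))\<^sup>2 = 0"
  proof (rule zero_of_integral_zero[OF cont _ _ zero])
    show "integrable lborel (\<lambda>\<eta>. c \<eta> * (cmod (?D \<eta>))\<^sup>2)"
      by (rule continuous_compact_support_integrable[OF cont]) (use bc in \<open>auto elim: bounded_subset\<close>)
  qed (simp add: c_def)
  then show "fourier (ift G) \<eta>0 = G \<eta>0" by (simp add: c_def)
qed

section \<open>Inverse transforms of smooth functions of compact support\<close>

text \<open>
  Smooth functions of compact support that vanish on a prescribed open set \<open>W\<close> with bounded
  complement. Carrying \<open>W\<close> along serves two purposes: it encodes the compact support, and for \<open>0 \<in> W\<close>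
  it records vanishing near the origin, which survives differentiation and gives the vanishing
  moments.
\<close>

definition bump :: "(real ^ 'd) set \<Rightarrow> (real ^ 'd \<Rightarrow> complex) \<Rightarrow> bool"
  where "bump W G \<longleftrightarrow> open W \<and> bounded (- W) \<and> smooth G \<and> (\<forall>\<xi>\<in>W. G \<xi> = 0)"

lemma bump_cs: "bump W G \<Longrightarrow> cont_cs G"
  unfolding bump_def cont_cs_def by (auto intro: smooth_continuous bounded_subset)

lemma bump_mult: "bump W G \<Longrightarrow> smooth F \<Longrightarrow> bump W (\<lambda>\<xi>. F \<xi> * G \<xi>)"
  by (auto simp: bump_def intro: smooth_mult)

lemma bump_add: "bump W F \<Longrightarrow> bump W G \<Longrightarrow> bump W (\<lambda>\<xi>. F \<xi> + G \<xi>)"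
  by (auto simp: bump_def intro: smooth_add)

lemma bump_partial_deriv:
  assumes "bump W G" shows "bump W (partial_deriv i G)"
proof -
  have "partial_deriv i G \<xi> = 0" if "\<xi> \<in> W" for \<xi>
  proof -
    have "partial_deriv i G \<xi> = partial_deriv i (\<lambda>_. 0) \<xi>"
      using assms that by (intro partial_deriv_local(2)[of W] smooth_const) (auto simp: bump_def)
    also have "has_partials (\<lambda>_ :: real ^ 'a. 0) (\<lambda>i _. 0)" by (simp add: has_partials_def)
    then have "partial_deriv i (\<lambda>_. 0) \<xi> = 0" by (simp add: has_partials_imp_partial_deriv)
    finally show ?thesis .
  qed
  then show ?thesis using assms by (simp add: bump_def smooth_partial_deriv)
qed

lemma smooth_component: "smooth (\<lambda>x. complex_of_real (x $ i))"
  by (rule smooth_linear) (simp add: linear_iff)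

lemma smooth_chr: "smooth (chr k)"
proof -
  have "smooth (\<lambda>x. exp (\<i> * complex_of_real (k \<bullet> x)))"
    by (intro smooth_exp smooth_mult smooth_const smooth_linear) (simp add: linear_iff inner_right_distrib)
  then show ?thesis by (simp add: chr_def[abs_def])
qed

lemma norm_exp_minus_linear: "cmod (exp (\<i> * complex_of_real t) - 1 - \<i> * complex_of_real t) \<le> t\<^sup>2"
  using Taylor_exp[of "\<i> * complex_of_real t" 1] by (simp add: norm_mult power2_eq_square algebra_simps)

text \<open>
  Differentiation under the integral, by the quadratic bound for the remainder of \<open>exp (\<i> t)\<close>; the
  second moment of \<open>G\<close> is finite since its support is bounded.
\<close>

lemma ift_has_partials:
  fixes G :: "real ^ 'd \<Rightarrow> complex"
  assumes G: "cont_cs G"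
  shows "has_partials (ift G) (\<lambda>i. ift (\<lambda>\<xi>. (\<i> * complex_of_real (\<xi> $ i)) * G \<xi>))"
  unfolding has_partials_def has_derivative_at
proof (intro allI conjI)
  fix x :: "real ^ 'd"
  let ?w = "(2 * pi) ^ CARD('d)"
  let ?D = "\<lambda>h. \<Sum>i\<in>UNIV. complex_of_real (h $ i) * ift (\<lambda>\<xi>. (\<i> * complex_of_real (\<xi> $ i)) * G \<xi>) x"
  have "linear ?D" by (simp add: linear_iff sum.distrib distrib_right scaleR_conv_of_real[where 'a = complex] sum_distrib_left mult.assoc)
  then show "bounded_linear ?D" by (simp add: linear_conv_bounded_linear)
  have i: "integrable lborel (\<lambda>\<xi>. g \<xi> * (G \<xi> * chr x \<xi>))" if "continuous_on UNIV g" for g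
    using cont_cs_integrable[OF cont_cs_mult[OF cont_cs_chr[OF G] that]] by (simp add: mult.commute)
  have cG: "continuous_on UNIV G" using G by (simp add: cont_cs_def)
  define K where "K = (LINT \<xi>|lborel. (norm \<xi>)\<^sup>2 * cmod (G \<xi>)) / ?w"
  have iK: "integrable lborel (\<lambda>\<xi>. (norm \<xi>)\<^sup>2 * cmod (G \<xi>))"
    by (rule continuous_compact_support_integrable)
      (use G in \<open>auto simp: cont_cs_def intro!: continuous_intros elim!: bounded_subset\<close>)
  have bound: "norm (ift G (x + h) - ift G x - ?D h) \<le> K * (norm h)\<^sup>2" for h
  proof -
    have Dh: "?D h = (LINT \<xi>|lborel. (\<i> * complex_of_real (h \<bullet> \<xi>)) * (G \<xi> * chr x \<xi>)) / ?w"
    proof -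
      have feq: "(\<Sum>i\<in>UNIV. (\<i> * complex_of_real (h $ i * \<xi> $ i)) * (G \<xi> * chr x \<xi>)) = (\<i> * complex_of_real (h \<bullet> \<xi>)) * (G \<xi> * chr x \<xi>)" for \<xi>
        by (simp add: inner_vec_def sum_distrib_left sum_distrib_right)
      have summand: "complex_of_real (h $ i) * ift (\<lambda>\<xi>. (\<i> * complex_of_real (\<xi> $ i)) * G \<xi>) x
        = (LINT \<xi>|lborel. (\<i> * complex_of_real (h $ i * \<xi> $ i)) * (G \<xi> * chr x \<xi>)) / ?w" for i
      proof -
        have "(LINT \<xi>|lborel. (\<i> * complex_of_real (h $ i * \<xi> $ i)) * (G \<xi> * chr x \<xi>))
          = (LINT \<xi>|lborel. complex_of_real (h $ i) * ((\<i> * complex_of_real (\<xi> $ i)) * G \<xi> * chr x \<xi>))"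
          by (simp only: of_real_mult mult_ac)
        then show ?thesis by (simp only: ift_def integral_mult_right_zero times_divide_eq_right)
      qed
      have "?D h = (\<Sum>i\<in>UNIV. LINT \<xi>|lborel. (\<i> * complex_of_real (h $ i * \<xi> $ i)) * (G \<xi> * chr x \<xi>)) / ?w"
        unfolding sum_divide_distrib by (intro sum.cong refl summand)
      also have "(\<Sum>i\<in>UNIV. LINT \<xi>|lborel. (\<i> * complex_of_real (h $ i * \<xi> $ i)) * (G \<xi> * chr x \<xi>))
         = (LINT \<xi>|lborel. (\<Sum>i\<in>UNIV. (\<i> * complex_of_real (h $ i * \<xi> $ i)) * (G \<xi> * chr x \<xi>)))"
        by (rule Bochner_Integration.integral_sum[symmetric]) (intro i continuous_intros)
      finally show ?thesis by (simp only: feq)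
    qed
    have "ift G (x + h) - ift G x - ?D h
      = ((LINT \<xi>|lborel. chr h \<xi> * (G \<xi> * chr x \<xi>)) - (LINT \<xi>|lborel. 1 * (G \<xi> * chr x \<xi>)) - (LINT \<xi>|lborel. (\<i> * complex_of_real (h \<bullet> \<xi>)) * (G \<xi> * chr x \<xi>))) / ?w"
      unfolding Dh unfolding ift_def chr_add by (simp add: mult_ac diff_divide_distrib)
    also have "\<dots> = (LINT \<xi>|lborel. chr h \<xi> * (G \<xi> * chr x \<xi>) - 1 * (G \<xi> * chr x \<xi>) - (\<i> * complex_of_real (h \<bullet> \<xi>)) * (G \<xi> * chr x \<xi>)) / ?w"
      by (subst Bochner_Integration.integral_diff Bochner_Integration.integral_diff; (intro i Bochner_Integration.integrable_diff continuous_intros)?)+ simp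
    also have "norm \<dots> \<le> (LINT \<xi>|lborel. (norm h)\<^sup>2 * ((norm \<xi>)\<^sup>2 * cmod (G \<xi>))) / ?w"
      unfolding norm_divide
    proof (intro divide_mono)
      show "norm (LINT \<xi>|lborel. chr h \<xi> * (G \<xi> * chr x \<xi>) - 1 * (G \<xi> * chr x \<xi>) - (\<i> * complex_of_real (h \<bullet> \<xi>)) * (G \<xi> * chr x \<xi>))
        \<le> (LINT \<xi>|lborel. (norm h)\<^sup>2 * ((norm \<xi>)\<^sup>2 * cmod (G \<xi>)))"
      proof (rule order_trans[OF integral_norm_bound integral_mono])
        show "integrable lborel (\<lambda>\<xi>. norm (chr h \<xi> * (G \<xi> * chr x \<xi>) - 1 * (G \<xi> * chr x \<xi>) - (\<i> * complex_of_real (h \<bullet> \<xi>)) * (G \<xi> * chr x \<xi>)))"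
          by (intro Bochner_Integration.integrable_norm Bochner_Integration.integrable_diff i continuous_intros)
        show "integrable lborel (\<lambda>\<xi>. (norm h)\<^sup>2 * ((norm \<xi>)\<^sup>2 * cmod (G \<xi>)))"
          using iK by simp
        fix \<xi>
        have "chr h \<xi> * (G \<xi> * chr x \<xi>) - 1 * (G \<xi> * chr x \<xi>) - (\<i> * complex_of_real (h \<bullet> \<xi>)) * (G \<xi> * chr x \<xi>)
          = (exp (\<i> * complex_of_real (h \<bullet> \<xi>)) - 1 - \<i> * complex_of_real (h \<bullet> \<xi>)) * (G \<xi> * chr x \<xi>)"
          by (simp add: chr_def[of h] algebra_simps)
        then have "norm (chr h \<xi> * (G \<xi> * chr x \<xi>) - 1 * (G \<xi> * chr x \<xi>) - (\<i> * complex_of_real (h \<bullet> \<xi>)) * (G \<xi> * chr x \<xi>))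
          = cmod (exp (\<i> * complex_of_real (h \<bullet> \<xi>)) - 1 - \<i> * complex_of_real (h \<bullet> \<xi>)) * cmod (G \<xi>)"
          by (simp add: norm_mult)
        also have "\<dots> \<le> (h \<bullet> \<xi>)\<^sup>2 * cmod (G \<xi>)"
          by (intro mult_right_mono norm_exp_minus_linear) simp
        also have "\<dots> \<le> (norm h * norm \<xi>)\<^sup>2 * cmod (G \<xi>)"
          by (intro mult_right_mono) (auto simp: abs_le_square_iff[symmetric] abs_mult Cauchy_Schwarz_ineq2)
        finally show "norm (chr h \<xi> * (G \<xi> * chr x \<xi>) - 1 * (G \<xi> * chr x \<xi>) - (\<i> * complex_of_real (h \<bullet> \<xi>)) * (G \<xi> * chr x \<xi>))
          \<le> (norm h)\<^sup>2 * ((norm \<xi>)\<^sup>2 * cmod (G \<xi>))" by (simp add: power_mult_distrib mult.assoc)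
      qed
    qed (auto simp: norm_power norm_mult intro!: integral_nonneg_AE)
    also have "\<dots> = K * (norm h)\<^sup>2" by (simp add: K_def)
    finally show ?thesis .
  qed
  have "((\<lambda>h :: real ^ 'd. K * norm h) \<longlongrightarrow> K * norm (0 :: real ^ 'd)) (at 0)"
    by (rule tendsto_mult[OF tendsto_const tendsto_norm[OF tendsto_ident_at]])
  then have lim: "((\<lambda>h :: real ^ 'd. K * norm h) \<longlongrightarrow> 0) (at 0)" by simp
  show "(\<lambda>h. norm (ift G (x + h) - ift G x - ?D h) / norm h) \<midarrow>0\<rightarrow> 0"
  proof (rule tendsto_sandwich[OF _ _ tendsto_const lim])
    show "\<forall>\<^sub>F h in at 0. norm (ift G (x + h) - ift G x - ?D h) / norm h \<le> K * norm h"
      unfolding eventually_at_filter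
    proof (intro always_eventually allI impI)
      fix h :: "real ^ 'd" assume "h \<noteq> 0"
      then have "norm (ift G (x + h) - ift G x - ?D h) / norm h \<le> (K * (norm h)\<^sup>2) / norm h"
        by (intro divide_right_mono bound) simp
      then show "norm (ift G (x + h) - ift G x - ?D h) / norm h \<le> K * norm h"
        using \<open>h \<noteq> 0\<close> by (simp add: power2_eq_square)
    qed
  qed auto
qed

text \<open>
  By translation invariance the integrals of the difference quotients are zero, and the difference
  quotients converge boundedly on a fixed ball.
\<close>

lemma integral_partial_deriv_zero:
  fixes H :: "real ^ 'd \<Rightarrow> complex"
  assumes H: "bump W H"
  shows "(LINT \<xi>|lborel. partial_deriv i H \<xi>) = 0"
proof -
  let ?e = "axis i 1 :: real ^ 'd"
  let ?P = "partial_deriv i H"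
  have csH: "cont_cs H" and csP: "cont_cs ?P" using H bump_cs bump_partial_deriv by blast+
  have contP: "continuous_on UNIV ?P" using csP by (simp add: cont_cs_def)
  obtain R where R: "\<And>x. x \<notin> W \<Longrightarrow> norm x \<le> R" using H by (auto simp: bump_def bounded_iff)
  obtain B where B: "\<And>x. norm (?P x) \<le> B" "B \<ge> 0"
  proof -
    have "compact (?P ` cball 0 R)" by (intro compact_continuous_image continuous_on_subset[OF contP]) auto
    from compact_imp_bounded[OF this] obtain B where "\<forall>y\<in>?P ` cball 0 R. norm y \<le> B"
      unfolding bounded_iff by (elim exE)
    then have B: "norm (?P x) \<le> B" if "x \<in> cball 0 R" for x using that by simp
    have "norm (?P x) \<le> max B 0" for x
    proof (cases "x \<in> W")
      case True then show ?thesis using bump_partial_deriv[OF H, of i] by (simp add: bump_def)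
    next
      case False then show ?thesis using B[of x] R[of x] by simp
    qed
    then show thesis using that[of "max B 0"] by simp
  qed
  have der: "((\<lambda>s. H (\<xi> + s *\<^sub>R ?e)) has_vector_derivative ?P (\<xi> + s *\<^sub>R ?e)) (at s within S)" for \<xi> s S
  proof -
    have "((\<lambda>s. \<xi> + s *\<^sub>R ?e) has_vector_derivative ?e) (at s within S)"
      by (auto intro!: derivative_eq_intros)
    moreover have "(H has_derivative (\<lambda>h. \<Sum>j\<in>UNIV. complex_of_real (h $ j) * partial_deriv j H (\<xi> + s *\<^sub>R ?e))) (at (\<xi> + s *\<^sub>R ?e))"
      using H smooth_has_partials[of H] by (simp add: bump_def has_partials_def)
    ultimately have "(H \<circ> (\<lambda>s. \<xi> + s *\<^sub>R ?e) has_vector_derivative (\<Sum>j\<in>UNIV. complex_of_real (?e $ j) * partial_deriv j H (\<xi> + s *\<^sub>R ?e))) (at s within S)"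
      by (intro vector_derivative_diff_chain_within) (auto intro: has_derivative_at_withinI)
    then show ?thesis by (simp add: sum_axis_mult o_def)
  qed
  have lip: "norm (H (\<xi> + t *\<^sub>R ?e) - H \<xi>) \<le> B * t" if "t \<ge> 0" for \<xi> t
  proof -
    have "norm (H (\<xi> + t *\<^sub>R ?e) - H (\<xi> + 0 *\<^sub>R ?e)) \<le> B * norm (t - 0)"
    proof (rule differentiable_bound[of UNIV "\<lambda>s. H (\<xi> + s *\<^sub>R ?e)" "\<lambda>s h. h *\<^sub>R ?P (\<xi> + s *\<^sub>R ?e)"])
      fix s :: real
      show "((\<lambda>s. H (\<xi> + s *\<^sub>R ?e)) has_derivative (\<lambda>h. h *\<^sub>R ?P (\<xi> + s *\<^sub>R ?e))) (at s within UNIV)"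
        using der by (simp add: has_vector_derivative_def)
      show "onorm (\<lambda>h. h *\<^sub>R ?P (\<xi> + s *\<^sub>R ?e)) \<le> B"
        using B by (intro onorm_bound) (auto simp: mult.commute[of B] intro!: mult_left_mono)
    qed auto
    then show ?thesis using that by simp
  qed
  define t where "t n = inverse (real (Suc n))" for n
  have t: "t n > 0" "t n \<le> 1" for n by (auto simp: t_def inverse_le_1_iff)
  have mH: "H \<in> borel_measurable borel" by (rule cont_cs_measurable[OF csH])
  note [measurable] = mH cont_cs_measurable[OF csP]
  let ?q = "\<lambda>n \<xi>. (H (\<xi> + t n *\<^sub>R ?e) - H \<xi>) /\<^sub>R t n"
  have lim: "(\<lambda>n. LINT \<xi>|lborel. ?q n \<xi>) \<longlonglongrightarrow> (LINT \<xi>|lborel. ?P \<xi>)"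
  proof (rule integral_dominated_convergence)
    show "integrable lborel (\<lambda>\<xi> :: real ^ 'd. B * indicator (cball 0 (R + 1)) \<xi>)"
      using emeasure_bounded_finite[OF bounded_cball[of "0 :: real ^ 'd" "R + 1"]]
      by (intro integrable_mult_right integrable_real_indicator) auto
    show "AE \<xi> in lborel. (\<lambda>n. ?q n \<xi>) \<longlonglongrightarrow> ?P \<xi>"
    proof (rule AE_I2)
      fix \<xi> :: "real ^ 'd"
      have "(\<lambda>n. t n) \<longlonglongrightarrow> 0" unfolding t_def by (rule LIMSEQ_inverse_real_of_nat)
      then have tl: "filterlim t (at 0) sequentially" using t(1) by (intro filterlim_atI) (auto simp: less_imp_neq[symmetric])
      have "((\<lambda>s. H (\<xi> + s *\<^sub>R ?e)) has_vector_derivative ?P (\<xi> + 0 *\<^sub>R ?e)) (at 0)" by (rule der)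
      then have "(\<lambda>s. norm (H (\<xi> + (0 + s) *\<^sub>R ?e) - H (\<xi> + 0 *\<^sub>R ?e) - s *\<^sub>R ?P (\<xi> + 0 *\<^sub>R ?e)) / norm s) \<midarrow>0\<rightarrow> 0"
        unfolding has_vector_derivative_def has_derivative_at by (rule conjunct2)
      then have "((\<lambda>s. norm ((H (\<xi> + s *\<^sub>R ?e) - H \<xi>) /\<^sub>R s - ?P \<xi>)) \<longlongrightarrow> 0) (at 0)"
      proof (rule Lim_transform_eventually)
        show "\<forall>\<^sub>F s in at 0. norm (H (\<xi> + (0 + s) *\<^sub>R ?e) - H (\<xi> + 0 *\<^sub>R ?e) - s *\<^sub>R ?P (\<xi> + 0 *\<^sub>R ?e)) / norm s
           = norm ((H (\<xi> + s *\<^sub>R ?e) - H \<xi>) /\<^sub>R s - ?P \<xi>)"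
          unfolding eventually_at_filter
        proof (intro always_eventually allI impI)
          fix s :: real assume "s \<noteq> 0"
          then have "(H (\<xi> + s *\<^sub>R ?e) - H \<xi>) /\<^sub>R s - ?P \<xi> = (H (\<xi> + s *\<^sub>R ?e) - H \<xi> - s *\<^sub>R ?P \<xi>) /\<^sub>R s"
            by (simp add: scaleR_diff_right)
          then show "norm (H (\<xi> + (0 + s) *\<^sub>R ?e) - H (\<xi> + 0 *\<^sub>R ?e) - s *\<^sub>R ?P (\<xi> + 0 *\<^sub>R ?e)) / norm s
           = norm ((H (\<xi> + s *\<^sub>R ?e) - H \<xi>) /\<^sub>R s - ?P \<xi>)" by (simp add: divide_inverse mult.commute)
        qed
      qed
      then have "((\<lambda>s. (H (\<xi> + s *\<^sub>R ?e) - H \<xi>) /\<^sub>R s) \<longlongrightarrow> ?P \<xi>) (at 0)"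
        by (simp add: tendsto_norm_zero_iff LIM_zero_iff)
      from filterlim_compose[OF this tl] show "(\<lambda>n. ?q n \<xi>) \<longlonglongrightarrow> ?P \<xi>" .
    qed
    fix n
    show "AE \<xi> in lborel. norm (?q n \<xi>) \<le> B * indicator (cball 0 (R + 1)) \<xi>"
    proof (rule AE_I2)
      fix \<xi> :: "real ^ 'd"
      show "norm (?q n \<xi>) \<le> B * indicator (cball 0 (R + 1)) \<xi>"
      proof (cases "\<xi> \<in> cball 0 (R + 1)")
        case True
        have "norm (?q n \<xi>) = norm (H (\<xi> + t n *\<^sub>R ?e) - H \<xi>) / t n"
          using t(1)[of n] by (simp add: divide_inverse mult.commute)
        also have "\<dots> \<le> B" using lip[of "t n" \<xi>] t(1)[of n] by (simp add: field_simps)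
        finally show ?thesis using True by simp
      next
        case False
        then have n1: "norm \<xi> > R + 1" by simp
        have "norm \<xi> \<le> norm (\<xi> + t n *\<^sub>R ?e) + norm (t n *\<^sub>R ?e)"
          using norm_triangle_ineq4[of "\<xi> + t n *\<^sub>R ?e" "t n *\<^sub>R ?e"] by simp
        then have "norm \<xi> \<le> norm (\<xi> + t n *\<^sub>R ?e) + 1" using t[of n] by simp
        then have "H \<xi> = 0" "H (\<xi> + t n *\<^sub>R ?e) = 0"
          using n1 R[of \<xi>] R[of "\<xi> + t n *\<^sub>R ?e"] H by (force simp: bump_def)+
        then show ?thesis using False by simp
      qed
    qed
    show "(\<lambda>\<xi>. ?q n \<xi>) \<in> borel_measurable lborel" by simp
  qed simp
  have q0: "(LINT \<xi>|lborel. ?q n \<xi>) = 0" for n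
  proof -
    have tr: "(LINT \<xi>|lborel. H (t n *\<^sub>R ?e + \<xi>)) = (LINT \<xi>|lborel. H \<xi>)"
    proof -
      have "(LINT \<xi>|lborel. H \<xi>) = (LINT \<xi>|distr lborel borel ((+) (t n *\<^sub>R ?e)). H \<xi>)" by (simp add: lborel_distr_plus)
      then show ?thesis by (simp add: integral_distr)
    qed
    have "integrable lborel (\<lambda>\<xi>. H (t n *\<^sub>R ?e + \<xi>))"
    proof -
      have "integrable (distr lborel borel ((+) (t n *\<^sub>R ?e))) H" using cont_cs_integrable[OF csH] by (simp add: lborel_distr_plus)
      then show ?thesis by (simp add: integrable_distr_eq)
    qed
    then show ?thesis using tr cont_cs_integrable[OF csH] by (simp add: add.commute)
  qed
  show ?thesis by (rule LIMSEQ_unique[OF lim[unfolded q0] tendsto_const])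
qed

text \<open>
  Integration by parts: the integral of the derivative of \<open>chr x * G\<close> is zero.
\<close>

lemma component_mult_ift:
  fixes G :: "real ^ 'd \<Rightarrow> complex"
  assumes G: "bump W G"
  shows "complex_of_real (x $ i) * ift G x = ift (\<lambda>\<xi>. \<i> * partial_deriv i G \<xi>) x"
proof -
  let ?w = "(2 * pi) ^ CARD('d)"
  let ?H = "\<lambda>\<xi>. chr x \<xi> * G \<xi>"
  have H: "bump W ?H" by (rule bump_mult[OF G smooth_chr])
  have chr_p: "has_partials (chr x) (\<lambda>i \<xi>. \<i> * complex_of_real (x $ i) * chr x \<xi>)"
    unfolding has_partials_def
  proof
    fix \<xi> :: "real ^ 'd"
    have l: "((\<lambda>\<xi>. \<i> * complex_of_real (x \<bullet> \<xi>)) has_derivative (\<lambda>h. \<i> * complex_of_real (x \<bullet> h))) (at \<xi>)"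
      by (auto intro!: derivative_eq_intros)
    have "(chr x has_derivative (\<lambda>h. chr x \<xi> * (\<i> * complex_of_real (x \<bullet> h)))) (at \<xi>)"
      unfolding chr_def[abs_def]
      using has_derivative_compose[OF l DERIV_exp[unfolded has_field_derivative_def]] .
    moreover have "chr x \<xi> * (\<i> * complex_of_real (x \<bullet> h)) = (\<Sum>j\<in>UNIV. complex_of_real (h $ j) * (\<i> * complex_of_real (x $ j) * chr x \<xi>))" for h
      by (simp add: inner_vec_def sum_distrib_left mult_ac)
    ultimately show "(chr x has_derivative (\<lambda>h. \<Sum>j\<in>UNIV. complex_of_real (h $ j) * (\<i> * complex_of_real (x $ j) * chr x \<xi>))) (at \<xi>)"
      by (simp only:)
  qed
  have "has_partials ?H (\<lambda>i \<xi>. chr x \<xi> * partial_deriv i G \<xi> + \<i> * complex_of_real (x $ i) * chr x \<xi> * G \<xi>)"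
    unfolding has_partials_def
  proof
    fix \<xi> :: "real ^ 'd"
    have d: "(chr x has_derivative (\<lambda>h. \<Sum>j\<in>UNIV. complex_of_real (h $ j) * (\<i> * complex_of_real (x $ j) * chr x \<xi>))) (at \<xi>)"
      "(G has_derivative (\<lambda>h. \<Sum>j\<in>UNIV. complex_of_real (h $ j) * partial_deriv j G \<xi>)) (at \<xi>)"
      using chr_p smooth_has_partials[of G] G by (simp_all add: has_partials_def bump_def)
    show "(?H has_derivative (\<lambda>h. \<Sum>j\<in>UNIV. complex_of_real (h $ j) * (chr x \<xi> * partial_deriv j G \<xi> + \<i> * complex_of_real (x $ j) * chr x \<xi> * G \<xi>))) (at \<xi>)"
      by (rule has_derivative_eq_rhs[OF has_derivative_mult[OF d]])
        (simp add: fun_eq_iff sum_distrib_left sum_distrib_right algebra_simps sum.distrib)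
  qed
  from has_partials_imp_partial_deriv[OF this]
  have p: "partial_deriv i ?H \<xi> = partial_deriv i G \<xi> * chr x \<xi> + \<i> * complex_of_real (x $ i) * (G \<xi> * chr x \<xi>)" for \<xi>
    by (simp add: mult_ac)
  have i1: "integrable lborel (\<lambda>\<xi>. partial_deriv i G \<xi> * chr x \<xi>)" "integrable lborel (\<lambda>\<xi>. G \<xi> * chr x \<xi>)"
    using cont_cs_integrable[OF cont_cs_chr] bump_cs[OF G] bump_cs[OF bump_partial_deriv[OF G]] by auto
  have "0 = (LINT \<xi>|lborel. partial_deriv i ?H \<xi>)" by (rule integral_partial_deriv_zero[OF H, symmetric])
  also have "\<dots> = (LINT \<xi>|lborel. partial_deriv i G \<xi> * chr x \<xi>) + \<i> * complex_of_real (x $ i) * (LINT \<xi>|lborel. G \<xi> * chr x \<xi>)"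
    unfolding p using i1 by simp
  finally have "\<i> * complex_of_real (x $ i) * (LINT \<xi>|lborel. G \<xi> * chr x \<xi>) = - (LINT \<xi>|lborel. partial_deriv i G \<xi> * chr x \<xi>)"
    by (simp add: eq_neg_iff_add_eq_0 add.commute)
  then have "\<i> * (\<i> * complex_of_real (x $ i) * (LINT \<xi>|lborel. G \<xi> * chr x \<xi>)) = - \<i> * (LINT \<xi>|lborel. partial_deriv i G \<xi> * chr x \<xi>)"
    by simp
  then have "complex_of_real (x $ i) * (LINT \<xi>|lborel. G \<xi> * chr x \<xi>) = \<i> * (LINT \<xi>|lborel. partial_deriv i G \<xi> * chr x \<xi>)"
    by (simp add: mult.assoc[symmetric])
  then show ?thesis by (simp add: ift_def mult.assoc)
qed

lemma smooth_ift: assumes "bump W G" shows "smooth (ift G)"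
proof (rule smooth_coinduct[of "\<lambda>f. \<exists>G. bump W G \<and> f = ift G"])
  fix f assume "\<exists>G. bump W G \<and> f = ift G"
  then obtain G where G: "bump W G" "f = ift G" by blast
  have "bump W (\<lambda>\<xi>. (\<i> * complex_of_real (\<xi> $ i)) * G \<xi>)" for i
    by (intro bump_mult[OF G(1)] smooth_mult smooth_const smooth_component)
  then show "\<exists>g. has_partials f g \<and> (\<forall>i. \<exists>G. bump W G \<and> g i = ift G)"
    unfolding G(2) using ift_has_partials[OF bump_cs[OF G(1)]] by blast
qed (use assms in blast)

lemma partial_derivs_ift:
  assumes "bump W G" shows "\<exists>G'. bump W G' \<and> partial_derivs is (ift G) = ift G'"
  using assms
proof (induction "is" arbitrary: G rule: rev_induct)
  case Nil then show ?case by (auto simp: partial_derivs_def)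
next
  case (snoc i is')
  have "bump W (\<lambda>\<xi>. (\<i> * complex_of_real (\<xi> $ i)) * G \<xi>)"
    by (intro bump_mult[OF snoc.prems] smooth_mult smooth_const smooth_component)
  moreover have "partial_deriv i (ift G) = ift (\<lambda>\<xi>. (\<i> * complex_of_real (\<xi> $ i)) * G \<xi>)"
    using has_partials_imp_partial_deriv[OF ift_has_partials[OF bump_cs[OF snoc.prems]]] .
  ultimately show ?case using snoc.IH by (simp only: partial_derivs_snoc)
qed

lemma component_mult_ift_ex:
  assumes "bump W G" shows "\<exists>G'. bump W G' \<and> (\<forall>x. complex_of_real (x $ i) * ift G x = ift G' x)"
  by (intro exI[of _ "\<lambda>\<xi>. \<i> * partial_deriv i G \<xi>"] conjI allI component_mult_ift[OF assms]
      bump_mult[OF bump_partial_deriv[OF assms]] smooth_const)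

lemma component_power_mult_ift_ex:
  assumes "bump W G" shows "\<exists>G'. bump W G' \<and> (\<forall>x. complex_of_real (x $ i ^ n) * ift G x = ift G' x)"
proof (induction n)
  case 0 then show ?case using assms by auto
next
  case (Suc n)
  then obtain G' where G': "bump W G'" "\<And>x. complex_of_real (x $ i ^ n) * ift G x = ift G' x" by blast
  obtain G'' where G'': "bump W G''" "\<And>x. complex_of_real (x $ i) * ift G' x = ift G'' x"
    using component_mult_ift_ex[OF G'(1)] by blast
  have "complex_of_real (x $ i ^ Suc n) * ift G x = ift G'' x" for x
    by (simp add: G'(2)[symmetric] G''(2)[symmetric] mult.assoc)
  then show ?case using G''(1) by blast
qed

lemma monomial_mult_ift_ex:
  assumes "bump W G" shows "\<exists>G'. bump W G' \<and> (\<forall>x. complex_of_real (monomial \<alpha> x) * ift G x = ift G' x)"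
proof -
  have "\<exists>G'. bump W G' \<and> (\<forall>x. complex_of_real (\<Prod>i\<in>S. x $ i ^ \<alpha> i) * ift G x = ift G' x)" if "finite S" for S
    using that
  proof induction
    case empty then show ?case using assms by auto
  next
    case (insert i S)
    then obtain G' where G': "bump W G'" "\<And>x. complex_of_real (\<Prod>i\<in>S. x $ i ^ \<alpha> i) * ift G x = ift G' x" by blast
    obtain G'' where G'': "bump W G''" "\<And>x. complex_of_real (x $ i ^ \<alpha> i) * ift G' x = ift G'' x"
      using component_power_mult_ift_ex[OF G'(1)] by blast
    have "complex_of_real (\<Prod>i\<in>insert i S. x $ i ^ \<alpha> i) * ift G x = ift G'' x" for x
      using insert by (simp add: G'(2)[symmetric] G''(2)[symmetric] mult.assoc)
    then show ?case using G''(1) by blast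
  qed
  from this[of UNIV] show ?thesis by (simp add: monomial_def)
qed

lemma ift_bounded:
  fixes G :: "real ^ 'd \<Rightarrow> complex"
  assumes "cont_cs G" shows "\<exists>B. \<forall>x. cmod (ift G x) \<le> B"
proof (intro exI allI)
  fix x
  have "cmod (LINT \<xi>|lborel. G \<xi> * chr x \<xi>) \<le> (LINT \<xi>|lborel. cmod (G \<xi> * chr x \<xi>))"
    by (rule integral_norm_bound)
  then show "cmod (ift G x) \<le> (LINT \<xi>|lborel. cmod (G \<xi>)) / (2 * pi) ^ CARD('d)"
    by (simp add: ift_def norm_divide norm_mult norm_power divide_right_mono)
qed

text \<open>
  Partial derivatives and multiplication by monomials lead from inverse transforms of bumps to inverse
  transforms of bumps, and these are bounded.
\<close>

theorem ift_schwartz: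
  assumes "bump W G" shows "ift G \<in> schwartz"
proof -
  have "bounded (range (\<lambda>x. complex_of_real (monomial \<alpha> x) * partial_derivs is (ift G) x))" for \<alpha> "is"
  proof -
    obtain G' where G': "bump W G'" "partial_derivs is (ift G) = ift G'" using partial_derivs_ift[OF assms] by blast
    obtain G'' where G'': "bump W G''" "\<And>x. complex_of_real (monomial \<alpha> x) * ift G' x = ift G'' x"
      using monomial_mult_ift_ex[OF G'(1)] by blast
    show ?thesis using ift_bounded[OF bump_cs[OF G''(1)]] by (auto simp: G'(2) G''(2) bounded_iff)
  qed
  then show ?thesis using smooth_ift[OF assms] by (auto simp: schwartz_def)
qed

text \<open>
  The product of the factors \<open>1 + x\<^sub>i\<^sup>2\<close> times \<open>ift G\<close> is again a bounded inverse transform, so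
  \<open>ift G\<close> is dominated by a product of integrable functions of one variable.
\<close>

theorem ift_integrable:
  fixes G :: "real ^ 'd \<Rightarrow> complex"
  assumes "bump W G" shows "integrable lborel (ift G)"
proof -
  have "\<exists>G'. bump W G' \<and> (\<forall>x. complex_of_real (\<Prod>i\<in>S. 1 + (x $ i)\<^sup>2) * ift G x = ift G' x)" if "finite S" for S
    using that
  proof induction
    case empty then show ?case using assms by auto
  next
    case (insert i S)
    then obtain G' where G': "bump W G'" "\<And>x. complex_of_real (\<Prod>i\<in>S. 1 + (x $ i)\<^sup>2) * ift G x = ift G' x" by blast
    obtain G'' where G'': "bump W G''" "\<And>x. complex_of_real ((x $ i)\<^sup>2) * ift G' x = ift G'' x"
      using component_power_mult_ift_ex[OF G'(1)] by blast
    have "complex_of_real (\<Prod>i\<in>insert i S. 1 + (x $ i)\<^sup>2) * ift G x = ift (\<lambda>\<xi>. G' \<xi> + G'' \<xi>) x" for x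
    proof -
      have "complex_of_real (\<Prod>i\<in>insert i S. 1 + (x $ i)\<^sup>2) * ift G x = ift G' x + ift G'' x"
        using insert by (simp add: G'(2)[symmetric] G''(2)[symmetric] algebra_simps)
      also have "\<dots> = ift (\<lambda>\<xi>. G' \<xi> + G'' \<xi>) x"
        using cont_cs_integrable[OF cont_cs_chr[OF bump_cs[OF G'(1)]]] cont_cs_integrable[OF cont_cs_chr[OF bump_cs[OF G''(1)]]]
        by (simp add: ift_def distrib_right add_divide_distrib)
      finally show ?thesis .
    qed
    then show ?case using bump_add[OF G'(1) G''(1)] by blast
  qed
  from this[of UNIV] obtain G' where G': "bump W G'" "\<And>x. complex_of_real (\<Prod>i\<in>UNIV. 1 + (x $ i)\<^sup>2) * ift G x = ift G' x" by auto
  obtain B where B: "\<And>x. cmod (ift G' x) \<le> B" using ift_bounded[OF bump_cs[OF G'(1)]] by blast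
  have "integrable lborel (\<lambda>x :: real ^ 'd. B * (\<Prod>i\<in>UNIV. inverse (1 + (x $ i)\<^sup>2)))"
  proof (intro integrable_mult_right integrable_prod_vec)
    show "integrable lborel (\<lambda>t :: real. inverse (1 + t\<^sup>2))"
      using integrable_inverse_1_plus_square by (simp add: set_integrable_def)
  qed
  then show ?thesis
  proof (rule Bochner_Integration.integrable_bound)
    show "ift G \<in> borel_measurable lborel"
      using smooth_continuous[OF smooth_ift[OF assms]] by (simp add: borel_measurable_continuous_onI)
    show "AE x in lborel. norm (ift G x) \<le> norm (B * (\<Prod>i\<in>UNIV. inverse (1 + (x $ i)\<^sup>2)))"
    proof (rule AE_I2)
      fix x :: "real ^ 'd"
      let ?p = "\<Prod>i\<in>UNIV. 1 + (x $ i)\<^sup>2"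
      have p: "?p > 0" by (intro prod_pos) (auto intro: add_pos_nonneg)
      have "?p * cmod (ift G x) = cmod (ift G' x)"
        using p by (simp only: G'(2)[symmetric] norm_mult norm_of_real abs_of_pos)
      then have "cmod (ift G x) \<le> B * inverse ?p" using B[of x] p by (simp add: field_simps)
      also have "inverse ?p = (\<Prod>i\<in>UNIV. inverse (1 + (x $ i)\<^sup>2))" by (simp add: prod_inversef[symmetric] o_def)
      finally show "norm (ift G x) \<le> norm (B * (\<Prod>i\<in>UNIV. inverse (1 + (x $ i)\<^sup>2)))" by simp
    qed
  qed
qed

theorem fourier_ift: "bump W G \<Longrightarrow> fourier (ift G) = G"
  by (rule fourier_inversion[OF bump_cs ift_integrable])

text \<open>
  A moment of \<open>ift G\<close> is the integral of the inverse transform of a derivative of \<open>G\<close>, that is the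
  value of this derivative at the origin.
\<close>

lemma ift_moments_vanish:
  assumes "bump W G" "0 \<in> W"
  shows "(LINT x|lebesgue. complex_of_real (monomial \<alpha> x) * ift G x) = 0"
proof -
  obtain G' where G': "bump W G'" "\<And>x. complex_of_real (monomial \<alpha> x) * ift G x = ift G' x"
    using monomial_mult_ift_ex[OF assms(1)] by blast
  have "(LINT x|lebesgue. ift G' x) = fourier (ift G') 0" by (simp add: fourier_def)
  also have "\<dots> = G' 0" by (simp add: fourier_ift[OF G'(1)])
  also have "\<dots> = 0" using G'(1) assms(2) by (simp add: bump_def)
  finally show ?thesis by (simp add: G'(2))
qed

lemma ift_real:
  fixes g :: "real ^ 'd \<Rightarrow> real"
  assumes "cont_cs (\<lambda>\<xi>. complex_of_real (g \<xi>))" and even: "\<And>\<xi>. g (- \<xi>) = g \<xi>"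
  shows "ift (\<lambda>\<xi>. complex_of_real (g \<xi>)) x \<in> \<real>"
proof -
  let ?G = "\<lambda>\<xi>. complex_of_real (g \<xi>)"
  have "cnj (LINT \<xi>|lborel. ?G \<xi> * chr x \<xi>) = (LINT \<xi>|lborel. ?G (- \<xi>) * chr x (- \<xi>))"
  proof -
    have "cnj (?G \<xi> * chr x \<xi>) = ?G (- \<xi>) * chr x (- \<xi>)" for \<xi>
      by (simp add: even chr_minus[of x \<xi>, symmetric]) (simp add: chr_def)
    then show ?thesis unfolding Bochner_Integration.integral_cnj[symmetric] by simp
  qed
  also have "\<dots> = (LINT \<xi>|lborel. ?G \<xi> * chr x \<xi>)"
    by (rule integral_lborel_uminus) (rule cont_cs_measurable[OF cont_cs_chr[OF assms(1)]])
  finally have "(LINT \<xi>|lborel. ?G \<xi> * chr x \<xi>) \<in> \<real>" by (simp add: Reals_cnj_iff)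
  then show ?thesis unfolding ift_def by (intro Reals_divide) auto
qed

section \<open>Square-integrable functions and dense test functions\<close>

text \<open>
  A quantitative triangle inequality for squares. With \<open>e\<close> small it compares the energies of two
  functions whose difference has small energy, without square roots.
\<close>

lemma norm_square_add_le: "(cmod (a + b))\<^sup>2 \<le> (1 + e) * (cmod a)\<^sup>2 + (1 + 1 / e) * (cmod b)\<^sup>2" if "e > 0"
proof -
  have "Re (a * cnj b) \<le> cmod a * cmod b" using complex_Re_le_cmod[of "a * cnj b"] by (simp add: norm_mult)
  moreover have "2 * (cmod a * cmod b) \<le> e * (cmod a)\<^sup>2 + (cmod b)\<^sup>2 / e"
  proof -
    have "0 \<le> (e * cmod a - cmod b)\<^sup>2 / e" using that by simp
    also have "\<dots> = e * (cmod a)\<^sup>2 - 2 * (cmod a * cmod b) + (cmod b)\<^sup>2 / e"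
      using that by (simp add: power2_eq_square field_simps)
    finally show ?thesis by simp
  qed
  ultimately show ?thesis unfolding norm_square_add by (simp add: algebra_simps)
qed

lemma norm_square_diff_le: "(cmod (a - b))\<^sup>2 \<le> 2 * (cmod (a - c))\<^sup>2 + 2 * (cmod (c - b))\<^sup>2"
  using norm_square_add_le[of 1 "a - c" "c - b"] by simp

lemma L2_measurable: "f \<in> L2 \<Longrightarrow> f \<in> borel_measurable lebesgue"
  and L2_integrable: "f \<in> L2 \<Longrightarrow> integrable lebesgue (\<lambda>x. (cmod (f x))\<^sup>2)"
  by (simp_all add: L2_def)

lemma L2_add: assumes "f \<in> L2" "g \<in> L2" shows "(\<lambda>x. f x + g x) \<in> L2"
proof -
  have [measurable]: "f \<in> borel_measurable lebesgue" "g \<in> borel_measurable lebesgue"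
    using assms by (auto dest: L2_measurable)
  have "integrable lebesgue (\<lambda>x. (cmod (f x + g x))\<^sup>2)"
  proof (rule Bochner_Integration.integrable_bound)
    show "integrable lebesgue (\<lambda>x. 2 * (cmod (f x))\<^sup>2 + 2 * (cmod (g x))\<^sup>2)"
      using L2_integrable[OF assms(1)] L2_integrable[OF assms(2)] by simp
    show "AE x in lebesgue. norm ((cmod (f x + g x))\<^sup>2) \<le> norm (2 * (cmod (f x))\<^sup>2 + 2 * (cmod (g x))\<^sup>2)"
      using norm_square_add_le[of 1] by simp
  qed measurable
  then show ?thesis by (simp add: L2_def)
qed

lemma L2_uminus: "f \<in> L2 \<Longrightarrow> (\<lambda>x. - f x) \<in> L2" by (simp add: L2_def)

lemma L2_diff: "f \<in> L2 \<Longrightarrow> g \<in> L2 \<Longrightarrow> (\<lambda>x. f x - g x) \<in> L2"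
  using L2_add[of f "\<lambda>x. - g x"] L2_uminus[of g] by simp

lemma cont_cs_L2: "cont_cs f \<Longrightarrow> f \<in> L2"
proof -
  assume f: "cont_cs f"
  have [measurable]: "f \<in> borel_measurable borel" by (rule cont_cs_measurable[OF f])
  have m: "f \<in> borel_measurable lebesgue" by (rule measurable_completion) simp
  have "integrable lebesgue (\<lambda>x. (cmod (f x))\<^sup>2)"
    using cont_cs_norm_square_integrable[OF f] by (subst integrable_completion) auto
  with m show "f \<in> L2" by (simp add: L2_def)
qed

lemma cont_cs_L2_norm_sq: "cont_cs f \<Longrightarrow> L2_norm_sq f = (LINT x|lborel. (cmod (f x))\<^sup>2)"
  unfolding L2_norm_sq_def using cont_cs_measurable[of f] by (subst integral_completion) auto

lemma cont_cs_diff: "cont_cs f \<Longrightarrow> cont_cs g \<Longrightarrow> cont_cs (\<lambda>x. f x - g x)"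
  using cont_cs_add[of f "\<lambda>x. g x * (- 1)"] cont_cs_mult[of g "\<lambda>_. - 1"] by simp

lemma L2_norm_sq_nonneg [simp]: "L2_norm_sq f \<ge> 0" by (simp add: L2_norm_sq_def)

lemma L2_norm_sq_mono_comb:
  assumes "f \<in> L2" "g \<in> L2" "h \<in> L2" and le: "\<And>x. (cmod (h x))\<^sup>2 \<le> a * (cmod (f x))\<^sup>2 + b * (cmod (g x))\<^sup>2"
  shows "L2_norm_sq h \<le> a * L2_norm_sq f + b * L2_norm_sq g"
proof -
  have "L2_norm_sq h \<le> (LINT x|lebesgue. a * (cmod (f x))\<^sup>2 + b * (cmod (g x))\<^sup>2)"
    unfolding L2_norm_sq_def using L2_integrable[OF assms(1)] L2_integrable[OF assms(2)] L2_integrable[OF assms(3)] le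
    by (intro integral_mono) auto
  also have "\<dots> = a * L2_norm_sq f + b * L2_norm_sq g"
    unfolding L2_norm_sq_def using L2_integrable[OF assms(1)] L2_integrable[OF assms(2)] by simp
  finally show ?thesis .
qed

lemma L2_inner_integrable:
  assumes "f \<in> L2" "g \<in> L2" shows "integrable lebesgue (\<lambda>x. f x * cnj (g x))"
  using assms by (auto simp: L2_def intro: integrable_inner_of_norm_square)

lemma L2_inner_diff:
  assumes "f \<in> L2" "g \<in> L2" "h \<in> L2"
  shows "L2_inner (\<lambda>x. f x - g x) h = L2_inner f h - L2_inner g h"
  unfolding L2_inner_def using L2_inner_integrable[OF assms(1,3)] L2_inner_integrable[OF assms(2,3)]
  by (simp add: left_diff_distrib)

text \<open>
  A weighted form of the Cauchy-Schwarz inequality, sufficient to show that \<open>L2_inner\<close> is continuous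
  in its first argument.
\<close>

lemma L2_inner_bound:
  assumes "f \<in> L2" "g \<in> L2" "e > 0"
  shows "cmod (L2_inner f g) \<le> L2_norm_sq f / e + e * L2_norm_sq g"
proof -
  have "cmod (L2_inner f g) \<le> (LINT x|lebesgue. cmod (f x * cnj (g x)))"
    unfolding L2_inner_def by (rule integral_norm_bound)
  also have "\<dots> \<le> (LINT x|lebesgue. (cmod (f x))\<^sup>2 / e + e * (cmod (g x))\<^sup>2)"
  proof (rule integral_mono)
    show "integrable lebesgue (\<lambda>x. cmod (f x * cnj (g x)))"
      using L2_inner_integrable[OF assms(1,2)] by (rule integrable_norm)
    show "integrable lebesgue (\<lambda>x. (cmod (f x))\<^sup>2 / e + e * (cmod (g x))\<^sup>2)"
      using L2_integrable[OF assms(1)] L2_integrable[OF assms(2)] by simp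
    fix x
    have "0 \<le> (cmod (f x) - e * cmod (g x))\<^sup>2 / e + cmod (f x) * cmod (g x)" using assms by simp
    also have "\<dots> = (cmod (f x))\<^sup>2 / e + e * (cmod (g x))\<^sup>2 - cmod (f x) * cmod (g x)"
      using assms by (simp add: power2_eq_square field_simps)
    finally show "cmod (f x * cnj (g x)) \<le> (cmod (f x))\<^sup>2 / e + e * (cmod (g x))\<^sup>2" by (simp add: norm_mult)
  qed
  also have "\<dots> = L2_norm_sq f / e + e * L2_norm_sq g"
    unfolding L2_norm_sq_def using L2_integrable[OF assms(1)] L2_integrable[OF assms(2)] by simp
  finally show ?thesis .
qed

lemma L2_inner_tendsto:
  assumes f: "f \<in> L2" "\<And>n. u n \<in> L2" "h \<in> L2" and lim: "(\<lambda>n. L2_norm_sq (\<lambda>x. u n x - f x)) \<longlonglongrightarrow> 0"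
  shows "(\<lambda>n. L2_inner (u n) h) \<longlonglongrightarrow> L2_inner f h"
proof (rule LIMSEQ_I)
  fix r :: real assume "r > 0"
  define e where "e = r / (2 * (L2_norm_sq h + 1))"
  have hp: "L2_norm_sq h + 1 > 0" by (rule add_nonneg_pos) simp_all
  have e: "e > 0" "e * L2_norm_sq h \<le> r / 2" using \<open>r > 0\<close> hp by (auto simp: e_def field_simps)
  have "e * r / 2 > 0" using e \<open>r > 0\<close> by simp
  from LIMSEQ_D[OF lim this] obtain N where N: "\<And>n. n \<ge> N \<Longrightarrow> L2_norm_sq (\<lambda>x. u n x - f x) < e * r / 2" by auto
  show "\<exists>N. \<forall>n\<ge>N. norm (L2_inner (u n) h - L2_inner f h) < r"
  proof (intro exI allI impI)
    fix n assume "n \<ge> N"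
    have "norm (L2_inner (u n) h - L2_inner f h) = cmod (L2_inner (\<lambda>x. u n x - f x) h)"
      using f by (simp add: L2_inner_diff)
    also have "\<dots> \<le> L2_norm_sq (\<lambda>x. u n x - f x) / e + e * L2_norm_sq h"
      by (intro L2_inner_bound L2_diff f e)
    also have "\<dots> < (e * r / 2) / e + r / 2"
      using N[OF \<open>n \<ge> N\<close>] e by (intro add_less_le_mono divide_strict_right_mono) auto
    also have "\<dots> = r" using e by simp
    finally show "norm (L2_inner (u n) h - L2_inner f h) < r" .
  qed
qed

lemma L2_truncate:
  fixes f :: "real ^ 'd \<Rightarrow> complex"
  assumes f: "f \<in> L2" and "e > 0"
  obtains m :: nat where "(LINT x|lebesgue. (cmod (f x - (if norm x \<le> m \<and> cmod (f x) \<le> m then f x else 0)))\<^sup>2) < e"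
proof -
  have [measurable]: "f \<in> borel_measurable lebesgue" using f by (rule L2_measurable)
  have [measurable]: "(\<lambda>x :: real ^ 'd. norm x) \<in> borel_measurable lebesgue"
    by (rule measurable_completion) measurable
  have "(\<lambda>m::nat. LINT x|lebesgue. (cmod (f x - (if norm x \<le> m \<and> cmod (f x) \<le> m then f x else 0)))\<^sup>2) \<longlonglongrightarrow> (LINT x::real^'d|lebesgue. 0)"
  proof (rule integral_dominated_convergence)
    show "integrable lebesgue (\<lambda>x. (cmod (f x))\<^sup>2)" by (rule L2_integrable[OF f])
    show "AE x in lebesgue. (\<lambda>m::nat. (cmod (f x - (if norm x \<le> m \<and> cmod (f x) \<le> m then f x else 0)))\<^sup>2) \<longlonglongrightarrow> 0"
    proof (rule AE_I2)
      fix x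
      obtain N :: nat where N: "max (norm x) (cmod (f x)) \<le> N" using real_arch_simple by blast
      show "(\<lambda>m::nat. (cmod (f x - (if norm x \<le> m \<and> cmod (f x) \<le> m then f x else 0)))\<^sup>2) \<longlonglongrightarrow> 0"
      proof (rule tendsto_eventually, rule eventually_sequentiallyI[of N])
        fix m assume "N \<le> m"
        then have "real N \<le> real m" by simp
        then show "(cmod (f x - (if norm x \<le> m \<and> cmod (f x) \<le> m then f x else 0)))\<^sup>2 = 0" using N by auto
      qed
    qed
  qed (simp, measurable)
  then have "(\<lambda>m::nat. LINT x|lebesgue. (cmod (f x - (if norm x \<le> m \<and> cmod (f x) \<le> m then f x else 0)))\<^sup>2) \<longlonglongrightarrow> 0" by simp
  from LIMSEQ_D[OF this \<open>e > 0\<close>] show thesis using that by (auto simp: abs_less_iff)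
qed

text \<open>
  A Lebesgue measurable function is almost everywhere a limit of continuous functions. Projecting
  their values to a ball and multiplying by a cutoff makes dominated convergence applicable.
\<close>

lemma cont_cs_dense_bounded:
  fixes f :: "real ^ 'd \<Rightarrow> complex"
  assumes f: "f \<in> borel_measurable lebesgue" and b: "\<And>x. cmod (f x) \<le> B" and s: "\<And>x. norm x > R \<Longrightarrow> f x = 0"
    and "e > 0"
  obtains h where "cont_cs h" "L2_norm_sq (\<lambda>x. f x - h x) < e"
proof -
  have "B \<ge> 0" using b[of undefined] norm_ge_zero order_trans by blast
  note [measurable] = f
  have "f measurable_on UNIV" by (rule lebesgue_measurable_imp_measurable_on[OF f]) simp
  then obtain N g where N: "negligible N" and g: "\<And>n::nat. continuous_on UNIV (g n)"
    "\<And>x. x \<notin> N \<Longrightarrow> (\<lambda>n. g n x) \<longlonglongrightarrow> f x" unfolding measurable_on_def by auto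
  define c where "c x = complex_of_real (max 0 (min 1 (R + 1 - norm x)))" for x :: "real ^ 'd"
  define h where "h n x = c x * closest_point (cball 0 B) (g n x)" for n x
  have ne: "cball (0::complex) B \<noteq> {}" using \<open>B \<ge> 0\<close> by simp
  have cpc: "continuous_on UNIV (closest_point (cball (0::complex) B))"
    using ne by (intro continuous_on_closest_point) auto
  have bc: "cmod (closest_point (cball (0::complex) B) z) \<le> B" for z
    using closest_point_in_set[OF _ ne, of z] by simp
  have hc: "cont_cs (h n)" for n
  proof -
    have "cont_cs c" unfolding cont_cs_def
    proof
      show "continuous_on UNIV c" unfolding c_def by (intro continuous_intros)
      show "bounded {x. c x \<noteq> 0}"
        by (rule bounded_subset[OF bounded_cball[of 0 "R + 1"]]) (auto simp: c_def)
    qed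
    then show ?thesis unfolding h_def
      by (intro cont_cs_mult continuous_on_compose2[OF cpc g(1)]) auto
  qed
  have hm [measurable]: "h n \<in> borel_measurable lebesgue" for n
    using L2_measurable[OF cont_cs_L2[OF hc]] .
  have "(\<lambda>n. LINT x|lebesgue. (cmod (f x - h n x))\<^sup>2) \<longlonglongrightarrow> (LINT x::real^'d|lebesgue. 0)"
  proof (rule integral_dominated_convergence)
    show "integrable lebesgue (\<lambda>x :: real ^ 'd. (2 * B)\<^sup>2 * indicator (cball 0 (R + 1)) x)"
      using emeasure_bounded_finite[OF bounded_cball[of "0 :: real ^ 'd" "R + 1"]]
      by (intro integrable_mult_right integrable_real_indicator) auto
    show "AE x in lebesgue. (\<lambda>n. (cmod (f x - h n x))\<^sup>2) \<longlonglongrightarrow> 0"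
    proof (rule AE_I')
      show "N \<in> null_sets lebesgue" using N by (simp add: negligible_iff_null_sets)
      show "{x \<in> space lebesgue. \<not> (\<lambda>n. (cmod (f x - h n x))\<^sup>2) \<longlonglongrightarrow> 0} \<subseteq> N"
      proof (rule subsetI, rule ccontr)
        fix x assume x: "x \<in> {x \<in> space lebesgue. \<not> (\<lambda>n. (cmod (f x - h n x))\<^sup>2) \<longlonglongrightarrow> 0}" and "x \<notin> N"
        have "(\<lambda>n. closest_point (cball 0 B) (g n x)) \<longlonglongrightarrow> closest_point (cball 0 B) (f x)"
          using cpc g(2)[OF \<open>x \<notin> N\<close>] by (intro isCont_tendsto_compose[of _ "closest_point (cball 0 B)"])
            (auto simp: continuous_on_eq_continuous_at)
        also have "closest_point (cball 0 B) (f x) = f x" using b by (intro closest_point_self) simp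
        finally have "(\<lambda>n. h n x) \<longlonglongrightarrow> c x * f x" unfolding h_def by (intro tendsto_intros)
        moreover have "c x * f x = f x"
        proof (cases "norm x > R")
          case False then show ?thesis by (simp add: c_def)
        qed (simp add: s)
        ultimately have "(\<lambda>n. h n x) \<longlonglongrightarrow> f x" by simp
        then have "(\<lambda>n. (cmod (f x - h n x))\<^sup>2) \<longlonglongrightarrow> (cmod (f x - f x))\<^sup>2" by (intro tendsto_intros)
        then show False using x by simp
      qed
    qed
    fix n
    show "AE x in lebesgue. norm ((cmod (f x - h n x))\<^sup>2) \<le> (2 * B)\<^sup>2 * indicator (cball 0 (R + 1)) x"
    proof (rule AE_I2)
      fix x :: "real ^ 'd"
      show "norm ((cmod (f x - h n x))\<^sup>2) \<le> (2 * B)\<^sup>2 * indicator (cball 0 (R + 1)) x"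
      proof (cases "norm x > R + 1")
        case True then show ?thesis by (simp add: s h_def c_def)
      next
        case False
        have "cmod (c x) \<le> 1" by (simp add: c_def)
        then have "cmod (h n x) \<le> 1 * B" unfolding h_def norm_mult using bc by (intro mult_mono) auto
        then have "cmod (f x - h n x) \<le> 2 * B" using b[of x] norm_triangle_ineq4[of "f x" "h n x"] by simp
        then have "(cmod (f x - h n x))\<^sup>2 \<le> (2 * B)\<^sup>2" by (intro power_mono) auto
        then show ?thesis using False by simp
      qed
    qed
  qed (simp, measurable)
  then have "(\<lambda>n. L2_norm_sq (\<lambda>x. f x - h n x)) \<longlonglongrightarrow> 0" by (simp add: L2_norm_sq_def)
  from LIMSEQ_D[OF this \<open>e > 0\<close>] obtain n where "L2_norm_sq (\<lambda>x. f x - h n x) < e" by (auto simp: abs_less_iff)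
  then show thesis using that hc by blast
qed

text \<open>
  Truncation reduces the claim to bounded functions of bounded support.
\<close>

lemma cont_cs_dense:
  fixes f :: "real ^ 'd \<Rightarrow> complex"
  assumes f: "f \<in> L2" and "e > 0"
  obtains h where "cont_cs h" "L2_norm_sq (\<lambda>x. f x - h x) < e"
proof -
  have [measurable]: "f \<in> borel_measurable lebesgue" using f by (rule L2_measurable)
  have [measurable]: "(\<lambda>x :: real ^ 'd. norm x) \<in> borel_measurable lebesgue"
    by (rule measurable_completion) measurable
  have "e / 4 > 0" using \<open>e > 0\<close> by simp
  from L2_truncate[OF f this] obtain m :: nat where
    m: "(LINT x|lebesgue. (cmod (f x - (if norm x \<le> m \<and> cmod (f x) \<le> m then f x else 0)))\<^sup>2) < e / 4" .
  define t where "t x = (if norm x \<le> m \<and> cmod (f x) \<le> m then f x else 0)" for x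
  have tm [measurable]: "t \<in> borel_measurable lebesgue" unfolding t_def[abs_def] by measurable
  obtain h where h: "cont_cs h" "L2_norm_sq (\<lambda>x. t x - h x) < e / 4"
  proof (rule cont_cs_dense_bounded[OF tm _ _ \<open>e / 4 > 0\<close>])
    show "cmod (t x) \<le> m" for x by (simp add: t_def)
    show "norm x > m \<Longrightarrow> t x = 0" for x by (simp add: t_def)
  qed
  have tL2: "t \<in> L2"
  proof -
    have "integrable lebesgue (\<lambda>x. (cmod (t x))\<^sup>2)"
      by (rule Bochner_Integration.integrable_bound[OF L2_integrable[OF f]]) (auto simp: t_def)
    then show ?thesis by (simp add: L2_def)
  qed
  have "L2_norm_sq (\<lambda>x. f x - h x) \<le> 2 * L2_norm_sq (\<lambda>x. f x - t x) + 2 * L2_norm_sq (\<lambda>x. t x - h x)"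
    by (intro L2_norm_sq_mono_comb L2_diff f tL2 cont_cs_L2 h norm_square_diff_le)
  also have "\<dots> < e" using m h by (simp add: L2_norm_sq_def t_def)
  finally show thesis using that h by blast
qed

text \<open>
  The family is indexed by pairs and the energy is an iterated integral for the counting measure, so
  that the first index can be the scale and the second one the lattice point.
\<close>

definition coefficient_energy ::
    "'i set \<Rightarrow> 'k set \<Rightarrow> ('i \<Rightarrow> 'k \<Rightarrow> real ^ 'd \<Rightarrow> complex) \<Rightarrow> (real ^ 'd \<Rightarrow> complex) \<Rightarrow> ennreal"
  where "coefficient_energy I K \<gamma> f =
    (\<integral>\<^sup>+i. (\<integral>\<^sup>+k. ennreal ((cmod (L2_inner f (\<gamma> i k)))\<^sup>2) \<partial>count_space K) \<partial>count_space I)"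

lemma coefficient_energy_le:
  fixes f g :: "real ^ 'd \<Rightarrow> complex"
  assumes \<gamma>: "\<And>i k. i \<in> I \<Longrightarrow> k \<in> K \<Longrightarrow> \<gamma> i k \<in> L2" and "f \<in> L2" "g \<in> L2" "e > 0"
  shows "coefficient_energy I K \<gamma> f \<le> ennreal (1 + e) * coefficient_energy I K \<gamma> g
    + ennreal (1 + 1 / e) * coefficient_energy I K \<gamma> (\<lambda>x. f x - g x)"
proof -
  let ?a = "\<lambda>f i k. ennreal ((cmod (L2_inner f (\<gamma> i k)))\<^sup>2)"
  have "coefficient_energy I K \<gamma> f \<le> (\<integral>\<^sup>+i. (\<integral>\<^sup>+k. ennreal (1 + e) * ?a g i k
     + ennreal (1 + 1 / e) * ?a (\<lambda>x. f x - g x) i k \<partial>count_space K) \<partial>count_space I)"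
    unfolding coefficient_energy_def
  proof (intro nn_integral_mono)
    fix i k assume "i \<in> space (count_space I)" "k \<in> space (count_space K)"
    then have "L2_inner f (\<gamma> i k) = L2_inner g (\<gamma> i k) + L2_inner (\<lambda>x. f x - g x) (\<gamma> i k)"
      using L2_inner_diff[OF assms(2,3), of "\<gamma> i k"] \<gamma> by simp
    then have "(cmod (L2_inner f (\<gamma> i k)))\<^sup>2 \<le> (1 + e) * (cmod (L2_inner g (\<gamma> i k)))\<^sup>2
      + (1 + 1 / e) * (cmod (L2_inner (\<lambda>x. f x - g x) (\<gamma> i k)))\<^sup>2"
      using norm_square_add_le[OF \<open>e > 0\<close>] by simp
    then show "?a f i k \<le> ennreal (1 + e) * ?a g i k + ennreal (1 + 1 / e) * ?a (\<lambda>x. f x - g x) i k"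
      using \<open>e > 0\<close> by (simp add: ennreal_mult[symmetric] ennreal_plus[symmetric] ennreal_leI del: ennreal_plus)
  qed
  also have "\<dots> = ennreal (1 + e) * coefficient_energy I K \<gamma> g + ennreal (1 + 1 / e) * coefficient_energy I K \<gamma> (\<lambda>x. f x - g x)"
    unfolding coefficient_energy_def by (simp add: nn_integral_add nn_integral_cmult)
  finally show ?thesis .
qed

text \<open>
  Each coefficient converges, so Fatou's lemma applies to both sums.
\<close>

lemma coefficient_energy_liminf:
  fixes f :: "real ^ 'd \<Rightarrow> complex"
  assumes \<gamma>: "\<And>i k. i \<in> I \<Longrightarrow> k \<in> K \<Longrightarrow> \<gamma> i k \<in> L2"
    and f: "f \<in> L2" "\<And>n. u n \<in> L2" and lim: "(\<lambda>n. L2_norm_sq (\<lambda>x. u n x - f x)) \<longlonglongrightarrow> 0"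
  shows "coefficient_energy I K \<gamma> f \<le> liminf (\<lambda>n. coefficient_energy I K \<gamma> (u n))"
proof -
  let ?a = "\<lambda>f i k. ennreal ((cmod (L2_inner f (\<gamma> i k)))\<^sup>2)"
  have "coefficient_energy I K \<gamma> f = (\<integral>\<^sup>+i. (\<integral>\<^sup>+k. liminf (\<lambda>n. ?a (u n) i k) \<partial>count_space K) \<partial>count_space I)"
    unfolding coefficient_energy_def
  proof (intro nn_integral_cong)
    fix i k assume "i \<in> space (count_space I)" "k \<in> space (count_space K)"
    then have "(\<lambda>n. L2_inner (u n) (\<gamma> i k)) \<longlonglongrightarrow> L2_inner f (\<gamma> i k)"
      by (intro L2_inner_tendsto f lim \<gamma>) auto
    then have "(\<lambda>n. ?a (u n) i k) \<longlonglongrightarrow> ?a f i k"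
      by (intro tendsto_ennrealI tendsto_intros)
    then show "?a f i k = liminf (\<lambda>n. ?a (u n) i k)"
      by (intro lim_imp_Liminf[symmetric]) auto
  qed
  also have "\<dots> \<le> (\<integral>\<^sup>+i. liminf (\<lambda>n. \<integral>\<^sup>+k. ?a (u n) i k \<partial>count_space K) \<partial>count_space I)"
    by (rule nn_integral_mono) (rule nn_integral_liminf, simp)
  also have "\<dots> \<le> liminf (\<lambda>n. \<integral>\<^sup>+i. \<integral>\<^sup>+k. ?a (u n) i k \<partial>count_space K \<partial>count_space I)"
    by (rule nn_integral_liminf) simp
  finally show ?thesis by (simp add: coefficient_energy_def)
qed

lemma ennreal_le_by_perturbation:
  assumes "a \<ge> 0" "\<And>e. 0 < e \<Longrightarrow> x \<le> ennreal ((1 + e)\<^sup>2 * a + e)"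
  shows "x \<le> ennreal a"
proof (rule tendsto_lowerbound)
  have "((\<lambda>e. (1 + e)\<^sup>2 * a + e) \<longlongrightarrow> (1 + 0)\<^sup>2 * a + 0) (at_right (0::real))"
    by (intro tendsto_intros)
  then show "((\<lambda>e. ennreal ((1 + e)\<^sup>2 * a + e)) \<longlongrightarrow> ennreal a) (at_right (0::real))"
    by (intro tendsto_ennrealI) simp
  show "\<forall>\<^sub>F e in at_right 0. x \<le> ennreal ((1 + e)\<^sup>2 * a + e)"
    using assms(2) by (auto simp: eventually_at_filter)
qed simp

text \<open>
  For approximations \<open>g n\<close> of \<open>f\<close>, Fatou's lemma bounds the energy of \<open>f - g n\<close> by the limit of the
  energies of \<open>g m - g n\<close>, which are squared norms and hence small. The perturbed triangle inequality
  then transfers the identity from \<open>g n\<close> to \<open>f\<close> in both directions.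
\<close>

theorem tight_frame_of_dense:
  fixes f :: "real ^ 'd \<Rightarrow> complex"
  assumes \<gamma>: "\<And>i k. i \<in> I \<Longrightarrow> k \<in> K \<Longrightarrow> \<gamma> i k \<in> L2"
    and cont_cs: "\<And>g. cont_cs g \<Longrightarrow> coefficient_energy I K \<gamma> g = ennreal (L2_norm_sq g)"
    and f: "f \<in> L2"
  shows "coefficient_energy I K \<gamma> f = ennreal (L2_norm_sq f)"
proof -
  let ?E = "coefficient_energy I K \<gamma>"
  have "\<exists>h. cont_cs h \<and> L2_norm_sq (\<lambda>x. f x - h x) < inverse (real (Suc n))" for n
    using cont_cs_dense[OF f, of "inverse (real (Suc n))"] by auto
  then obtain g where g: "\<And>n. cont_cs (g n)" "\<And>n. L2_norm_sq (\<lambda>x. f x - g n x) < inverse (real (Suc n))" by metis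
  have gL: "g n \<in> L2" for n by (rule cont_cs_L2[OF g(1)])
  let ?d = "\<lambda>n. L2_norm_sq (\<lambda>x. f x - g n x)"
  have dlim: "?d \<longlonglongrightarrow> 0"
  proof (rule tendsto_sandwich[OF _ _ tendsto_const LIMSEQ_inverse_real_of_nat])
    show "\<forall>\<^sub>F n in sequentially. ?d n \<le> inverse (real (Suc n))" by (intro always_eventually allI less_imp_le g(2))
  qed (simp add: L2_norm_sq_nonneg)
  have bessel: "?E (\<lambda>x. f x - g n x) \<le> ennreal (2 * inverse (real (Suc n)) + 2 * ?d n)" for n
  proof -
    have sw: "L2_norm_sq (\<lambda>x. (g m x - g n x) - (f x - g n x)) = ?d m" for m
      by (simp add: L2_norm_sq_def norm_minus_commute)
    have "?E (\<lambda>x. f x - g n x) \<le> liminf (\<lambda>m. ?E (\<lambda>x. g m x - g n x))"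
      by (intro coefficient_energy_liminf \<gamma> L2_diff f gL) (simp_all only: sw dlim)
    also have "\<dots> \<le> liminf (\<lambda>m. ennreal (2 * inverse (real (Suc n)) + 2 * ?d n))"
    proof (rule Liminf_mono, rule eventually_sequentiallyI[of n])
      fix m assume "n \<le> m"
      have "L2_norm_sq (\<lambda>x. g m x - g n x) \<le> 2 * L2_norm_sq (\<lambda>x. g m x - f x) + 2 * ?d n"
        by (intro L2_norm_sq_mono_comb L2_diff f gL norm_square_diff_le)
      also have "L2_norm_sq (\<lambda>x. g m x - f x) = ?d m" by (simp add: L2_norm_sq_def norm_minus_commute)
      also have "?d m \<le> inverse (real (Suc n))"
      proof -
        have "inverse (real (Suc m)) \<le> inverse (real (Suc n))" using \<open>n \<le> m\<close> by (intro le_imp_inverse_le) auto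
        then show ?thesis by (rule order_trans[OF less_imp_le[OF g(2)]])
      qed
      finally show "?E (\<lambda>x. g m x - g n x) \<le> ennreal (2 * inverse (real (Suc n)) + 2 * ?d n)"
        by (subst cont_cs[OF cont_cs_diff[OF g(1) g(1)]]) (intro ennreal_leI, simp)
    qed
    also have "\<dots> = ennreal (2 * inverse (real (Suc n)) + 2 * ?d n)" by (rule Liminf_const) simp
    finally show ?thesis .
  qed
  have small: "\<exists>n. ?d n \<le> e \<and> ?E (\<lambda>x. f x - g n x) \<le> ennreal e" if "e > 0" for e
  proof -
    have "(\<lambda>n. 2 * inverse (real (Suc n)) + 2 * ?d n) \<longlonglongrightarrow> 2 * 0 + 2 * 0"
      by (intro tendsto_intros LIMSEQ_inverse_real_of_nat dlim)
    then have "\<forall>\<^sub>F n in sequentially. 2 * inverse (real (Suc n)) + 2 * ?d n < e"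
      using that by (intro order_tendstoD) auto
    then obtain n where n: "2 * inverse (real (Suc n)) + 2 * ?d n < e"
      by (auto simp: eventually_sequentially)
    have "?E (\<lambda>x. f x - g n x) \<le> ennreal e" using n by (intro order_trans[OF bessel[of n]] ennreal_leI) simp
    moreover have "?d n \<le> e"
    proof -
      have "0 \<le> inverse (real (Suc n))" by simp
      then show ?thesis using n L2_norm_sq_nonneg[of "\<lambda>x. f x - g n x"] by linarith
    qed
    ultimately show ?thesis by blast
  qed
  \<comment> \<open>an accuracy \<open>d\<close> for which the error terms of two perturbed inequalities add up to at most \<open>e\<close>\<close>
  have approx: "\<exists>d>0. (1 + e) * ((1 + 1 / e) * d) + (1 + 1 / e) * d \<le> e" if "e > 0" for e :: real
  proof (intro exI conjI)
    have p: "(1 + e) * (1 + 1 / e) + (1 + 1 / e) > 0" using that by (intro add_pos_pos mult_pos_pos) auto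
    let ?d = "e / ((1 + e) * (1 + 1 / e) + (1 + 1 / e))"
    show "?d > 0" using p that by simp
    have "(1 + e) * ((1 + 1 / e) * ?d) + (1 + 1 / e) * ?d = ((1 + e) * (1 + 1 / e) + (1 + 1 / e)) * ?d"
      by (simp only: distrib_right mult.assoc)
    also have "\<dots> = e" using p by simp
    finally show "(1 + e) * ((1 + 1 / e) * ?d) + (1 + 1 / e) * ?d \<le> e" by simp
  qed
  have regroup: "a * (a * x + b * d) + b * d = a\<^sup>2 * x + (a * (b * d) + b * d)" for a b x d :: real
    by (simp add: power2_eq_square algebra_simps)
  note nonneg = L2_norm_sq_nonneg
  have upper: "?E f \<le> ennreal (L2_norm_sq f)"
  proof (rule ennreal_le_by_perturbation[OF nonneg])
    fix e :: real assume "e > 0"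
    obtain d where d: "d > 0" "(1 + e) * ((1 + 1 / e) * d) + (1 + 1 / e) * d \<le> e" using approx[OF \<open>e > 0\<close>] by blast
    obtain n where n: "?d n \<le> d" "?E (\<lambda>x. f x - g n x) \<le> ennreal d" using small[OF d(1)] by blast
    have "L2_norm_sq (g n) \<le> (1 + e) * L2_norm_sq f + (1 + 1 / e) * ?d n"
    proof (intro L2_norm_sq_mono_comb f gL L2_diff)
      fix x
      have "cmod (g n x) = cmod (f x + (g n x - f x))" by simp
      then show "(cmod (g n x))\<^sup>2 \<le> (1 + e) * (cmod (f x))\<^sup>2 + (1 + 1 / e) * (cmod (f x - g n x))\<^sup>2"
        using norm_square_add_le[OF \<open>e > 0\<close>, of "f x" "g n x - f x"] by (simp only: norm_minus_commute)
    qed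
    also have "\<dots> \<le> (1 + e) * L2_norm_sq f + (1 + 1 / e) * d"
      using n \<open>e > 0\<close> by (intro add_left_mono mult_left_mono) auto
    finally have gn: "L2_norm_sq (g n) \<le> (1 + e) * L2_norm_sq f + (1 + 1 / e) * d" .
    have "?E f \<le> ennreal (1 + e) * ?E (g n) + ennreal (1 + 1 / e) * ?E (\<lambda>x. f x - g n x)"
      by (intro coefficient_energy_le \<gamma> f gL \<open>e > 0\<close>)
    also have "\<dots> \<le> ennreal (1 + e) * ennreal ((1 + e) * L2_norm_sq f + (1 + 1 / e) * d) + ennreal (1 + 1 / e) * ennreal d"
      using gn n(2) by (intro add_mono mult_left_mono) (auto simp: cont_cs[OF g(1)] intro: ennreal_leI)
    also have "\<dots> = ennreal ((1 + e) * ((1 + e) * L2_norm_sq f + (1 + 1 / e) * d) + (1 + 1 / e) * d)"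
      using \<open>e > 0\<close> d(1) nonneg[of f] by (simp add: ennreal_mult[symmetric] ennreal_plus[symmetric] del: ennreal_plus)
    also have "\<dots> \<le> ennreal ((1 + e)\<^sup>2 * L2_norm_sq f + e)"
    proof (rule ennreal_leI)
      have "(1 + e) * ((1 + e) * L2_norm_sq f + (1 + 1 / e) * d) + (1 + 1 / e) * d
        = (1 + e)\<^sup>2 * L2_norm_sq f + ((1 + e) * ((1 + 1 / e) * d) + (1 + 1 / e) * d)"
        by (rule regroup)
      then show "(1 + e) * ((1 + e) * L2_norm_sq f + (1 + 1 / e) * d) + (1 + 1 / e) * d \<le> (1 + e)\<^sup>2 * L2_norm_sq f + e"
        using d(2) by linarith
    qed
    finally show "?E f \<le> ennreal ((1 + e)\<^sup>2 * L2_norm_sq f + e)" .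
  qed
  then obtain a where a: "?E f = ennreal a" "a \<ge> 0"
    by (metis ennreal_cases ennreal_less_top neq_top_trans top.not_eq_extremum)
  have "ennreal (L2_norm_sq f) \<le> ennreal a"
  proof (rule ennreal_le_by_perturbation[OF a(2)])
    fix e :: real assume "e > 0"
    obtain d where d: "d > 0" "(1 + e) * ((1 + 1 / e) * d) + (1 + 1 / e) * d \<le> e" using approx[OF \<open>e > 0\<close>] by blast
    obtain n where n: "?d n \<le> d" "?E (\<lambda>x. f x - g n x) \<le> ennreal d" using small[OF d(1)] by blast
    have "?E (\<lambda>x. g n x - f x) = ?E (\<lambda>x. f x - g n x)"
      unfolding coefficient_energy_def
      by (intro nn_integral_cong) (simp add: L2_inner_diff[OF gL f \<gamma>] L2_inner_diff[OF f gL \<gamma>] norm_minus_commute)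
    then have "?E (g n) \<le> ennreal (1 + e) * ?E f + ennreal (1 + 1 / e) * ?E (\<lambda>x. f x - g n x)"
      using coefficient_energy_le[of I K \<gamma> "g n" f e, OF \<gamma> gL f \<open>e > 0\<close>] by simp
    also have "\<dots> \<le> ennreal (1 + e) * ennreal a + ennreal (1 + 1 / e) * ennreal d"
      using n(2) a by (intro add_mono mult_left_mono) auto
    also have "\<dots> = ennreal ((1 + e) * a + (1 + 1 / e) * d)"
      using \<open>e > 0\<close> d(1) a by (simp add: ennreal_mult[symmetric] ennreal_plus[symmetric] del: ennreal_plus)
    finally have "ennreal (L2_norm_sq (g n)) \<le> ennreal ((1 + e) * a + (1 + 1 / e) * d)" by (simp only: cont_cs[OF g(1)])
    then have gn: "L2_norm_sq (g n) \<le> (1 + e) * a + (1 + 1 / e) * d"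
      using \<open>e > 0\<close> d(1) a by (subst (asm) ennreal_le_iff) auto
    have "L2_norm_sq f \<le> (1 + e) * L2_norm_sq (g n) + (1 + 1 / e) * ?d n"
    proof (intro L2_norm_sq_mono_comb f gL L2_diff)
      fix x
      show "(cmod (f x))\<^sup>2 \<le> (1 + e) * (cmod (g n x))\<^sup>2 + (1 + 1 / e) * (cmod (f x - g n x))\<^sup>2"
        using norm_square_add_le[OF \<open>e > 0\<close>, of "g n x" "f x - g n x"] by simp
    qed
    also have "\<dots> \<le> (1 + e) * ((1 + e) * a + (1 + 1 / e) * d) + (1 + 1 / e) * d"
      using n gn \<open>e > 0\<close> by (intro add_mono mult_left_mono) auto
    also have "\<dots> = (1 + e)\<^sup>2 * a + ((1 + e) * ((1 + 1 / e) * d) + (1 + 1 / e) * d)"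
      by (rule regroup)
    also have "\<dots> \<le> (1 + e)\<^sup>2 * a + e" using d(2) by linarith
    finally show "ennreal (L2_norm_sq f) \<le> ennreal ((1 + e)\<^sup>2 * a + e)" by (rule ennreal_leI)
  qed
  with upper show ?thesis unfolding a(1) by (rule antisym)
qed

section \<open>Powers of the inverse of an expansive matrix\<close>

text \<open>
  The vector \<open>p(A) v\<close>. Evaluating at one vector avoids polynomials in matrices.
\<close>

definition poly_act :: "complex ^ 'n ^ 'n \<Rightarrow> complex poly \<Rightarrow> complex ^ 'n \<Rightarrow> complex ^ 'n"
  where "poly_act A p v = (\<Sum>i\<le>degree p. coeff p i *s (((*v) A) ^^ i) v)"

lemma matrix_vector_mult_sum_right: "A *v (\<Sum>i\<in>S. f i) = (\<Sum>i\<in>S. A *v f i)"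
  by (induction S rule: infinite_finite_induct) (auto simp: matrix_vector_right_distrib)

lemma poly_act_bound: "degree p \<le> N \<Longrightarrow> poly_act A p v = (\<Sum>i\<le>N. coeff p i *s (((*v) A) ^^ i) v)"
  unfolding poly_act_def
  by (rule sum.mono_neutral_left) (auto simp: coeff_eq_0 not_le)

lemma power_apply_add: "(((*v) (A :: complex ^ 'n ^ 'n)) ^^ i) (v + w) = (((*v) A) ^^ i) v + (((*v) A) ^^ i) w"
  by (induction i) (auto simp: matrix_vector_right_distrib)

lemma power_apply_smult: "(((*v) (A :: complex ^ 'n ^ 'n)) ^^ i) (c *s v) = c *s (((*v) A) ^^ i) v"
  by (induction i) (auto simp: vector_scalar_commute)

lemma poly_act_linear_factor:
  "poly_act A ([:- l, 1:] * q) v = A *v poly_act A q v - l *s poly_act A q v"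
    "poly_act A ([:- l, 1:] * q) v = poly_act A q (A *v v - l *s v)"
proof -
  define N where "N = degree q"
  define E where "E i = (((*v) A) ^^ i) v" for i
  have E: "A *v E i = E (Suc i)" for i by (simp add: E_def)
  have E': "(((*v) A) ^^ i) (A *v v) = E (Suc i)" for i by (simp add: E_def funpow_swap1)
  have c: "coeff ([:- l, 1:] * q) i = coeff (pCons 0 q) i - l * coeff q i" for i by simp
  have "degree ([:- l, 1:] * q) \<le> Suc N"
    using degree_mult_le[of "[:- l, 1:]" q] by (simp add: N_def)
  then have "poly_act A ([:- l, 1:] * q) v = (\<Sum>i\<le>Suc N. coeff ([:- l, 1:] * q) i *s E i)"
    unfolding E_def by (rule poly_act_bound)
  also have "\<dots> = (\<Sum>i\<le>Suc N. coeff (pCons 0 q) i *s E i) - l *s (\<Sum>i\<le>Suc N. coeff q i *s E i)"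
    unfolding c by (simp only: vector_sub_rdistrib sum_subtractf vec.scale_sum_right vector_smult_assoc)
  also have "(\<Sum>i\<le>Suc N. coeff q i *s E i) = poly_act A q v"
    unfolding E_def by (rule poly_act_bound[symmetric]) (simp add: N_def)
  also have "(\<Sum>i\<le>Suc N. coeff (pCons 0 q) i *s E i) = (\<Sum>i\<le>N. coeff q i *s E (Suc i))"
    by (simp add: sum.atMost_Suc_shift del: sum.atMost_Suc)
  finally have *: "poly_act A ([:- l, 1:] * q) v = (\<Sum>i\<le>N. coeff q i *s E (Suc i)) - l *s poly_act A q v" .
  have "(\<Sum>i\<le>N. coeff q i *s E (Suc i)) = A *v poly_act A q v"
    by (simp add: poly_act_def N_def E_def[symmetric] matrix_vector_mult_sum_right vector_scalar_commute E)
  with * show "poly_act A ([:- l, 1:] * q) v = A *v poly_act A q v - l *s poly_act A q v" by simp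
  have "poly_act A q (A *v v - l *s v) = (\<Sum>i\<le>N. coeff q i *s (((*v) A) ^^ i) (A *v v + (- l) *s v))"
    by (simp add: poly_act_def N_def)
  also have "\<dots> = (\<Sum>i\<le>N. coeff q i *s E (Suc i) - l *s (coeff q i *s E i))"
    by (simp only: power_apply_add power_apply_smult E' E_def[symmetric]) (simp add: vector_add_ldistrib vector_smult_assoc mult.commute)
  also have "\<dots> = (\<Sum>i\<le>N. coeff q i *s E (Suc i)) - l *s poly_act A q v"
    by (simp add: sum_subtractf vec.scale_sum_right poly_act_def N_def E_def)
  finally show "poly_act A ([:- l, 1:] * q) v = poly_act A q (A *v v - l *s v)" using * by simp
qed

text \<open>
  A contraction with a vanishing perturbation.
\<close>

lemma tendsto_0_of_recurrence:
  fixes a b :: "nat \<Rightarrow> 'b::real_normed_vector"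
  assumes "norm l < 1" "b \<longlonglongrightarrow> 0" "\<And>n. norm (a (Suc n)) \<le> norm (l::complex) * norm (a n) + norm (b n)"
  shows "a \<longlonglongrightarrow> 0"
proof -
  define r where "r = norm l"
  have r: "0 \<le> r" "r < 1" using assms by (auto simp: r_def)
  show ?thesis
  proof (rule LIMSEQ_I)
    fix e :: real assume "e > 0"
    \<comment> \<open>the perturbation that keeps the bound \<open>e / 2\<close> invariant under the recurrence\<close>
    define \<delta> where "\<delta> = e / 2 * (1 - r)"
    have "\<delta> > 0" using r \<open>e > 0\<close> by (simp add: \<delta>_def)
    then obtain N where N: "\<And>n. n \<ge> N \<Longrightarrow> norm (b n) < \<delta>"
      using LIMSEQ_D[OF assms(2)] by auto
    have bd: "norm (a (N + k)) \<le> r ^ k * norm (a N) + e / 2" for k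
    proof (induction k)
      case 0 then show ?case using \<open>e > 0\<close> by simp
    next
      case (Suc k)
      have "norm (a (N + Suc k)) \<le> r * norm (a (N + k)) + norm (b (N + k))"
        using assms(3)[of "N + k"] by (simp add: r_def)
      also have "\<dots> \<le> r * (r ^ k * norm (a N) + e / 2) + \<delta>"
        using Suc r N[of "N + k"] by (intro add_mono mult_left_mono) auto
      also have "\<dots> = r ^ Suc k * norm (a N) + e / 2"
        by (simp add: \<delta>_def field_simps)
      finally show ?case .
    qed
    have "(\<lambda>k. r ^ k * norm (a N)) \<longlonglongrightarrow> 0 * norm (a N)"
      using r by (intro tendsto_mult LIMSEQ_power_zero tendsto_const) auto
    then have rlim: "(\<lambda>k. r ^ k * norm (a N)) \<longlonglongrightarrow> 0" by simp
    then obtain K where K: "\<And>k. k \<ge> K \<Longrightarrow> norm (r ^ k * norm (a N)) < e / 2"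
      using LIMSEQ_D[OF rlim, of "e/2"] \<open>e > 0\<close> by (auto simp del: norm_mult)
    show "\<exists>no. \<forall>n\<ge>no. norm (a n - 0) < e"
    proof (intro exI allI impI)
      fix n assume "n \<ge> N + K"
      then have "n = N + (n - N)" "n - N \<ge> K" by auto
      then show "norm (a n - 0) < e" using bd[of "n - N"] K[of "n - N"] r by auto
    qed
  qed
qed

text \<open>
  By induction on the degree of a polynomial that annihilates \<open>v\<close>. Split off a root \<open>l\<close> as
  \<open>p = (X - l) q\<close>. If \<open>q(A) v = 0\<close> the degree drops. Otherwise \<open>q(A) v\<close> is an eigenvector, so
  \<open>\<bar>l\<bar> < 1\<close>; the induction hypothesis applies to \<open>A v - l v\<close>, and the powers applied to \<open>v\<close> satisfy a
  contracting recurrence.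
\<close>

lemma power_apply_tendsto_0:
  fixes A :: "complex ^ 'n ^ 'n"
  assumes ev: "\<And>c. eigenvalue A c \<Longrightarrow> cmod c < 1"
    and p: "p \<noteq> 0" "poly_act A p v = 0"
  shows "(\<lambda>n. (((*v) A) ^^ n) v) \<longlonglongrightarrow> 0"
  using p
proof (induction "degree p" arbitrary: p v)
  case 0
  then obtain c where "p = [:c:]" by (metis degree_eq_zeroE)
  with 0 have "c \<noteq> 0" "c *s v = 0" by (auto simp: poly_act_def)
  then have "v = 0" by simp
  moreover have "(((*v) A) ^^ n) 0 = 0" for n by (induction n) auto
  ultimately show ?case by simp
next
  case (Suc n)
  then have "\<not> constant (poly p)" by (simp add: constant_degree)
  then obtain l where "poly p l = 0" using fundamental_theorem_of_algebra by blast
  then obtain q where q: "p = [:- l, 1:] * q" by (metis poly_eq_0_iff_dvd dvd_def)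
  with Suc have "q \<noteq> 0" by auto
  then have "degree p = Suc (degree q)" unfolding q by (subst degree_mult_eq) auto
  with Suc have deg: "n = degree q" by simp
  show ?case
  proof (cases "poly_act A q v = 0")
    case True
    show ?thesis by (rule Suc.hyps(1)[OF deg \<open>q \<noteq> 0\<close> True])
  next
    case False
    have "A *v poly_act A q v = l *s poly_act A q v"
      using Suc.prems poly_act_linear_factor(1)[of A l q v] by (simp add: q)
    then have "cmod l < 1" using ev False by (auto simp: eigenvalue_def)
    have "poly_act A q (A *v v - l *s v) = 0"
      using Suc.prems poly_act_linear_factor(2)[of A l q v] by (simp add: q)
    from Suc.hyps(1)[OF deg \<open>q \<noteq> 0\<close> this]
    have lim: "(\<lambda>n. (((*v) A) ^^ n) (A *v v - l *s v)) \<longlonglongrightarrow> 0" .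
    show ?thesis
    proof (rule tendsto_0_of_recurrence[OF \<open>cmod l < 1\<close> lim])
      fix n
      have "(((*v) A) ^^ n) (A *v v - l *s v) = (((*v) A) ^^ n) (A *v v + (- l) *s v)" by simp
      also have "\<dots> = (((*v) A) ^^ Suc n) v - l *s (((*v) A) ^^ n) v"
        unfolding power_apply_add power_apply_smult by (simp add: funpow_swap1)
      finally have "(((*v) A) ^^ Suc n) v = l *s (((*v) A) ^^ n) v + (((*v) A) ^^ n) (A *v v - l *s v)"
        by simp
      moreover have "norm (l *s w) = cmod l * norm w" for w :: "complex ^ 'n"
        by (simp add: norm_vec_def L2_set_def norm_mult power_mult_distrib sum_distrib_left[symmetric] real_sqrt_mult)
      ultimately show "norm ((((*v) A) ^^ Suc n) v) \<le> cmod l * norm ((((*v) A) ^^ n) v) + norm ((((*v) A) ^^ n) (A *v v - l *s v))"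
        by (metis norm_triangle_ineq)
    qed
  qed
qed

text \<open>
  Among more iterates than the dimension there is a linear relation.
\<close>

lemma exists_annihilating_poly:
  fixes A :: "complex ^ 'n ^ 'n"
  shows "\<exists>p. p \<noteq> 0 \<and> poly_act A p v = 0"
proof -
  define E where "E i = (((*v) A) ^^ i) v" for i
  define N where "N = DIM(complex ^ 'n)"
  obtain c where c: "\<exists>i\<le>N. c i \<noteq> (0::real)" "(\<Sum>i\<le>N. c i *\<^sub>R E i) = 0"
  proof (cases "inj_on E {..N}")
    case True
    have "dependent (E ` {..N})"
      by (rule dependent_biggerset) (metis N_def card_image[OF True] card_atMost lessI)
    then obtain u w where u: "w \<in> E ` {..N}" "u w \<noteq> 0" "(\<Sum>x\<in>E ` {..N}. u x *\<^sub>R x) = 0"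
      using dependent_finite[of "E ` {..N}"] by auto
    then have "(\<Sum>i\<le>N. u (E i) *\<^sub>R E i) = 0" by (simp add: sum.reindex[OF True])
    then show thesis using u that[of "\<lambda>i. u (E i)"] by auto
  next
    case False
    then obtain i j where ij: "i \<le> N" "j \<le> N" "i \<noteq> j" "E i = E j" by (auto simp: inj_on_def)
    have "(\<Sum>k\<le>N. ((if k = i then 1 else 0) - (if k = j then 1 else (0::real))) *\<^sub>R E k)
        = (\<Sum>k\<le>N. if k = i then E k else 0) - (\<Sum>k\<le>N. if k = j then E k else 0)"
      unfolding sum_subtractf[symmetric] by (intro sum.cong) auto
    also have "\<dots> = 0" using ij by simp
    finally show thesis using ij by (intro that) auto
  qed
  define p where "p = (\<Sum>i\<le>N. monom (complex_of_real (c i)) i)"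
  have cf: "coeff p k = (if k \<le> N then complex_of_real (c k) else 0)" for k
    by (simp add: p_def coeff_sum)
  have "p \<noteq> 0" using c(1) cf by (metis coeff_0 of_real_eq_0_iff)
  have "degree p \<le> N" by (rule degree_le) (simp add: cf)
  then have "poly_act A p v = (\<Sum>i\<le>N. coeff p i *s E i)" unfolding E_def by (rule poly_act_bound)
  also have "\<dots> = (\<Sum>i\<le>N. c i *\<^sub>R E i)"
    by (intro sum.cong) (auto simp: cf vec_eq_iff scaleR_conv_of_real[where 'a=complex])
  finally show ?thesis using c(2) \<open>p \<noteq> 0\<close> by metis
qed

text \<open>
  Expansiveness refers to complex eigenvalues, hence the passage to complex vectors and matrices.
\<close>

definition cvec :: "real ^ 'n \<Rightarrow> complex ^ 'n" where "cvec x = (\<chi> i. complex_of_real (x $ i))"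
definition cmat :: "real ^ 'n ^ 'm \<Rightarrow> complex ^ 'n ^ 'm" where "cmat A = (\<chi> i j. complex_of_real (A $ i $ j))"

lemma cmat_mult_cvec: "cmat A *v cvec x = cvec (A *v x)"
  by (simp add: cmat_def cvec_def matrix_vector_mult_def vec_eq_iff)

lemma cmat_mult: "cmat A ** cmat B = cmat (A ** B)"
  by (simp add: cmat_def matrix_matrix_mult_def vec_eq_iff)

lemma cmat_1: "cmat (mat 1) = mat 1"
  by (simp add: cmat_def mat_def vec_eq_iff)

lemma matrix_inv_inverse:
  assumes "invertible A" shows "A ** matrix_inv A = mat 1" "matrix_inv A ** A = mat 1"
  using someI_ex[OF assms[unfolded invertible_def]] unfolding matrix_inv_def by auto

lemma expansive_invertible:
  assumes "expansive M" shows "invertible M"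
proof -
  have "x = 0" if "M *v x = 0" for x
  proof (rule ccontr)
    assume "x \<noteq> 0"
    have "cmat M *v cvec x = 0 *s cvec x"
      by (simp add: cmat_mult_cvec that) (simp add: cvec_def vec_eq_iff)
    moreover have "cvec x \<noteq> 0" using \<open>x \<noteq> 0\<close> by (auto simp: cvec_def vec_eq_iff)
    ultimately have "eigenvalue (cmat M) 0" by (auto simp: eigenvalue_def)
    then show False using assms by (force simp: expansive_def cmat_def)
  qed
  then have "\<exists>B. B ** M = mat 1" by (simp add: matrix_left_invertible_ker)
  then show ?thesis by (simp add: invertible_left_inverse)
qed

lemma power_matrix_inv_tendsto_0:
  assumes "expansive M"
  shows "(\<lambda>n. (((*v) (matrix_inv M)) ^^ n) x) \<longlonglongrightarrow> 0"
proof -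
  let ?A = "matrix_inv M"
  have MA: "M ** ?A = mat 1" using matrix_inv_inverse(1)[OF expansive_invertible[OF assms]] .
  have ev: "cmod c < 1" if "eigenvalue (cmat ?A) c" for c
  proof -
    from that obtain v where v: "v \<noteq> 0" "cmat ?A *v v = c *s v" by (auto simp: eigenvalue_def)
    have "v = cmat M *v (cmat ?A *v v)" by (simp add: matrix_vector_mul_assoc cmat_mult MA cmat_1)
    also have "\<dots> = c *s (cmat M *v v)" by (simp add: v(2) vector_scalar_commute)
    finally have *: "v = c *s (cmat M *v v)" .
    with v(1) have "c \<noteq> 0" by auto
    then have "cmat M *v v = (1 / c) *s v" using * by (metis vector_smult_assoc nonzero_eq_divide_eq mult.commute vector_smult_lid)
    then have "eigenvalue (cmat M) (1 / c)" using v(1) by (auto simp: eigenvalue_def)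
    then have "cmod (1 / c) > 1" using assms by (simp add: expansive_def cmat_def)
    then show ?thesis using \<open>c \<noteq> 0\<close> by (simp add: norm_divide field_simps)
  qed
  obtain p where "p \<noteq> 0" "poly_act (cmat ?A) p (cvec x) = 0" using exists_annihilating_poly by blast
  from power_apply_tendsto_0[OF ev this]
  have "(\<lambda>n. (((*v) (cmat ?A)) ^^ n) (cvec x)) \<longlonglongrightarrow> 0" .
  moreover have "(((*v) (cmat ?A)) ^^ n) (cvec x) = cvec ((((*v) ?A) ^^ n) x)" for n
    by (induction n) (auto simp: cmat_mult_cvec)
  ultimately have lim: "(\<lambda>n. cvec ((((*v) ?A) ^^ n) x)) \<longlonglongrightarrow> 0" by simp
  show ?thesis
  proof (rule vec_tendstoI)
    fix i
    have "(\<lambda>n. Re (cvec ((((*v) ?A) ^^ n) x) $ i)) \<longlonglongrightarrow> Re (0 $ i)"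
      by (intro tendsto_Re tendsto_vec_nth lim)
    then show "(\<lambda>n. (((*v) ?A) ^^ n) x $ i) \<longlonglongrightarrow> 0 $ i" by (simp add: cvec_def)
  qed
qed

lemma power_transpose_matrix_inv_tendsto_0:
  assumes "expansive (M :: real ^ 'n ^ 'n)"
  shows "(\<lambda>n. (((*v) (transpose (matrix_inv M))) ^^ n) x) \<longlonglongrightarrow> 0"
proof (rule vec_tendstoI)
  let ?A = "matrix_inv M"
  fix i :: 'n
  have adj: "(((*v) (transpose ?A)) ^^ n) x \<bullet> y = x \<bullet> (((*v) ?A) ^^ n) y" for n y
  proof (induction n arbitrary: y)
    case (Suc n)
    have "(((*v) (transpose ?A)) ^^ Suc n) x \<bullet> y = (((*v) (transpose ?A)) ^^ n) x \<bullet> (?A *v y)"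
      by (simp add: transpose_matrix_vector dot_lmul_matrix)
    also have "\<dots> = x \<bullet> (((*v) ?A) ^^ Suc n) y"
      unfolding Suc by (simp only: funpow_Suc_right o_apply)
    finally show ?case .
  qed simp
  have eq: "(((*v) (transpose ?A)) ^^ n) x $ i = x \<bullet> (((*v) ?A) ^^ n) (axis i 1)" for n
    by (simp add: inner_axis flip: adj)
  have "(\<lambda>n. x \<bullet> (((*v) ?A) ^^ n) (axis i 1)) \<longlonglongrightarrow> x \<bullet> 0"
    by (intro tendsto_intros power_matrix_inv_tendsto_0 assms)
  then show "(\<lambda>n. (((*v) (transpose ?A)) ^^ n) x $ i) \<longlonglongrightarrow> 0 $ i" by (simp add: eq)
qed

lemma linear_funpow: "linear (T :: 'a::real_vector \<Rightarrow> 'a) \<Longrightarrow> linear (T ^^ n)"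
proof (induction n)
  case 0 show ?case using linear_ident by (simp add: id_def)
next
  case (Suc n)
  then have "linear (T \<circ> (T ^^ n))" by (intro linear_compose) auto
  then show ?case by (simp only: funpow.simps(2))
qed

lemma power_contraction:
  fixes T :: "real ^ 'n \<Rightarrow> real ^ 'n"
  assumes lin: "linear T" and lim: "\<And>x. (\<lambda>n. (T ^^ n) x) \<longlonglongrightarrow> 0"
  shows "\<exists>N>0. \<forall>x. norm ((T ^^ N) x) \<le> norm x / 2"
proof -
  have linN: "linear (T ^^ n)" for n
    by (rule linear_funpow[OF lin])
  have "(\<lambda>n. \<Sum>b\<in>Basis. norm ((T ^^ n) b)) \<longlonglongrightarrow> (\<Sum>b\<in>(Basis :: (real ^ 'n) set). norm (0 :: real ^ 'n))"
    by (intro tendsto_sum tendsto_norm lim)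
  then have slim: "(\<lambda>n. \<Sum>b\<in>Basis. norm ((T ^^ n) b)) \<longlonglongrightarrow> 0" by simp
  then obtain N0 where N0: "\<And>n. n \<ge> N0 \<Longrightarrow> norm (\<Sum>b\<in>Basis. norm ((T ^^ n) b)) < 1 / 2"
    using LIMSEQ_D[OF slim, of "1/2"] by auto
  have "norm ((T ^^ Suc N0) x) \<le> norm x / 2" for x
  proof -
    have "(T ^^ Suc N0) x = (T ^^ Suc N0) (\<Sum>b\<in>Basis. (x \<bullet> b) *\<^sub>R b)" by (simp add: euclidean_representation)
    also have "\<dots> = (\<Sum>b\<in>Basis. (x \<bullet> b) *\<^sub>R (T ^^ Suc N0) b)"
      using linN[of "Suc N0"] by (simp only: linear_sum linear_scale)
    finally have "norm ((T ^^ Suc N0) x) \<le> (\<Sum>b\<in>Basis. norm ((x \<bullet> b) *\<^sub>R (T ^^ Suc N0) b))"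
      by (metis norm_sum)
    also have "\<dots> \<le> (\<Sum>b\<in>Basis. norm x * norm ((T ^^ Suc N0) b))"
      by (intro sum_mono) (auto intro!: mult_right_mono Basis_le_norm)
    also have "\<dots> = norm x * (\<Sum>b\<in>Basis. norm ((T ^^ Suc N0) b))" by (simp add: sum_distrib_left)
    also have "\<dots> \<le> norm x * (1 / 2)"
      using N0[of "Suc N0"] by (intro mult_left_mono) (auto simp: sum_nonneg)
    finally show ?thesis by simp
  qed
  then show ?thesis by blast
qed

text \<open>
  If \<open>T\<^sup>N\<close> halves the norm, then the sum of the squared norms of \<open>T\<^sup>n x\<close> over \<open>n < N\<close> drops by at
  least \<open>3 / 4\<close> of the squared norm of \<open>x\<close> when \<open>x\<close> is replaced by \<open>T x\<close>. This is a fixed fraction of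
  the sum, since the sum is bounded by a multiple of the squared norm.
\<close>

lemma lyapunov_form:
  fixes T :: "real ^ 'n \<Rightarrow> real ^ 'n"
  assumes lin: "linear T" and lim: "\<And>x. (\<lambda>n. (T ^^ n) x) \<longlonglongrightarrow> 0"
  obtains N \<rho> where "0 < \<rho>" "\<rho> < 1"
    "\<And>x. (\<Sum>n<N. (norm ((T ^^ n) (T x)))\<^sup>2) \<le> \<rho> * (\<Sum>n<N. (norm ((T ^^ n) x))\<^sup>2)"
    "\<And>x. (norm x)\<^sup>2 \<le> (\<Sum>n<N. (norm ((T ^^ n) x))\<^sup>2)"
proof -
  obtain N where N: "N > 0" "\<And>x. norm ((T ^^ N) x) \<le> norm x / 2"
    using power_contraction[OF lin lim] by blast
  define Q where "Q x = (\<Sum>n<N. (norm ((T ^^ n) x))\<^sup>2)" for x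
  have linN: "linear (T ^^ n)" for n
    by (rule linear_funpow[OF lin])
  then obtain K where K: "\<And>n. K n > 0" "\<And>n x. norm ((T ^^ n) x) \<le> norm x * K n"
    using bounded_linear.pos_bounded[OF linear_conv_bounded_linear[THEN iffD1, OF linN]] by metis
  \<comment> \<open>the summand one only serves to make \<open>C\<close> at least one and \<open>\<rho>\<close> positive\<close>
  define C where "C = 1 + (\<Sum>n<N. (K n)\<^sup>2)"
  have C: "C \<ge> 1" by (simp add: C_def sum_nonneg)
  have QC: "Q x \<le> C * (norm x)\<^sup>2" for x
  proof -
    have "Q x \<le> (\<Sum>n<N. (K n)\<^sup>2 * (norm x)\<^sup>2)"
      unfolding Q_def using K(2) by (intro sum_mono) (metis mult.commute norm_ge_zero power_mono power_mult_distrib)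
    then have "Q x \<le> (\<Sum>n<N. (K n)\<^sup>2) * (norm x)\<^sup>2" by (simp add: sum_distrib_right)
    also have "\<dots> \<le> C * (norm x)\<^sup>2" by (intro mult_right_mono) (auto simp: C_def)
    finally show ?thesis .
  qed
  have QT: "Q (T x) = Q x - (norm x)\<^sup>2 + (norm ((T ^^ N) x))\<^sup>2" for x
  proof -
    have "Q x + (norm ((T ^^ N) x))\<^sup>2 = (\<Sum>n<Suc N. (norm ((T ^^ n) x))\<^sup>2)" by (simp add: Q_def)
    also have "\<dots> = (norm x)\<^sup>2 + (\<Sum>n<N. (norm ((T ^^ Suc n) x))\<^sup>2)"
      by (subst sum.lessThan_Suc_shift) simp
    also have "(\<Sum>n<N. (norm ((T ^^ Suc n) x))\<^sup>2) = Q (T x)" by (simp add: Q_def funpow_swap1)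
    finally show ?thesis by simp
  qed
  have lower: "(norm x)\<^sup>2 \<le> Q x" for x
    unfolding Q_def using member_le_sum[of 0 "{..<N}" "\<lambda>n. (norm ((T ^^ n) x))\<^sup>2"] N(1) by auto
  define \<rho> where "\<rho> = 1 - 3 / (4 * C)"
  have "0 < \<rho>" "\<rho> < 1" using C by (auto simp: \<rho>_def field_simps)
  moreover have "Q (T x) \<le> \<rho> * Q x" for x
  proof -
    have "(norm ((T ^^ N) x))\<^sup>2 \<le> (norm x / 2)\<^sup>2" by (intro power_mono N(2)) auto
    then have "Q (T x) \<le> Q x - 3 / 4 * (norm x)\<^sup>2" using QT[of x] by (simp add: power_divide)
    also have "\<dots> \<le> Q x - 3 / 4 * (Q x / C)" using QC[of x] C by (simp add: field_simps)
    also have "\<dots> = \<rho> * Q x" using C by (simp add: \<rho>_def field_simps)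
    finally show ?thesis .
  qed
  ultimately show thesis using that[of \<rho> N] lower by (simp add: Q_def)
qed

section \<open>Tight frames from partitions of unity in frequency\<close>

(* The default simp rule turns the transpose times x into x v* A, which hides the dual dilation. *)
declare transpose_matrix_vector [simp del]

lemma matrix_inv_transpose:
  fixes U :: "real ^ 'd ^ 'd"
  assumes "det U \<noteq> 0"
  shows "transpose (matrix_inv U) *v (transpose U *v x) = x" "transpose U *v (transpose (matrix_inv U) *v x) = x"
proof -
  have i: "invertible U" using assms by (simp add: invertible_det_nz)
  have "transpose (matrix_inv U) ** transpose U = mat 1" "transpose U ** transpose (matrix_inv U) = mat 1"
    by (simp_all add: matrix_transpose_mul[symmetric] matrix_inv_inverse[OF i] transpose_mat)
  then show "transpose (matrix_inv U) *v (transpose U *v x) = x" "transpose U *v (transpose (matrix_inv U) *v x) = x"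
    by (simp_all add: matrix_vector_mul_assoc)
qed

lemma chr_diff: "chr (k - l) x = chr k x * cnj (chr l x)"
  unfolding chr_minus[symmetric] chr_add[symmetric] by simp

lemma chr_matrix: "chr (U *v x) \<xi> = chr (transpose U *v \<xi>) x"
proof -
  have "(U *v x) \<bullet> \<xi> = (transpose U *v \<xi>) \<bullet> x"
    by (simp only: transpose_matrix_vector dot_lmul_matrix) (rule inner_commute)
  then show ?thesis by (simp add: chr_def)
qed

lemma ift_continuous: "cont_cs G \<Longrightarrow> continuous_on UNIV (ift G)"
  using has_partials_imp_differentiable[OF ift_has_partials] by (rule differentiable_imp_continuous_on)

text \<open>
  Inserting the integral for \<open>ift G\<close> and exchanging the integrals exhibits the coefficient as a
  Fourier coefficient of \<open>G * cnj (fourier f \<circ> U\<^sup>T)\<close>. The modulus absorbs a conjugation.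
\<close>

lemma L2_inner_dilate_shift_ift:
  fixes f G :: "real ^ 'd \<Rightarrow> complex"
  assumes f: "cont_cs f" and G: "cont_cs G"
  shows "cmod (L2_inner f (dilate_shift U k (ift G))) = sqrt \<bar>det U\<bar> / (2 * pi) ^ CARD('d) *
    cmod (LINT \<xi>|lborel. (G \<xi> * cnj (fourier f (transpose U *v \<xi>))) * cnj (chr k \<xi>))"
proof -
  let ?w = "(2 * pi) ^ CARD('d)"
  note [measurable] = cont_cs_measurable[OF f] cont_cs_measurable[OF G] borel_measurable_continuous_onI[OF ift_continuous[OF G]]
  have [measurable]: "(\<lambda>x. cnj (ift G (U *v x - k))) \<in> borel_measurable borel"
    by (intro borel_measurable_continuous_onI continuous_intros continuous_on_compose2[OF ift_continuous[OF G]]) auto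
  have "L2_inner f (dilate_shift U k (ift G)) = (LINT x|lebesgue. complex_of_real (sqrt \<bar>det U\<bar>) * (f x * cnj (ift G (U *v x - k))))"
    by (simp add: L2_inner_def dilate_shift_def mult_ac)
  also have "\<dots> = (LINT x|lborel. complex_of_real (sqrt \<bar>det U\<bar>) * (f x * cnj (ift G (U *v x - k))))"
    by (rule integral_completion) simp
  also have "\<dots> = complex_of_real (sqrt \<bar>det U\<bar>) * (LINT x|lborel. f x * cnj (ift G (U *v x - k)))"
    by simp
  also have "(LINT x|lborel. f x * cnj (ift G (U *v x - k)))
    = (LINT x|lborel. LINT \<xi>|lborel. f x * cnj (G \<xi>) * cnj (chr (U *v x - k) \<xi>)) / ?w"
  proof -
    have "f x * cnj (ift G (U *v x - k)) = (LINT \<xi>|lborel. f x * cnj (G \<xi>) * cnj (chr (U *v x - k) \<xi>)) / ?w" for x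
    proof -
      have "cnj (LINT \<xi>|lborel. G \<xi> * chr (U *v x - k) \<xi>) = (LINT \<xi>|lborel. cnj (G \<xi>) * cnj (chr (U *v x - k) \<xi>))"
        unfolding Bochner_Integration.integral_cnj[symmetric] by simp
      then show ?thesis by (simp add: ift_def mult.assoc)
    qed
    then show ?thesis by simp
  qed
  also have "(LINT x|lborel. LINT \<xi>|lborel. f x * cnj (G \<xi>) * cnj (chr (U *v x - k) \<xi>))
    = (LINT \<xi>|lborel. LINT x|lborel. f x * cnj (G \<xi>) * cnj (chr (U *v x - k) \<xi>))"
  proof (rule fubini_kernel[symmetric, OF cont_cs_integrable[OF f] cont_cs_integrable[OF cont_cs_cnj[OF G]]])
    show "continuous_on UNIV (\<lambda>(x, \<xi>). cnj (chr (U *v x - k) \<xi>))"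
      unfolding case_prod_beta' by (intro continuous_intros continuous_on_compose2[of UNIV "\<lambda>x. U *v x"]) auto
  qed simp
  also have "\<dots> = (LINT \<xi>|lborel. cnj ((G \<xi> * cnj (fourier f (transpose U *v \<xi>))) * cnj (chr k \<xi>)))"
  proof (rule Bochner_Integration.integral_cong[OF refl])
    fix \<xi>
    have "f x * cnj (G \<xi>) * cnj (chr (U *v x - k) \<xi>) = (cnj (G \<xi>) * chr k \<xi>) * (f x * cnj (chr (transpose U *v \<xi>) x))" for x
      by (simp only: chr_diff complex_cnj_mult complex_cnj_cnj chr_matrix[of U x \<xi>] mult_ac)
    then have "(LINT x|lborel. f x * cnj (G \<xi>) * cnj (chr (U *v x - k) \<xi>)) = (cnj (G \<xi>) * chr k \<xi>) * fourier f (transpose U *v \<xi>)"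
      by (simp only: fourier_lborel[OF cont_cs_measurable[OF f]] integral_mult_right_zero)
    then show "(LINT x|lborel. f x * cnj (G \<xi>) * cnj (chr (U *v x - k) \<xi>)) = cnj ((G \<xi> * cnj (fourier f (transpose U *v \<xi>))) * cnj (chr k \<xi>))"
      by (simp add: mult_ac)
  qed
  also have "\<dots> = cnj (LINT \<xi>|lborel. (G \<xi> * cnj (fourier f (transpose U *v \<xi>))) * cnj (chr k \<xi>))"
    by (rule Bochner_Integration.integral_cnj)
  finally show ?thesis by (simp only: norm_mult norm_divide norm_of_real complex_mod_cnj norm_power) (simp add: norm_mult norm_power)
qed

text \<open>
  As \<open>G\<close> is supported in the unit ball, Parseval's identity sums the Fourier coefficients without
  overlap. Changing variables by the transpose of \<open>U\<close> cancels the determinant.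
\<close>

lemma level_energy_ift:
  fixes f G :: "real ^ 'd \<Rightarrow> complex"
  assumes f: "cont_cs f" and G: "cont_cs G" and supp: "\<And>\<xi>. G \<xi> \<noteq> 0 \<Longrightarrow> norm \<xi> \<le> 1" and U: "det U \<noteq> 0"
  shows "level_energy (ift G) U f = (\<integral>\<^sup>+\<eta>. ennreal ((cmod (G (transpose (matrix_inv U) *v \<eta>)))\<^sup>2)
    * ennreal ((cmod (fourier f \<eta>))\<^sup>2 / (2 * pi) ^ CARD('d)) \<partial>lborel)"
proof -
  define w where "w = (2 * pi) ^ CARD('d)"
  have w: "w > 0" by (simp add: w_def)
  let ?F = "\<lambda>\<xi>. G \<xi> * cnj (fourier f (transpose U *v \<xi>))"
  let ?b = "\<bar>det U\<bar> / w\<^sup>2"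
  have cf: "continuous_on UNIV (fourier f)" by (intro fourier_continuous cont_cs_integrable f)
  have cG: "continuous_on UNIV G" using G by (simp add: cont_cs_def)
  have cF: "continuous_on UNIV ?F"
    by (intro continuous_intros cG continuous_on_compose2[OF cf]) auto
  have csF: "cont_cs ?F" using G by (intro cont_cs_mult G continuous_intros continuous_on_compose2[OF cf]) auto
  have sF: "\<bar>\<xi> $ i\<bar> \<le> 1" if "?F \<xi> \<noteq> 0" for \<xi> i
  proof -
    have "norm \<xi> \<le> 1" using that by (intro supp) auto
    then show ?thesis using component_le_norm_cart[of \<xi> i] by simp
  qed
  have summand: "ennreal ((cmod (L2_inner f (dilate_shift U k (ift G))))\<^sup>2)
     = ennreal ?b * ennreal ((cmod (LINT \<xi>|lborel. ?F \<xi> * cnj (chr k \<xi>)))\<^sup>2)" for k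
    unfolding L2_inner_dilate_shift_ift[OF f G] w_def[symmetric]
    by (subst ennreal_mult[symmetric]) (auto simp: power_mult_distrib power_divide real_sqrt_pow2)
  have "level_energy (ift G) U f = ennreal ?b * (\<Sum>\<^sub>\<infinity>k\<in>int_lattice. ennreal ((cmod (LINT \<xi>|lborel. ?F \<xi> * cnj (chr k \<xi>)))\<^sup>2))"
    unfolding level_energy_def infsum_ennreal_eq_nn_integral[OF countable_int_lattice] summand
    by (rule nn_integral_cmult) simp
  also have "\<dots> = ennreal ?b * ennreal (w * (LINT \<xi>|lborel. (cmod (?F \<xi>))\<^sup>2))"
    unfolding w_def by (subst parseval_torus[OF cF sF]) auto
  also have "\<dots> = ennreal \<bar>det U\<bar> * ennreal ((LINT \<xi>|lborel. (cmod (?F \<xi>))\<^sup>2 / w))"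
    using w by (simp add: ennreal_mult[symmetric] power2_eq_square)
  also have "ennreal ((LINT \<xi>|lborel. (cmod (?F \<xi>))\<^sup>2 / w)) = (\<integral>\<^sup>+\<xi>. ennreal ((cmod (?F \<xi>))\<^sup>2 / w) \<partial>lborel)"
    using cont_cs_norm_square_integrable[OF csF] w by (intro nn_integral_eq_integral[symmetric]) auto
  also have "\<dots> = (\<integral>\<^sup>+\<xi>. ennreal ((cmod (G (transpose (matrix_inv U) *v (transpose U *v \<xi>))))\<^sup>2)
    * ennreal ((cmod (fourier f (transpose U *v \<xi>)))\<^sup>2 / w) \<partial>lborel)"
    using w by (simp add: matrix_inv_transpose[OF U] ennreal_mult[symmetric] norm_mult power_mult_distrib)
  also have "ennreal \<bar>det U\<bar> * \<dots> = (\<integral>\<^sup>+\<eta>. ennreal ((cmod (G (transpose (matrix_inv U) *v \<eta>)))\<^sup>2)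
    * ennreal ((cmod (fourier f \<eta>))\<^sup>2 / w) \<partial>lborel)"
  proof -
    have [measurable]: "G \<in> borel_measurable borel" "fourier f \<in> borel_measurable borel"
      using cG cf by (auto intro: borel_measurable_continuous_onI)
    show ?thesis
      using nn_integral_lborel_linear[of "\<lambda>\<eta>. ennreal ((cmod (G (transpose (matrix_inv U) *v \<eta>)))\<^sup>2) * ennreal ((cmod (fourier f \<eta>))\<^sup>2 / w)" "transpose U"]
        U by simp
  qed
  finally show ?thesis unfolding w_def .
qed

lemma dilate_shift_ift_L2:
  fixes G :: "real ^ 'd \<Rightarrow> complex"
  assumes G: "bump W G" and U: "det U \<noteq> 0"
  shows "dilate_shift U k (ift G) \<in> L2"
proof -
  have c: "continuous_on UNIV (ift G)" by (rule ift_continuous[OF bump_cs[OF G]])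
  obtain B where B: "\<And>x. cmod (ift G x) \<le> B" using ift_bounded[OF bump_cs[OF G]] by blast
  have ci: "continuous_on UNIV (\<lambda>x. complex_of_real ((cmod (ift G x))\<^sup>2))" by (intro continuous_intros c)
  have i: "integrable lborel (\<lambda>x. complex_of_real ((cmod (ift G x))\<^sup>2))"
  proof (rule Bochner_Integration.integrable_bound)
    show "integrable lborel (\<lambda>x. B * cmod (ift G x))" using ift_integrable[OF G] by auto
    show "AE x in lborel. norm (complex_of_real ((cmod (ift G x))\<^sup>2)) \<le> norm (B * cmod (ift G x))"
    proof (rule AE_I2)
      fix x
      have "cmod (ift G x) * cmod (ift G x) \<le> B * cmod (ift G x)" by (intro mult_right_mono B) simp
      then show "norm (complex_of_real ((cmod (ift G x))\<^sup>2)) \<le> norm (B * cmod (ift G x))"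
        by (simp add: power2_eq_square norm_mult)
    qed
  qed (use ci in \<open>simp add: borel_measurable_continuous_onI\<close>)
  have sub: "integrable lborel (\<lambda>x. complex_of_real ((cmod (ift G (x - k)))\<^sup>2))"
  proof -
    have "integrable (distr lborel borel ((+) (- k))) (\<lambda>x. complex_of_real ((cmod (ift G x))\<^sup>2))"
      using i by (simp add: lborel_distr_plus)
    then show ?thesis
      by (subst (asm) integrable_distr_eq) (use ci in \<open>auto simp: borel_measurable_continuous_onI\<close>)
  qed
  have "continuous_on UNIV (\<lambda>x. complex_of_real ((cmod (ift G (x - k)))\<^sup>2))"
    by (intro continuous_intros continuous_on_compose2[OF c]) auto
  then have "integrable lborel (\<lambda>x. complex_of_real ((cmod (ift G (U *v x - k)))\<^sup>2))"
    using sub integrable_lborel_linear_iff[OF U, of "\<lambda>x. complex_of_real ((cmod (ift G (x - k)))\<^sup>2)"]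
    by (simp add: borel_measurable_continuous_onI)
  then have "integrable lborel (\<lambda>x. Re (complex_of_real ((cmod (ift G (U *v x - k)))\<^sup>2)))"
    by (rule integrable_Re)
  then have ir: "integrable lborel (\<lambda>x. (cmod (dilate_shift U k (ift G) x))\<^sup>2)"
    by (simp add: dilate_shift_def norm_mult power_mult_distrib)
  have cd: "continuous_on UNIV (dilate_shift U k (ift G))"
    unfolding dilate_shift_def by (intro continuous_intros continuous_on_compose2[OF c]) auto
  then have m: "dilate_shift U k (ift G) \<in> borel_measurable borel" by (rule borel_measurable_continuous_onI)
  then have "integrable lebesgue (\<lambda>x. (cmod (dilate_shift U k (ift G) x))\<^sup>2)"
    using ir by (subst integrable_completion) auto
  moreover have "dilate_shift U k (ift G) \<in> borel_measurable lebesgue"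
    by (rule measurable_completion) (simp add: m)
  ultimately show ?thesis by (simp add: L2_def)
qed

text \<open>
  On the dense class of continuous functions of compact support the energies add up, by Tonelli's
  theorem, to the integral of \<open>\<bar>f^\<bar>\<^sup>2 / (2 \<pi>)\<^sup>d\<close> times the partition of unity. The origin may be
  exempted from the partition because it is a null set.
\<close>

theorem tight_frame_criterion:
  fixes G :: "'i \<Rightarrow> real ^ 'd \<Rightarrow> complex" and U :: "'i \<Rightarrow> real ^ 'd ^ 'd"
  assumes I: "countable I" and G: "\<And>i. i \<in> I \<Longrightarrow> bump (W i) (G i)"
    and supp: "\<And>i \<xi>. i \<in> I \<Longrightarrow> G i \<xi> \<noteq> 0 \<Longrightarrow> norm \<xi> \<le> 1"
    and U: "\<And>i. i \<in> I \<Longrightarrow> det (U i) \<noteq> 0"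
    and partition: "\<And>\<eta>. \<eta> \<noteq> 0 \<Longrightarrow> (\<Sum>\<^sub>\<infinity>i\<in>I. ennreal ((cmod (G i (transpose (matrix_inv (U i)) *v \<eta>)))\<^sup>2)) = 1"
    and f: "f \<in> L2"
  shows "(\<Sum>\<^sub>\<infinity>i\<in>I. level_energy (ift (G i)) (U i) f) = ennreal (L2_norm_sq f)"
proof -
  define \<gamma> where "\<gamma> i k = dilate_shift (U i) k (ift (G i))" for i k
  have E: "coefficient_energy I int_lattice \<gamma> g = (\<Sum>\<^sub>\<infinity>i\<in>I. level_energy (ift (G i)) (U i) g)" for g
    unfolding coefficient_energy_def level_energy_def \<gamma>_def infsum_ennreal_eq_nn_integral[OF I]
      infsum_ennreal_eq_nn_integral[OF countable_int_lattice] ..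
  have "coefficient_energy I int_lattice \<gamma> f = ennreal (L2_norm_sq f)"
  proof (rule tight_frame_of_dense[OF _ _ f])
    show "\<gamma> i k \<in> L2" if "i \<in> I" for i k
      unfolding \<gamma>_def by (rule dilate_shift_ift_L2[OF G[OF that] U[OF that]])
    fix g :: "real ^ 'd \<Rightarrow> complex" assume g: "cont_cs g"
    let ?w = "(2 * pi) ^ CARD('d)"
    let ?p = "\<lambda>i \<eta>. ennreal ((cmod (G i (transpose (matrix_inv (U i)) *v \<eta>)))\<^sup>2)"
    let ?q = "\<lambda>\<eta>. ennreal ((cmod (fourier g \<eta>))\<^sup>2 / ?w)"
    have mq [measurable]: "fourier g \<in> borel_measurable borel"
      by (intro borel_measurable_continuous_onI fourier_continuous cont_cs_integrable g)
    have mp: "?p i \<in> borel_measurable borel" if "i \<in> I" for i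
    proof -
      have [measurable]: "G i \<in> borel_measurable borel" by (rule cont_cs_measurable[OF bump_cs[OF G[OF that]]])
      show ?thesis by measurable
    qed
    have "coefficient_energy I int_lattice \<gamma> g = (\<integral>\<^sup>+i. level_energy (ift (G i)) (U i) g \<partial>count_space I)"
      unfolding E by (rule infsum_ennreal_eq_nn_integral[OF I])
    also have "\<dots> = (\<integral>\<^sup>+i. (\<integral>\<^sup>+\<eta>. ?p i \<eta> * ?q \<eta> \<partial>lborel) \<partial>count_space I)"
    proof (rule nn_integral_cong)
      fix i assume "i \<in> space (count_space I)"
      then have "i \<in> I" by simp
      then show "level_energy (ift (G i)) (U i) g = (\<integral>\<^sup>+\<eta>. ?p i \<eta> * ?q \<eta> \<partial>lborel)"
        by (intro level_energy_ift g bump_cs[OF G] supp U)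
    qed
    also have "\<dots> = (\<integral>\<^sup>+\<eta>. (\<integral>\<^sup>+i. ?p i \<eta> * ?q \<eta> \<partial>count_space I) \<partial>lborel)"
      using mp by (intro nn_integral_count_space_nn_integral[OF I, symmetric]) auto
    also have "\<dots> = (\<integral>\<^sup>+\<eta>. ?q \<eta> \<partial>lborel)"
    proof (rule nn_integral_cong_AE)
      have "AE \<eta> in lborel. \<eta> \<noteq> (0 :: real ^ 'd)" by (rule AE_lborel_singleton)
      then show "AE \<eta> in lborel. (\<integral>\<^sup>+i. ?p i \<eta> * ?q \<eta> \<partial>count_space I) = ?q \<eta>"
      proof eventually_elim
        fix \<eta> :: "real ^ 'd" assume "\<eta> \<noteq> 0"
        have "(\<integral>\<^sup>+i. ?p i \<eta> * ?q \<eta> \<partial>count_space I) = (\<integral>\<^sup>+i. ?p i \<eta> \<partial>count_space I) * ?q \<eta>"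
          by (rule nn_integral_multc) simp
        also have "(\<integral>\<^sup>+i. ?p i \<eta> \<partial>count_space I) = 1"
          using partition[OF \<open>\<eta> \<noteq> 0\<close>] by (simp only: infsum_ennreal_eq_nn_integral[OF I])
        finally show "(\<integral>\<^sup>+i. ?p i \<eta> * ?q \<eta> \<partial>count_space I) = ?q \<eta>" by simp
      qed
    qed
    also have "\<dots> = (\<integral>\<^sup>+\<eta>. ennreal (1 / ?w) * ennreal ((cmod (fourier g \<eta>))\<^sup>2) \<partial>lborel)"
      by (intro nn_integral_cong) (simp add: ennreal_mult[symmetric])
    also have "\<dots> = ennreal (1 / ?w) * (\<integral>\<^sup>+\<eta>. ennreal ((cmod (fourier g \<eta>))\<^sup>2) \<partial>lborel)"
      by (rule nn_integral_cmult) measurable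
    also have "\<dots> = ennreal (1 / ?w) * ennreal (?w * L2_norm_sq g)"
      by (simp only: plancherel[OF g] cont_cs_L2_norm_sq[OF g])
    also have "\<dots> = ennreal (L2_norm_sq g)"
      by (subst ennreal_mult[symmetric]) auto
    finally show "coefficient_energy I int_lattice \<gamma> g = ennreal (L2_norm_sq g)" .
  qed
  then show ?thesis unfolding E .
qed

abbreviation matrix_power :: "real ^ 'n ^ 'n \<Rightarrow> nat \<Rightarrow> real ^ 'n ^ 'n"
  where "matrix_power A n \<equiv> (((**) A) ^^ n) (mat 1)"

lemma matrix_power_commute: "matrix_power A n ** A = A ** matrix_power A n"
  by (induction n) (simp_all add: matrix_mul_assoc[symmetric])

lemma matrix_power_inverse:
  assumes "A ** B = mat 1" shows "matrix_power A n ** matrix_power B n = mat 1"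
proof (induction n)
  case (Suc n)
  have "matrix_power A (Suc n) ** matrix_power B (Suc n) = (matrix_power A n ** A) ** (B ** matrix_power B n)"
    by (simp add: matrix_power_commute)
  also have "\<dots> = matrix_power A n ** (A ** B) ** matrix_power B n" by (simp only: matrix_mul_assoc)
  also have "\<dots> = mat 1" by (simp add: assms Suc)
  finally show ?case .
qed simp

lemma matrix_inv_unique:
  fixes A :: "real ^ 'n ^ 'n"
  assumes "A ** B = mat 1" "B ** A = mat 1" shows "matrix_inv A = B"
proof -
  have "invertible A" using assms by (auto simp: invertible_def)
  then have "matrix_inv A = B ** A ** matrix_inv A" by (simp add: assms)
  also have "\<dots> = B" using matrix_inv_inverse(1)[OF \<open>invertible A\<close>] by (simp add: matrix_mul_assoc[symmetric])
  finally show ?thesis .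
qed

lemma transpose_matrix_power: "transpose (matrix_power A n) *v x = (((*v) (transpose A)) ^^ n) x"
proof (induction n arbitrary: x)
  case (Suc n)
  have "transpose (matrix_power A (Suc n)) *v x = transpose (matrix_power A n) *v (transpose A *v x)"
    by (simp add: matrix_transpose_mul matrix_vector_mul_assoc)
  then show ?case by (simp only: Suc funpow_Suc_right o_apply)
qed (simp add: transpose_mat)

text \<open>
  On the frequency side, scale \<open>j\<close> acts by the \<open>j\<close>-th power of the inverse transpose of \<open>M\<close>. For
  negative \<open>j\<close> this is a power of the transpose itself.
\<close>

lemma
  fixes M :: "real ^ 'n ^ 'n"
  assumes "invertible M"
  shows det_matrix_powi: "det (matrix_powi M j) \<noteq> 0"
    and transpose_inv_matrix_powi: "transpose (matrix_inv (matrix_powi M j)) *v x =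
      (if j \<ge> 0 then (((*v) (transpose (matrix_inv M))) ^^ nat j) x else (((*v) (transpose M)) ^^ nat (- j)) x)"
proof -
  let ?A = "matrix_inv M"
  define n where "n = nat (if j \<ge> 0 then j else - j)"
  have 1: "matrix_power M n ** matrix_power ?A n = mat 1" "matrix_power ?A n ** matrix_power M n = mat 1"
    by (intro matrix_power_inverse matrix_inv_inverse assms)+
  have inv: "matrix_inv (matrix_power M n) = matrix_power ?A n" "matrix_inv (matrix_power ?A n) = matrix_power M n"
    using 1 by (auto intro: matrix_inv_unique)
  show "transpose (matrix_inv (matrix_powi M j)) *v x =
      (if j \<ge> 0 then (((*v) (transpose (matrix_inv M))) ^^ nat j) x else (((*v) (transpose M)) ^^ nat (- j)) x)"
    using inv by (auto simp: matrix_powi_def n_def transpose_matrix_power)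
  have "det (matrix_power M n) * det (matrix_power ?A n) = 1" unfolding det_mul[symmetric] 1 by simp
  then show "det (matrix_powi M j) \<noteq> 0"
    by (auto simp: matrix_powi_def n_def split: if_splits)
qed

section \<open>Nested masks and the wavelet frame\<close>

lemma smooth_norm_square_linear:
  fixes L :: "real ^ 'd \<Rightarrow> real ^ 'd"
  assumes "linear L" shows "smooth (\<lambda>x. complex_of_real ((norm (L x))\<^sup>2))"
proof -
  have "smooth (\<lambda>x. \<Sum>i\<in>UNIV. complex_of_real (L x $ i) * complex_of_real (L x $ i))"
    using assms by (intro smooth_sum smooth_mult smooth_linear) (auto simp: linear_iff)
  then show ?thesis by (simp add: power2_norm_eq_inner inner_vec_def)
qed

text \<open>
  The masks are functions of a quadratic form \<open>Q\<close> that \<open>T\<close> contracts by the factor \<open>\<rho>\<close>. The step \<open>h\<close>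
  falls from one to zero between the levels \<open>\<rho> r\<close> and \<open>r\<close>, so \<open>s x \<noteq> 0\<close> implies \<open>Q x < r\<close>, hence
  \<open>Q (T x) < \<rho> r\<close> and \<open>s (T x) = 1\<close>. The level \<open>r\<close> is taken so small that the sets \<open>{x. Q x < r}\<close> and
  \<open>{x. Q (T x) < r}\<close> lie in the unit ball. The third function \<open>\<kappa>\<close> is the step at the next larger
  level \<open>r / \<rho>\<close>; it equals one on the support of \<open>s\<close> and cuts off functions built from \<open>c\<close>, which is not
  compactly supported, before they are periodized.
\<close>

lemma smooth_masks:
  fixes M :: "real ^ 'd ^ 'd"
  assumes M: "expansive M"
  defines "T \<equiv> (*v) (transpose (matrix_inv M))" and "S \<equiv> (*v) (transpose M)"
  obtains s c \<kappa> :: "real ^ 'd \<Rightarrow> real" and V where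
    "smooth (\<lambda>x. complex_of_real (s x))" "smooth (\<lambda>x. complex_of_real (c x))" "smooth (\<lambda>x. complex_of_real (\<kappa> x))"
    "\<And>x. s (- x) = s x" "\<And>x. c (- x) = c x"
    "\<And>x. (s x)\<^sup>2 + (c x)\<^sup>2 = 1"
    "\<And>x. s x \<noteq> 0 \<Longrightarrow> s (T x) = 1"
    "\<And>x. s x \<noteq> 0 \<Longrightarrow> norm x \<le> 1" "\<And>x. s (T x) \<noteq> 0 \<Longrightarrow> norm x \<le> 1"
    "\<And>x. s x \<noteq> 0 \<Longrightarrow> \<kappa> x = 1" "\<And>x. \<kappa> x \<noteq> 0 \<Longrightarrow> norm x \<le> 1"
    "open V" "0 \<in> V" "\<And>x. x \<in> V \<Longrightarrow> s x = 1"
    "\<And>x. \<exists>n. \<forall>m\<ge>n. s ((T ^^ m) x) = 1"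
    "\<And>x. x \<noteq> 0 \<Longrightarrow> \<exists>n. \<forall>m\<ge>n. s ((S ^^ m) x) = 0"
proof -
  have inv: "invertible M" by (rule expansive_invertible[OF M])
  have d: "det M \<noteq> 0" using inv by (simp add: invertible_det_nz)
  have TS: "T (S x) = x" "S (T x) = x" for x
    unfolding T_def S_def by (rule matrix_inv_transpose[OF d])+
  have linT: "linear T" "linear S" unfolding T_def S_def by (rule matrix_vector_mul_linear)+
  have limT: "(\<lambda>n. (T ^^ n) x) \<longlonglongrightarrow> 0" for x
    unfolding T_def by (rule power_transpose_matrix_inv_tendsto_0[OF M])
  obtain \<rho> N where \<rho>: "0 < \<rho>" "\<rho> < 1" and
    QT: "\<And>x. (\<Sum>n<N. (norm ((T ^^ n) (T x)))\<^sup>2) \<le> \<rho> * (\<Sum>n<N. (norm ((T ^^ n) x))\<^sup>2)" and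
    Qn: "\<And>x. (norm x)\<^sup>2 \<le> (\<Sum>n<N. (norm ((T ^^ n) x))\<^sup>2)"
    by (rule lyapunov_form[OF linT(1) limT]) (rule that)
  define Q where "Q x = (\<Sum>n<N. (norm ((T ^^ n) x))\<^sup>2)" for x
  note QT = QT[folded Q_def] and Qn = Qn[folded Q_def]
  have linTn: "linear (T ^^ n)" for n by (rule linear_funpow[OF linT(1)])
  have sQ: "smooth (\<lambda>x. complex_of_real (Q x))"
    unfolding Q_def of_real_sum by (intro smooth_sum smooth_norm_square_linear linTn)
  have cQ: "continuous_on UNIV Q"
    unfolding Q_def using linTn by (intro continuous_intros linear_continuous_on) (simp add: linear_conv_bounded_linear)
  have Q0: "Q 0 = 0" using linear_0[OF linTn] by (simp add: Q_def)
  have Qm: "Q (- x) = Q x" for x using linear_neg[OF linTn] by (simp add: Q_def)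
  obtain K where K: "K > 0" "\<And>x. norm (S x) \<le> norm x * K"
    using bounded_linear.pos_bounded[of S] linT(2) linear_conv_bounded_linear by blast
  \<comment> \<open>\<open>K\<close> bounds the norm of \<open>S\<close>, so \<open>r * K\<^sup>2 \<le> 1\<close> puts the set of all \<open>x\<close> with \<open>Q (T x) < r\<close> into the unit ball\<close>
  define r where "r = min \<rho> (1 / K\<^sup>2)"
  have r: "r > 0" "r \<le> \<rho>" "r * K\<^sup>2 \<le> 1" using \<rho> K(1) by (auto simp: r_def min_def field_simps)
  define h where "h q x = cutoff \<rho> (Q x * inverse q)" for q x
  have sh: "smooth (\<lambda>x. complex_of_real (h q x))" for q
    unfolding h_def by (rule smooth_cutoff[OF _ \<rho>(2)]) (use smooth_mult[OF sQ smooth_const[of "complex_of_real (inverse q)"]] in simp)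
  have h1: "h q x = 1" if "Q x \<le> \<rho> * q" "q > 0" for q x
    unfolding h_def using that by (intro cutoff_eq_1 \<rho>) (simp add: field_simps)
  have h0: "Q x < q" if "h q x \<noteq> 0" "q > 0" for q x
  proof (rule ccontr)
    assume "\<not> Q x < q"
    then have "h q x = 0" unfolding h_def using that(2) by (intro cutoff_eq_0) (simp add: field_simps)
    then show False using that by simp
  qed
  define s where "s x = sin (h r x * (pi / 2))" for x
  define c where "c x = cos (h r x * (pi / 2))" for x
  have sm: "smooth (\<lambda>x. complex_of_real (h r x * (pi / 2)))"
    using smooth_mult[OF sh[of r] smooth_const[of "complex_of_real (pi / 2)"]] by simp
  have s1: "s x = 1" if "Q x \<le> \<rho> * r" for x using h1[OF that r(1)] by (simp add: s_def)
  have s0: "Q x < r" if "s x \<noteq> 0" for x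
  proof (rule h0[OF _ r(1)])
    show "h r x \<noteq> 0" using that by (auto simp: s_def)
  qed
  have small: "norm x \<le> 1" if "Q x \<le> 1" for x
    using abs_square_le_1[of "norm x"] Qn[of x] that by simp
  have rr: "r / \<rho> > 0" "r / \<rho> \<le> 1" using r \<rho> by auto
  show thesis
  proof (rule that[of s c "h (r / \<rho>)" "{x. Q x < \<rho> * r}"])
    show "smooth (\<lambda>x. complex_of_real (s x))" unfolding s_def by (rule smooth_sin[OF sm])
    show "smooth (\<lambda>x. complex_of_real (c x))" unfolding c_def by (rule smooth_cos[OF sm])
    show "smooth (\<lambda>x. complex_of_real (h (r / \<rho>) x))" by (rule sh)
    show "s (- x) = s x" "c (- x) = c x" for x by (simp_all add: s_def c_def h_def Qm)
    show "(s x)\<^sup>2 + (c x)\<^sup>2 = 1" for x by (simp add: s_def c_def)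
    show "s (T x) = 1" if "s x \<noteq> 0" for x
    proof (rule s1)
      have "\<rho> * Q x \<le> \<rho> * r" using s0[OF that] \<rho> by (intro mult_left_mono) auto
      then show "Q (T x) \<le> \<rho> * r" using QT[of x] by simp
    qed
    show "norm x \<le> 1" if "s x \<noteq> 0" for x
      using s0[OF that] r \<rho> by (intro small) simp
    show "norm x \<le> 1" if "s (T x) \<noteq> 0" for x
    proof -
      have "(norm (T x))\<^sup>2 \<le> r" using s0[OF that] Qn[of "T x"] by simp
      then have "(norm (T x))\<^sup>2 * K\<^sup>2 \<le> r * K\<^sup>2" by (intro mult_right_mono) auto
      then have "(norm (T x) * K)\<^sup>2 \<le> 1" using r by (simp add: power_mult_distrib)
      then have "norm (T x) * K \<le> 1" using K(1) abs_square_le_1[of "norm (T x) * K"] by simp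
      then show ?thesis using K(2)[of "T x"] by (simp add: TS)
    qed
    show "h (r / \<rho>) x = 1" if "s x \<noteq> 0" for x
      using s0[OF that] \<rho> by (intro h1 rr) simp
    show "norm x \<le> 1" if "h (r / \<rho>) x \<noteq> 0" for x
      using h0[OF that rr(1)] rr by (intro small) simp
    show "open {x. Q x < \<rho> * r}" by (intro open_Collect_less cQ continuous_intros)
    show "0 \<in> {x. Q x < \<rho> * r}" using \<rho> r by (simp add: Q0)
    show "s x = 1" if "x \<in> {x. Q x < \<rho> * r}" for x using that by (intro s1) simp
    have Qpow: "Q ((T ^^ m) x) \<le> \<rho> ^ m * Q x" for m x
    proof (induction m)
      case (Suc m)
      have "Q ((T ^^ Suc m) x) \<le> \<rho> * Q ((T ^^ m) x)" using QT[of "(T ^^ m) x"] by simp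
      also have "\<dots> \<le> \<rho> * (\<rho> ^ m * Q x)" using Suc \<rho> by (intro mult_left_mono) auto
      finally show ?case by (simp add: mult.assoc)
    qed simp
    have lim: "(\<lambda>m. \<rho> ^ m * b) \<longlonglongrightarrow> 0" for b :: real
      using tendsto_mult[OF LIMSEQ_power_zero[of \<rho>] tendsto_const[of b]] \<rho> by simp
    show "\<exists>n. \<forall>m\<ge>n. s ((T ^^ m) x) = 1" for x
    proof -
      have "\<forall>\<^sub>F m in sequentially. \<rho> ^ m * Q x < \<rho> * r"
        using lim[of "Q x"] \<rho> r by (intro order_tendstoD(2)) auto
      then obtain n where n: "\<And>m. m \<ge> n \<Longrightarrow> \<rho> ^ m * Q x < \<rho> * r" by (auto simp: eventually_sequentially)
      have "s ((T ^^ m) x) = 1" if "m \<ge> n" for m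
        using n[OF that] Qpow[of m x] by (intro s1) simp
      then show ?thesis by blast
    qed
    show "\<exists>n. \<forall>m\<ge>n. s ((S ^^ m) x) = 0" if "x \<noteq> 0" for x
    proof -
      have "Q x > 0"
      proof -
        have "0 < (norm x)\<^sup>2" using that by simp
        then show ?thesis using Qn[of x] by linarith
      qed
      then have "\<forall>\<^sub>F m in sequentially. \<rho> ^ m * r < Q x"
        using lim[of r] by (intro order_tendstoD(2)) auto
      then obtain n where n: "\<And>m. m \<ge> n \<Longrightarrow> \<rho> ^ m * r < Q x" by (auto simp: eventually_sequentially)
      have TSm: "(T ^^ m) ((S ^^ m) x) = x" for m
        by (induction m) (simp_all add: funpow_swap1[of T] TS)
      have "s ((S ^^ m) x) = 0" if "m \<ge> n" for m
      proof (rule ccontr)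
        assume "s ((S ^^ m) x) \<noteq> 0"
        then have "Q ((S ^^ m) x) \<le> r" using s0 by (simp add: less_imp_le)
        then have "\<rho> ^ m * Q ((S ^^ m) x) \<le> \<rho> ^ m * r" using \<rho> by (intro mult_left_mono) auto
        then show False using n[OF that] Qpow[of m "(S ^^ m) x"] by (simp add: TSm)
      qed
      then show ?thesis by blast
    qed
  qed
qed

lemma sum_telescope_int: "(\<Sum>j\<in>{J..<J + int n}. a (j + 1) - a j) = a (J + int n) - (a J :: real)"
proof (induction n)
  case (Suc n)
  have "{J..<J + int (Suc n)} = insert (J + int n) {J..<J + int n}" by auto
  then show ?case using Suc by (simp add: algebra_simps)
qed simp

text \<open>
  Only finitely many terms are nonzero, since \<open>a\<close> is eventually one.
\<close>

lemma infsum_telescope_int: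
  fixes a :: "int \<Rightarrow> real"
  assumes mono: "\<And>j. a j \<le> a (j + 1)" and one: "\<And>j. j \<ge> J1 \<Longrightarrow> a j = 1"
  shows "(\<Sum>\<^sub>\<infinity>j\<in>{J..}. ennreal (a (j + 1) - a j)) = ennreal (1 - a J)"
proof -
  define n where "n = nat (J1 - J)"
  have ge: "J + int n \<ge> J1" by (simp add: n_def)
  have "(\<Sum>\<^sub>\<infinity>j\<in>{J..}. ennreal (a (j + 1) - a j)) = (\<Sum>\<^sub>\<infinity>j\<in>{J..<J + int n}. ennreal (a (j + 1) - a j))"
  proof (rule infsum_cong_neutral)
    fix j assume "j \<in> {J..} - {J..<J + int n}"
    then have "j \<ge> J1" using ge by auto
    then show "ennreal (a (j + 1) - a j) = 0" using one[of j] one[of "j + 1"] by simp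
  qed auto
  also have "\<dots> = (\<Sum>j\<in>{J..<J + int n}. ennreal (a (j + 1) - a j))" by (rule infsum_finite) simp
  also have "\<dots> = ennreal (\<Sum>j\<in>{J..<J + int n}. a (j + 1) - a j)"
    using mono by (intro sum_ennreal) simp
  also have "\<dots> = ennreal (1 - a J)" by (simp add: sum_telescope_int one[OF ge])
  finally show ?thesis .
qed

theorem theorem2:
  fixes M :: "real ^ 'd ^ 'd"
  assumes "expansive M"
  shows "\<exists>\<phi> \<psi> :: real ^ 'd \<Rightarrow> complex.
    \<phi> \<in> schwartz \<and> \<psi> \<in> schwartz \<and> (\<forall>x. \<phi> x \<in> \<real>) \<and> (\<forall>x. \<psi> x \<in> \<real>) \<and>
    (\<forall>J::int. \<forall>f\<in>L2. ennreal (L2_norm_sq f) =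
        level_energy \<phi> (matrix_powi M J) f +
        (\<Sum>\<^sub>\<infinity>j\<in>{J..}. level_energy \<psi> (matrix_powi M j) f)) \<and>
    (compactly_supported (fourier \<phi>) \<and> smooth (fourier \<phi>) \<and> even_fun (fourier \<phi>) \<and>
     compactly_supported (fourier \<psi>) \<and> smooth (fourier \<psi>) \<and> even_fun (fourier \<psi>)) \<and>
    ((\<forall>\<^sub>F \<xi> in nhds 0. fourier \<psi> \<xi> = 0) \<and>
     (\<forall>\<alpha>. (LINT x|lebesgue. complex_of_real (monomial \<alpha> x) * \<psi> x) = 0)) \<and>
    (\<exists>a b :: real ^ 'd \<Rightarrow> real ^ 'd \<Rightarrow> complex. \<forall>k\<in>int_lattice.
        a k \<in> smooth_torus \<and> b k \<in> smooth_torus \<and>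
        (\<forall>\<xi>. exp (- (\<i> * complex_of_real (k \<bullet> (transpose M *v \<xi>)))) * fourier \<phi> (transpose M *v \<xi>)
              = a k \<xi> * fourier \<phi> \<xi> \<and>
             exp (- (\<i> * complex_of_real (k \<bullet> (transpose M *v \<xi>)))) * fourier \<psi> (transpose M *v \<xi>)
              = b k \<xi> * fourier \<phi> \<xi>)) \<and>
    (\<forall>f\<in>L2. ennreal (L2_norm_sq f) =
        (\<Sum>\<^sub>\<infinity>j\<in>(UNIV::int set). level_energy \<psi> (matrix_powi M j) f))"
proof -
  define T where "T = (*v) (transpose (matrix_inv M))"
  define S where "S = (*v) (transpose M)"
  have inv: "invertible M" by (rule expansive_invertible[OF assms])
  have d: "det M \<noteq> 0" using inv by (simp add: invertible_det_nz)
  have TS: "T (S x) = x" "S (T x) = x" for x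
    unfolding T_def S_def by (rule matrix_inv_transpose[OF d])+
  have linT: "linear T" and linS: "linear S" unfolding T_def S_def by (rule matrix_vector_mul_linear)+
  obtain s c \<kappa> :: "real ^ 'd \<Rightarrow> real" and V where
    sm: "smooth (\<lambda>x. complex_of_real (s x))" "smooth (\<lambda>x. complex_of_real (c x))" "smooth (\<lambda>x. complex_of_real (\<kappa> x))"
    and even: "\<And>x. s (- x) = s x" "\<And>x. c (- x) = c x"
    and sc: "\<And>x. (s x)\<^sup>2 + (c x)\<^sup>2 = 1"
    and sT: "\<And>x. s x \<noteq> 0 \<Longrightarrow> s (T x) = 1"
    and supp: "\<And>x. s x \<noteq> 0 \<Longrightarrow> norm x \<le> 1" "\<And>x. s (T x) \<noteq> 0 \<Longrightarrow> norm x \<le> 1"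
    and chi: "\<And>x. s x \<noteq> 0 \<Longrightarrow> \<kappa> x = 1" "\<And>x. \<kappa> x \<noteq> 0 \<Longrightarrow> norm x \<le> 1"
    and V: "open V" "0 \<in> V" "\<And>x. x \<in> V \<Longrightarrow> s x = 1"
    and orbit_1: "\<And>x. \<exists>n. \<forall>m\<ge>n. s ((T ^^ m) x) = 1"
    and orbit_0: "\<And>x. x \<noteq> 0 \<Longrightarrow> \<exists>n. \<forall>m\<ge>n. s ((S ^^ m) x) = 0"
    by (rule smooth_masks[OF assms, folded T_def S_def]) (rule that)
  \<comment> \<open>the transform of \<open>\<psi>\<close>; the two-scale relation \<open>g\<^sup>2 + s\<^sup>2 = s\<^sup>2 \<circ> T\<close> holds since \<open>s \<circ> T = 1\<close> on the support of \<open>s\<close>\<close>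
  define g where "g x = s (T x) * c x" for x
  define G where "G x = complex_of_real (s x)" for x
  define H where "H x = complex_of_real (g x)" for x
  define W where "W = - cball (0 :: real ^ 'd) 1"
  have W: "open W" "bounded (- W)" "bounded (- (V \<union> W))" unfolding W_def by (auto intro: bounded_subset[OF bounded_cball])
  have sW: "s x = 0" if "x \<in> W" for x using supp(1)[of x] that by (auto simp: W_def)
  have G: "bump W G" unfolding bump_def G_def using W(1,2) sm(1) sW by simp
  have csup: "s (T x) = 0" if "x \<in> W" for x using supp(2)[of x] that by (auto simp: W_def)
  have c0: "c x = 0" if "x \<in> V" for x using sc[of x] V(3)[OF that] by simp
  have H: "bump (V \<union> W) H"
  proof -
    have "smooth H"
      unfolding H_def g_def of_real_mult by (intro smooth_mult smooth_compose_linear[OF sm(1)] linT sm(2))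
    moreover have "H x = 0" if "x \<in> V \<union> W" for x using that c0 csup by (auto simp: H_def g_def)
    ultimately show ?thesis using W V(1) by (auto simp: bump_def)
  qed
  have suppG: "norm x \<le> 1" if "G x \<noteq> 0" for x using that supp(1) by (simp add: G_def)
  have suppH: "norm x \<le> 1" if "H x \<noteq> 0" for x using that supp(2) by (simp add: H_def g_def)
  have TSuminus: "T (- x) = - T x" for x using linear_neg[OF linT] .
  have gm: "g (- x) = g x" for x by (simp add: g_def TSuminus even)
  define \<phi> where "\<phi> = ift G"
  define \<psi> where "\<psi> = ift H"
  have F\<phi>: "fourier \<phi> = G" unfolding \<phi>_def by (rule fourier_ift[OF G])
  have F\<psi>: "fourier \<psi> = H" unfolding \<psi>_def by (rule fourier_ift[OF H])
  have real: "\<phi> x \<in> \<real>" "\<psi> x \<in> \<real>" for x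
  proof -
    show "\<phi> x \<in> \<real>" unfolding \<phi>_def G_def[abs_def]
      by (rule ift_real) (use bump_cs[OF G] in \<open>simp_all add: G_def[abs_def] even\<close>)
    show "\<psi> x \<in> \<real>" unfolding \<psi>_def H_def[abs_def]
      by (rule ift_real) (use bump_cs[OF H] in \<open>simp_all add: H_def[abs_def] gm\<close>)
  qed
  \<comment> \<open>the orbit of \<open>x\<close> under the dual dilation; going up one scale applies \<open>T\<close>\<close>
  define Y where "Y j x = transpose (matrix_inv (matrix_powi M j)) *v x" for j x
  have Y: "Y j x = (if j \<ge> 0 then (T ^^ nat j) x else (S ^^ nat (- j)) x)" for j x
    unfolding Y_def T_def S_def by (rule transpose_inv_matrix_powi[OF inv])
  have Y_step: "Y (j + 1) x = T (Y j x)" for j x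
  proof (cases "j \<ge> 0")
    case True then show ?thesis by (simp add: Y nat_add_distrib)
  next
    case False
    then obtain m where m: "j = - int (Suc m)" by (metis not_le nonneg_int_cases neg_int_cases of_nat_Suc minus_add_distrib zless_iff_Suc_zadd negD)
    then show ?thesis by (auto simp: Y TS nat_add_distrib split: if_splits)
  qed
  define A where "A x j = (s (Y j x))\<^sup>2" for x j
  have sum1: "(cmod (H (Y j x)))\<^sup>2 = A x (j + 1) - A x j" for j x
  proof -
    have "(cmod (H (Y j x)))\<^sup>2 = (s (T (Y j x)))\<^sup>2 * (c (Y j x))\<^sup>2"
      by (simp add: H_def g_def norm_mult power_mult_distrib)
    also have "\<dots> = (s (T (Y j x)))\<^sup>2 - (s (T (Y j x)))\<^sup>2 * (s (Y j x))\<^sup>2"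
    proof -
      have "(c (Y j x))\<^sup>2 = 1 - (s (Y j x))\<^sup>2" using sc[of "Y j x"] by linarith
      then show ?thesis by (simp only: right_diff_distrib mult_1_right)
    qed
    also have "(s (T (Y j x)))\<^sup>2 * (s (Y j x))\<^sup>2 = (s (Y j x))\<^sup>2" using sT[of "Y j x"] by (cases "s (Y j x) = 0") auto
    finally show ?thesis by (simp add: A_def Y_step)
  qed
  have A_mono: "A x j \<le> A x (j + 1)" for x j using sum1[of j x] by (smt (verit) zero_le_power2)
  have A_le: "0 \<le> A x j" "A x j \<le> 1" for x j
    unfolding A_def using sc[of "Y j x"] zero_le_power2[of "c (Y j x)"] zero_le_power2[of "s (Y j x)"] by linarith+
  have A_one: "\<exists>J1. \<forall>j\<ge>J1. A x j = 1" for x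
  proof -
    obtain n where "\<forall>m\<ge>n. s ((T ^^ m) x) = 1" using orbit_1 by blast
    then show ?thesis by (intro exI[of _ "int n"]) (auto simp: A_def Y)
  qed
  have A_zero: "\<exists>J0. \<forall>j\<le>J0. A x j = 0" if nz: "x \<noteq> 0" for x
  proof -
    obtain n where "\<forall>m\<ge>n. s ((S ^^ m) x) = 0" using orbit_0[OF nz] by blast
    then show ?thesis by (intro exI[of _ "- int n - 1"]) (auto simp: A_def Y)
  qed
  have tail: "(\<Sum>\<^sub>\<infinity>j\<in>{J..}. ennreal ((cmod (H (Y j x)))\<^sup>2)) = ennreal (1 - A x J)" for J x
  proof -
    obtain J1 where "\<And>j. j \<ge> J1 \<Longrightarrow> A x j = 1" using A_one[of x] by blast
    then show ?thesis unfolding sum1 by (intro infsum_telescope_int[where ?J1.0 = J1] A_mono)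
  qed
  have nonhomogeneous: "ennreal (L2_norm_sq f) = level_energy \<phi> (matrix_powi M J) f +
        (\<Sum>\<^sub>\<infinity>j\<in>{J..}. level_energy \<psi> (matrix_powi M j) f)" if f: "f \<in> L2" for J f
  proof -
    \<comment> \<open>the scaling function has index \<open>None\<close>, the wavelet at scale \<open>j\<close> has index \<open>Some j\<close>\<close>
    let ?I = "insert None (Some ` {J..})"
    let ?G = "\<lambda>i. case i of None \<Rightarrow> G | Some j \<Rightarrow> H"
    let ?U = "\<lambda>i. case i of None \<Rightarrow> matrix_powi M J | Some j \<Rightarrow> matrix_powi M j"
    have split: "(\<Sum>\<^sub>\<infinity>i\<in>?I. F i) = F None + (\<Sum>\<^sub>\<infinity>j\<in>{J..}. F (Some j))" for F :: "int option \<Rightarrow> ennreal"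
    proof -
      have "(\<Sum>\<^sub>\<infinity>i\<in>?I. F i) = F None + (\<Sum>\<^sub>\<infinity>i\<in>Some ` {J..}. F i)"
        by (rule infsum_insert) (auto intro: nonneg_summable_on_complete)
      then show ?thesis by (simp add: infsum_reindex o_def)
    qed
    have "(\<Sum>\<^sub>\<infinity>i\<in>?I. level_energy (ift (?G i)) (?U i) f) = ennreal (L2_norm_sq f)"
    proof (rule tight_frame_criterion[OF _ _ _ _ _ f])
      show "bump (case i of None \<Rightarrow> W | Some j \<Rightarrow> V \<union> W) (?G i)" for i using G H by (simp split: option.split)
      show "norm \<xi> \<le> 1" if "?G i \<xi> \<noteq> 0" for i \<xi> using that suppG suppH by (auto split: option.splits)
      show "det (?U i) \<noteq> 0" for i using det_matrix_powi[OF inv] by (simp split: option.split)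
      fix \<eta> :: "real ^ 'd"
      show "(\<Sum>\<^sub>\<infinity>i\<in>?I. ennreal ((cmod (?G i (transpose (matrix_inv (?U i)) *v \<eta>)))\<^sup>2)) = 1"
      proof -
        have "(\<Sum>\<^sub>\<infinity>i\<in>?I. ennreal ((cmod (?G i (transpose (matrix_inv (?U i)) *v \<eta>)))\<^sup>2))
          = ennreal ((cmod (G (Y J \<eta>)))\<^sup>2) + (\<Sum>\<^sub>\<infinity>j\<in>{J..}. ennreal ((cmod (H (Y j \<eta>)))\<^sup>2))"
          unfolding split by (simp add: Y_def)
        also have "\<dots> = ennreal (A \<eta> J) + ennreal (1 - A \<eta> J)" unfolding tail by (simp add: G_def A_def)
        also have "\<dots> = 1" using A_le[of \<eta> J] by (simp flip: ennreal_plus)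
        finally show ?thesis .
      qed
    qed simp
    then show ?thesis unfolding split by (simp add: \<phi>_def \<psi>_def)
  qed
  have homogeneous: "ennreal (L2_norm_sq f) = (\<Sum>\<^sub>\<infinity>j\<in>(UNIV::int set). level_energy \<psi> (matrix_powi M j) f)" if f: "f \<in> L2" for f
  proof -
    have "(\<Sum>\<^sub>\<infinity>j\<in>(UNIV::int set). level_energy (ift H) (matrix_powi M j) f) = ennreal (L2_norm_sq f)"
    proof (rule tight_frame_criterion[where W = "\<lambda>_. V \<union> W", OF _ H suppH _ _ f])
      show "det (matrix_powi M j) \<noteq> 0" for j by (rule det_matrix_powi[OF inv])
      fix \<eta> :: "real ^ 'd" assume "\<eta> \<noteq> 0"
      then obtain J0 where J0: "\<And>j. j \<le> J0 \<Longrightarrow> A \<eta> j = 0" using A_zero by blast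
      have "(\<Sum>\<^sub>\<infinity>j\<in>UNIV. ennreal ((cmod (H (Y j \<eta>)))\<^sup>2)) = (\<Sum>\<^sub>\<infinity>j\<in>{J0..}. ennreal ((cmod (H (Y j \<eta>)))\<^sup>2))"
        unfolding sum1 by (rule infsum_cong_neutral) (auto simp: J0)
      also have "\<dots> = 1" unfolding tail by (simp add: J0)
      finally show "(\<Sum>\<^sub>\<infinity>j\<in>UNIV. ennreal ((cmod (H (transpose (matrix_inv (matrix_powi M j)) *v \<eta>)))\<^sup>2)) = 1"
        by (simp add: Y_def)
    qed auto
    then show ?thesis by (simp add: \<psi>_def)
  qed
  have compact: "compactly_supported F" if "bump Z F" for Z and F :: "real ^ 'd \<Rightarrow> complex"
    using bump_cs[OF that] by (simp add: compactly_supported_def cont_cs_def compact_closure)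
  define e where "e k \<xi> = exp (- (\<i> * complex_of_real (k \<bullet> S \<xi>)))" for k \<xi>
  have e: "smooth (e k)" for k
  proof -
    have "smooth (\<lambda>\<xi>. exp ((- \<i>) * complex_of_real (k \<bullet> S \<xi>)))"
      using linS by (intro smooth_exp smooth_mult smooth_const smooth_linear) (simp add: linear_iff inner_right_distrib)
    then show ?thesis by (simp add: e_def[abs_def])
  qed
  \<comment> \<open>on the support of \<open>s\<close> these are the quotients of the two sides; their supports lie in the unit ball, so they can be periodized\<close>
  define a0 where "a0 k \<xi> = e k \<xi> * complex_of_real (s (S \<xi>))" for k \<xi>
  define b0 where "b0 k \<xi> = e k \<xi> * complex_of_real (c (S \<xi>)) * complex_of_real (\<kappa> \<xi>)" for k \<xi>
  have sS: "s \<xi> = 1" if "s (S \<xi>) \<noteq> 0" for \<xi> using sT[OF that] by (simp add: TS)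
  have sm0: "smooth (a0 k)" "smooth (b0 k)" for k
    unfolding a0_def b0_def
    by (intro smooth_mult e sm(3) smooth_compose_linear[OF sm(1)] smooth_compose_linear[OF sm(2)] linS)+
  have supp0: "norm \<xi> \<le> 1" if "a0 k \<xi> \<noteq> 0 \<or> b0 k \<xi> \<noteq> 0" for k \<xi>
    using that sS[of \<xi>] supp(1)[of \<xi>] chi(2)[of \<xi>] by (auto simp: a0_def b0_def)
  have comp: "\<bar>\<xi> $ i\<bar> \<le> 1" if "norm \<xi> \<le> 1" for \<xi> :: "real ^ 'd" and i
    using component_le_norm_cart[of \<xi> i] that by simp
  have torus: "(\<lambda>\<xi>. F (wrap \<xi>)) \<in> smooth_torus" if "smooth F" "\<And>\<xi>. F \<xi> \<noteq> 0 \<Longrightarrow> norm \<xi> \<le> 1" for F :: "real ^ 'd \<Rightarrow> complex"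
  proof -
    have "smooth (\<lambda>\<xi>. F (wrap \<xi>))"
    proof (rule smooth_wrap[OF that(1)])
      fix \<xi> i assume "F \<xi> \<noteq> 0"
      then have "\<bar>\<xi> $ i\<bar> \<le> 1" by (intro comp that(2))
      then show "\<bar>\<xi> $ i\<bar> \<le> pi / 2" using pi_gt3 by simp
    qed
    then show ?thesis by (simp add: smooth_torus_def wrap_periodic)
  qed
  have wrap_self: "wrap \<xi> = \<xi>" if "norm \<xi> \<le> 1" for \<xi> :: "real ^ 'd"
  proof (rule wrap_eq_self)
    fix i show "\<bar>\<xi> $ i\<bar> < pi" using comp[OF that, of i] pi_gt3 by simp
  qed
  have refine: "e k \<xi> * G (S \<xi>) = a0 k (wrap \<xi>) * G \<xi>" "e k \<xi> * H (S \<xi>) = b0 k (wrap \<xi>) * G \<xi>" for k \<xi>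
  proof -
    have "e k \<xi> * G (S \<xi>) = a0 k (wrap \<xi>) * G \<xi> \<and> e k \<xi> * H (S \<xi>) = b0 k (wrap \<xi>) * G \<xi>"
    proof (cases "s \<xi> = 0")
      case True
      then have "s (S \<xi>) = 0" using sS[of \<xi>] by auto
      then show ?thesis using True by (simp add: G_def H_def g_def TS)
    next
      case False
      then have w: "wrap \<xi> = \<xi>" by (intro wrap_self supp(1))
      have "s (S \<xi>) = s (S \<xi>) * s \<xi>" using sS[of \<xi>] by (cases "s (S \<xi>) = 0") auto
      then have "complex_of_real (s (S \<xi>)) = complex_of_real (s (S \<xi>)) * complex_of_real (s \<xi>)" by (metis of_real_mult)
      then show ?thesis
        using chi(1)[OF False] by (simp add: w a0_def b0_def G_def H_def g_def TS mult_ac)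
    qed
    then show "e k \<xi> * G (S \<xi>) = a0 k (wrap \<xi>) * G \<xi>" "e k \<xi> * H (S \<xi>) = b0 k (wrap \<xi>) * G \<xi>" by blast+
  qed
  show ?thesis
  proof (rule exI[of _ \<phi>], rule exI[of _ \<psi>], intro conjI allI ballI)
    show "\<phi> \<in> schwartz" "\<psi> \<in> schwartz" unfolding \<phi>_def \<psi>_def by (rule ift_schwartz[OF G] ift_schwartz[OF H])+
    show "\<phi> x \<in> \<real>" "\<psi> x \<in> \<real>" for x by (rule real)+
    show "ennreal (L2_norm_sq f) = level_energy \<phi> (matrix_powi M J) f +
        (\<Sum>\<^sub>\<infinity>j\<in>{J..}. level_energy \<psi> (matrix_powi M j) f)" if "f \<in> L2" for J f
      by (rule nonhomogeneous[OF that])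
    show "compactly_supported (fourier \<phi>)" "compactly_supported (fourier \<psi>)"
      unfolding F\<phi> F\<psi> by (rule compact[OF G] compact[OF H])+
    show "smooth (fourier \<phi>)" "smooth (fourier \<psi>)" unfolding F\<phi> F\<psi> using G H by (auto simp: bump_def)
    show "even_fun (fourier \<phi>)" "even_fun (fourier \<psi>)"
      unfolding F\<phi> F\<psi> by (auto simp: even_fun_def G_def H_def even gm)
    show "\<forall>\<^sub>F \<xi> in nhds 0. fourier \<psi> \<xi> = 0"
      unfolding F\<psi> eventually_nhds using V c0 by (intro exI[of _ V]) (auto simp: H_def g_def)
    show "(LINT x|lebesgue. complex_of_real (monomial \<alpha> x) * \<psi> x) = 0" for \<alpha>
      unfolding \<psi>_def by (rule ift_moments_vanish[OF H]) (use V in simp)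
    show "ennreal (L2_norm_sq f) = (\<Sum>\<^sub>\<infinity>j\<in>(UNIV::int set). level_energy \<psi> (matrix_powi M j) f)" if "f \<in> L2" for f
      by (rule homogeneous[OF that])
    show "\<exists>a b :: real ^ 'd \<Rightarrow> real ^ 'd \<Rightarrow> complex. \<forall>k\<in>int_lattice.
        a k \<in> smooth_torus \<and> b k \<in> smooth_torus \<and>
        (\<forall>\<xi>. exp (- (\<i> * complex_of_real (k \<bullet> (transpose M *v \<xi>)))) * fourier \<phi> (transpose M *v \<xi>)
              = a k \<xi> * fourier \<phi> \<xi> \<and>
             exp (- (\<i> * complex_of_real (k \<bullet> (transpose M *v \<xi>)))) * fourier \<psi> (transpose M *v \<xi>)
              = b k \<xi> * fourier \<phi> \<xi>)"
    proof (rule exI[of _ "\<lambda>k \<xi>. a0 k (wrap \<xi>)"], rule exI[of _ "\<lambda>k \<xi>. b0 k (wrap \<xi>)"], intro ballI conjI allI)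
      fix k :: "real ^ 'd" and \<xi> :: "real ^ 'd"
      show "(\<lambda>\<xi>. a0 k (wrap \<xi>)) \<in> smooth_torus" "(\<lambda>\<xi>. b0 k (wrap \<xi>)) \<in> smooth_torus"
        using supp0 by (auto intro!: torus sm0)
      show "exp (- (\<i> * complex_of_real (k \<bullet> (transpose M *v \<xi>)))) * fourier \<phi> (transpose M *v \<xi>)
          = a0 k (wrap \<xi>) * fourier \<phi> \<xi>"
        using refine(1)[of k \<xi>] by (simp only: F\<phi> e_def S_def)
      show "exp (- (\<i> * complex_of_real (k \<bullet> (transpose M *v \<xi>)))) * fourier \<psi> (transpose M *v \<xi>)
          = b0 k (wrap \<xi>) * fourier \<phi> \<xi>"
        using refine(2)[of k \<xi>] by (simp only: F\<phi> F\<psi> e_def S_def)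
    qed
  qed
qed

end
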